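(* Let $Q_1,Q_2\in\mathbb{N}$ and let $\Lambda\subset Q_1^{-1}\mathbb{Z}\times Q_2^{-1}\mathbb{Z}$ be a finite set satisfying the separation condition $$\max\{|\lambda_1-\lambda_1'|,|\lambda_2-\lambda_2'|\}\ge 1\quad\text{for all }\lambda=(\lambda_1,\lambda_2),\ \lambda'=(\lambda_1',\lambda_2')\in\Lambda\text{ with }\lambda\ne\lambda'.$$ There is a constant $C>0$ such that for all $f\in L^2(\mathbb{R}^2)$, $$\Big\|\sup_{n_1,n_2\in\mathbb{N}_0}\Big|\sum_{\lambda\in\Lambda}\mathcal{F}^{-1}\big(\mathbf{1}_{R^\lambda_{n_1,n_2}}\mathcal{F}f\big)\Big|\Big\|_{L^2}\le C\,\log\log\big(Q_1\sqrt{|\Lambda|}\big)\cdot\log\log\big(Q_2\sqrt{|\Lambda|}\big)\,\|f\|_{L^2}.$$ Moreover, the constant $C$ is independent of $Q_1$, $Q_2$ and the cardinality of the set $\Lambda$.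
   Context: $\mathbb{N}=\{1,2,\dots\}$ and $\mathbb{N}_0=\mathbb{N}\cup\{0\}$. For $n\in\mathbb{N}_0$, $A_n=(-2^{-n-1},2^{-n-1})\subset\mathbb{R}$. For $\lambda\in\mathbb{R}^2$ and $n_1,n_2\in\mathbb{N}_0$, $R^\lambda_{n_1,n_2}=\lambda+A_{n_1}\times A_{n_2}$. $|\Lambda|$ is the cardinality of $\Lambda$, and $\mathbf{1}_E$ is the indicator function of $E$. $\mathcal{F}$ is the Fourier transform on $\mathbb{R}^2$, $\mathcal{F}f(\xi)=\int_{\mathbb{R}^2}e^{-2\pi i\xi\cdot x}f(x)\,dx$ (extended to $L^2$), and $\mathcal{F}^{-1}$ is its inverse.
   Formalization: The factor log log x is replaced by 1 when x ≤ e, since there it is negative or undefined: for Λ = {0}, Q₁ = 2, Q₂ = 3 the stated right-hand side is negative, and for Q₁ = |Λ| = 1 it contains log 0; for x > e it is log log x as stated. *)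

theory Defs
  imports "HOL-Analysis.Analysis"
begin

text \<open>The norm is taken of extended nonnegative functions, since a supremum over infinitely
  many indices may be infinite at some points.\<close>

definition L2_norm :: "(real \<times> real \<Rightarrow> ennreal) \<Rightarrow> ennreal" where
  "L2_norm g =
    (let I = (\<integral>\<^sup>+ x. (g x)\<^sup>2 \<partial>lborel) in if I = \<infinity> then \<infinity> else ennreal (sqrt (enn2real I)))"

definition L2 :: "(real \<times> real \<Rightarrow> complex) set" where
  "L2 = {f \<in> borel_measurable lborel. integrable lborel (\<lambda>x. (cmod (f x))\<^sup>2)}"

definition L2_tendsto ::
  "(nat \<Rightarrow> real \<times> real \<Rightarrow> complex) \<Rightarrow> (real \<times> real \<Rightarrow> complex) \<Rightarrow> bool" where
  "L2_tendsto u f \<longleftrightarrow> (\<lambda>k. L2_norm (\<lambda>x. ennreal (cmod (u k x - f x)))) \<longlonglongrightarrow> 0"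

definition fourier_L1 :: "(real \<times> real \<Rightarrow> complex) \<Rightarrow> real \<times> real \<Rightarrow> complex" where
  "fourier_L1 f \<xi> = (\<integral>x. exp (- 2 * pi * \<i> * of_real (\<xi> \<bullet> x)) * f x \<partial>lborel)"

text \<open>The continuous extension of the integral from $L^1 \cap L^2$ to $L^2$. By Plancherel's theorem
  \<open>g\<close> exists for every \<open>f\<close> in \<open>L2\<close> and is unique up to a null set, so \<open>fourier\<close> and \<open>inv_fourier\<close>
  below pick one representative of the corresponding element of $L^2$; they carry no information
  outside \<open>L2\<close>.\<close>

definition is_fourier :: "(real \<times> real \<Rightarrow> complex) \<Rightarrow> (real \<times> real \<Rightarrow> complex) \<Rightarrow> bool" where
  "is_fourier f g \<longleftrightarrow> g \<in> L2 \<and>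
    (\<exists>u. (\<forall>k. integrable lborel (u k) \<and> u k \<in> L2) \<and>
         L2_tendsto u f \<and> L2_tendsto (\<lambda>k. fourier_L1 (u k)) g)"

definition fourier :: "(real \<times> real \<Rightarrow> complex) \<Rightarrow> real \<times> real \<Rightarrow> complex" where
  "fourier f = (SOME g. is_fourier f g)"

definition inv_fourier :: "(real \<times> real \<Rightarrow> complex) \<Rightarrow> real \<times> real \<Rightarrow> complex" where
  "inv_fourier h = (SOME f. f \<in> L2 \<and> (AE \<xi> in lborel. fourier f \<xi> = h \<xi>))"

definition A :: "nat \<Rightarrow> real set" where
  "A n = {- (1 / 2 ^ (n + 1)) <..< 1 / 2 ^ (n + 1)}"

definition R :: "real \<times> real \<Rightarrow> nat \<Rightarrow> nat \<Rightarrow> (real \<times> real) set" where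
  "R l n1 n2 = (\<lambda>\<xi>. l + \<xi>) ` (A n1 \<times> A n2)"

text \<open>For \<open>x \<le> e\<close> the expression \<open>ln (ln x)\<close> is nonpositive or undefined and cannot serve as a factor
  in an upper bound; there \<open>loglog\<close> is \<open>1\<close> by convention.\<close>

definition loglog :: "real \<Rightarrow> real" where
  "loglog x = (if x > exp 1 then ln (ln x) else 1)"

end

theory Submission
  imports Defs "HOL-Probability.Levy"
begin

text \<open>By the separation condition the rectangles \<open>R l 0 0\<close> are disjoint, so the multiplier
  \<open>\<Sum>l. indicator (R l n1 n2)\<close> is the product of the indicators of \<open>S1 n1 = (\<Union>l. R l n1 0)\<close> and
  \<open>S2 n2 = (\<Union>l. R l 0 n2)\<close>, and the two parameters can be added one after the other: a maximal
  inequality for a family \<open>v\<close> of multipliers implies one for all products \<open>indicator (S n) * v j\<close>.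
  Let \<open>2 ^ N\<close> be comparable to the denominator \<open>Q\<close> of the frequencies. There are about \<open>log Q\<close> scales
  \<open>n < N\<close>, for which the Rademacher--Menshov argument loses a factor \<open>log (log Q)\<close>. For
  \<open>n \<ge> N\<close> no loss occurs: the average of \<open>2 ^ (n - N)\<close> translations by multiples of \<open>Q\<close> has a
  \<open>1 / Q\<close>-periodic multiplier, hence looks the same at all frequencies; on \<open>S N\<close> it differs
  from \<open>indicator (S n)\<close> by an error which is square summable in \<open>n\<close>, and the averages are controlled by the
  maximal ergodic theorem.

  Plancherel's theorem is derived from the Levy inversion formula, which computes the inner products
  of the Fourier transforms of rectangles.\<close>

section \<open>The Fourier transform of an interval\<close>

text \<open>The two parameters separate because the one-parameter bound holds for an arbitrary
  family \<open>v\<close> and sees only its maximal constant, as a factor. Every error is therefore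
  arranged as \<open>v j * w i\<close> with \<open>w\<close> independent of \<open>j\<close>: the
  inequality for \<open>v\<close> is applied to \<open>mult_op (w i) f\<close>, and Plancherel sums
  over \<open>i\<close> once the sum of |w i|^2 is bounded uniformly in the frequency. The obstacle
  is that the rectangles sit at many frequencies, so no single kernel fits them all. The lattice
  condition helps: each coordinate of each frequency is 0 modulo 1/Q, and 2^(n-N) translations by Q
  span a length of about 2^n, matching a cutoff of width 2^-n. The averaged multiplier also peaks at
  all other multiples of 1/Q; hence it is compared with the cutoff only on \<open>S N\<close>, whose
  intervals have width 2^-N, at most one period. Constants are kept for squared norms. The number
  \<open>K\<close> with N <= 2^K is about the double logarithm of Q, and (K + 2)^2 for the square
  means K + 2 for the norm.\<close>

lemma borel_measurable_cnj [measurable (raw)]: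
  "f \<in> borel_measurable M \<Longrightarrow> (\<lambda>x. cnj (f x)) \<in> borel_measurable M"
  by (rule measurable_compose[OF _ borel_measurable_continuous_onI]) (auto intro!: continuous_intros)

text \<open>The half-open interval and the frequency without a factor \<open>2 * pi\<close> follow
  the Levy inversion formula; \<open>ivl_ft_scaled_inner\<close> returns to the normalisation of
  \<open>fourier_L1\<close>.\<close>

definition ivl_ft :: "real \<Rightarrow> real \<Rightarrow> real \<Rightarrow> complex" where
  "ivl_ft a b t = (LINT s|lborel. indicator {a<..b} s *\<^sub>R iexp (- (t * s)))"

lemma ivl_ft_measurable [measurable]: "ivl_ft a b \<in> borel_measurable borel"
  unfolding ivl_ft_def by measurable

text \<open>The right-hand side is the kernel of the Levy inversion formula, which thereby becomes a
  statement about \<open>ivl_ft\<close>.\<close>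

lemma ivl_ft_eq:
  assumes "a \<le> b" "t \<noteq> 0"
  shows "ivl_ft a b t = (iexp (- (t * a)) - iexp (- (t * b))) / (\<i> * t)"
proof -
  have "ivl_ft a b t = (LINT s|lborel. indicator {a..b} s *\<^sub>R iexp (- (t * s)))"
    unfolding ivl_ft_def
    by (rule integral_cong_AE, measurable)
       (use AE_lborel_singleton[of a] in \<open>eventually_elim, auto simp: indicator_def\<close>)
  also have "\<dots> = (\<i> / t * iexp (- (t * b))) - (\<i> / t * iexp (- (t * a)))"
  proof (rule integral_FTC_Icc[OF assms(1)])
    show "((\<lambda>x. \<i> / t * iexp (- (t * x))) has_vector_derivative iexp (- (t * x))) (at x within {a..b})"
      for x
      using assms(2)
      by (auto intro!: derivative_eq_intros has_vector_derivative_real_field simp: field_simps)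
    show "continuous_on {a..b} (\<lambda>x. iexp (- (t * x)))"
      by (intro continuous_intros)
  qed
  also have "\<dots> = (iexp (- (t * a)) - iexp (- (t * b))) / (\<i> * t)"
    using assms(2) by (simp add: field_simps)
  finally show ?thesis .
qed

lemma ivl_ft_bound: "a \<le> b \<Longrightarrow> cmod (ivl_ft a b t) \<le> b - a"
proof -
  assume "a \<le> b"
  have "cmod (ivl_ft a b t) \<le> (LINT s|lborel. norm (indicator {a<..b} s *\<^sub>R iexp (- (t * s))))"
    unfolding ivl_ft_def by (rule integral_norm_bound)
  also have "\<dots> = (LINT s|lborel. indicator {a<..b} s)"
    by (rule Bochner_Integration.integral_cong) (auto simp: indicator_def)
  also have "\<dots> = b - a" using \<open>a \<le> b\<close> by simp
  finally show ?thesis .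
qed

text \<open>For a uniform distribution, Levy inversion is Parseval's identity for two intervals: the
  kernel supplies one transform, the characteristic function the conjugate of the other.\<close>

lemma char_uniform_ivl:
  fixes c d :: real
  assumes "c < d" and S: "S \<in> sets borel"
  defines "M \<equiv> uniform_measure lborel {c<..d}"
  shows "real_distribution M" "char M t = cnj (ivl_ft c d t) / (d - c)"
    "measure M S = measure lborel ({c<..d} \<inter> S) / (d - c)"
proof -
  interpret prob_space M
    unfolding M_def using assms(1) by (intro prob_space_uniform_measure) auto
  show "real_distribution M"
    by standard (simp add: M_def)
  have M: "M = density lborel (\<lambda>x. ennreal (indicator {c<..d} x / (d - c)))"
    unfolding M_def uniform_measure_def using assms(1)
    by (intro arg_cong2[where f=density] refl ext)
       (simp add: divide_ennreal[symmetric] ennreal_indicator[symmetric])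
  have "char M t = (CLINT s|lborel. (indicator {c<..d} s / (d - c)) *\<^sub>R iexp (t * s))"
    unfolding char_def M using assms(1) by (intro integral_density) auto
  also have "\<dots> = (CLINT s|lborel. (indicator {c<..d} s *\<^sub>R iexp (t * s)) / (d - c))"
    by (rule Bochner_Integration.integral_cong) (auto simp: scaleR_conv_of_real)
  also have "\<dots> = (CLINT s|lborel. cnj (indicator {c<..d} s *\<^sub>R iexp (- (t * s))) / (d - c))"
    by (rule Bochner_Integration.integral_cong) (auto simp: indicator_def exp_cnj)
  also have "\<dots> = cnj (ivl_ft c d t) / (d - c)"
    unfolding ivl_ft_def by (simp only: integral_divide_zero Bochner_Integration.integral_cnj)
  finally show "char M t = cnj (ivl_ft c d t) / (d - c)" .
  show "measure M S = measure lborel ({c<..d} \<inter> S) / (d - c)"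
    using assms(1) S unfolding M_def by (subst measure_uniform_measure) auto
qed

lemma ivl_ft_truncated:
  assumes "a < b" "c < d"
  shows "(\<lambda>n. LINT t|lborel. indicator {- real n<..<real n} t *\<^sub>R (ivl_ft a b t * cnj (ivl_ft c d t)))
     \<longlonglongrightarrow> 2 * pi * measure lborel ({a<..b} \<inter> {c<..d})"
proof -
  define M where "M = uniform_measure lborel {c<..d}"
  interpret real_distribution M
    unfolding M_def by (rule char_uniform_ivl(1)[OF assms(2), of "{}"]) simp
  have m: "measure M S = measure lborel ({c<..d} \<inter> S) / (d - c)" if "S \<in> sets borel" for S
    unfolding M_def by (rule char_uniform_ivl(3)[OF assms(2) that])
  \<comment> \<open>Levy inversion recovers the mass of an interval whose endpoints are not
    atoms.\<close>
  have p: "measure M {x} = 0" for x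
  proof -
    have "measure lborel ({c<..d} \<inter> {x}) \<le> measure lborel {x}"
      by (intro measure_mono_fmeasurable) (auto intro: fmeasurable_compact)
    then show ?thesis by (subst m) (auto simp: measure_le_0_iff)
  qed
  have eq: "(CLBINT t=-real n..real n. (iexp (-(t * a)) - iexp (-(t * b))) / (\<i> * t) * char M t)
     = (LINT t|lborel. indicator {- real n<..<real n} t *\<^sub>R (ivl_ft a b t * cnj (ivl_ft c d t))) / (d - c)"
    for n
  proof -
    define S where "S = {- real n<..<real n}"
    have [measurable]: "S \<in> sets borel" by (simp add: S_def)
    have ch: "char M t = cnj (ivl_ft c d t) / (d - c)" for t
      unfolding M_def by (rule char_uniform_ivl(2)[OF assms(2), of "{}"]) simp
    have "(CLBINT t=-real n..real n. (iexp (-(t * a)) - iexp (-(t * b))) / (\<i> * t) * char M t)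
      = (LINT t|lborel. indicator S t *\<^sub>R
            ((iexp (-(t * a)) - iexp (-(t * b))) / (\<i> * t) * (cnj (ivl_ft c d t) / (d - c))))"
      by (simp add: ch interval_lebesgue_integral_def set_lebesgue_integral_def S_def)
    also have "\<dots> = (LINT t|lborel. (indicator S t *\<^sub>R (ivl_ft a b t * cnj (ivl_ft c d t))) / (d - c))"
    proof (rule integral_cong_AE)
      show "AE t in lborel. indicator S t *\<^sub>R ((iexp (-(t * a)) - iexp (-(t * b))) / (\<i> * t) * (cnj (ivl_ft c d t) / (d - c)))
        = (indicator S t *\<^sub>R (ivl_ft a b t * cnj (ivl_ft c d t))) / (d - c)"
        using AE_lborel_singleton[of 0]
        by eventually_elim (simp add: ivl_ft_eq assms less_imp_le scaleR_conv_of_real)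
      show "(\<lambda>t. indicator S t *\<^sub>R ((iexp (-(t * a)) - iexp (-(t * b))) / (\<i> * t) * (cnj (ivl_ft c d t) / (d - c)))) \<in> borel_measurable lborel"
        by measurable
      show "(\<lambda>t. (indicator S t *\<^sub>R (ivl_ft a b t * cnj (ivl_ft c d t))) / (d - c)) \<in> borel_measurable lborel"
        by measurable
    qed
    finally show ?thesis by (simp add: S_def)
  qed
  \<comment> \<open>The factor \<open>2 * pi * (d - c)\<close> clears the 1 / (2 pi) of the
    inversion formula and the density of \<open>M\<close>.\<close>
  have "(\<lambda>n. LINT t|lborel. indicator {- real n<..<real n} t *\<^sub>R (ivl_ft a b t * cnj (ivl_ft c d t)))
     \<longlonglongrightarrow> of_real (2 * pi * (d - c)) * of_real (measure M {a<..b})"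
    by (rule Lim_transform_eventually[OF tendsto_mult_left[OF Levy_Inversion[OF less_imp_le[OF assms(1)] p p,
          unfolded of_int_minus of_int_of_nat_eq], of "of_real (2 * pi * (d - c))"]],
      unfold eq) (use assms in \<open>simp add: field_simps\<close>)
  then show ?thesis using assms by (simp add: m Int_commute mult.assoc)
qed

text \<open>For two equal intervals the truncated integrands are nonnegative and increase with n, so
  convergence of the truncated integrals already yields integrability.\<close>

lemma ivl_ft_square_integrable:
  assumes "a < b" shows "integrable lborel (\<lambda>t. (cmod (ivl_ft a b t))\<^sup>2)"
proof (rule integrable_monotone_convergence)
  let ?f = "\<lambda>n t. indicator {- real n<..<real n} t * (cmod (ivl_ft a b t))\<^sup>2 :: real"
  show "integrable lborel (?f n)" for n
  proof -
    have "integrable lborel (\<lambda>t. indicator {- real n<..<real n} t *\<^sub>R (cmod (ivl_ft a b t))\<^sup>2)"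
    proof (rule integrableI_bounded_set_indicator[where B="(b - a)\<^sup>2"])
      show "AE x in lborel. x \<in> {- real n<..<real n} \<longrightarrow> norm ((cmod (ivl_ft a b x))\<^sup>2) \<le> (b - a)\<^sup>2"
        using ivl_ft_bound[of a b] assms by (intro AE_I2 impI) (simp add: power_mono)
    qed auto
    then show ?thesis by simp
  qed
  show "AE x in lborel. mono (\<lambda>n. ?f n x)"
    by (intro AE_I2 monoI) (auto simp: indicator_def)
  show "AE x in lborel. (\<lambda>n. ?f n x) \<longlonglongrightarrow> (cmod (ivl_ft a b x))\<^sup>2"
  proof (intro AE_I2 tendsto_eventually)
    fix x :: real
    obtain N where "\<bar>x\<bar> < real N" using reals_Archimedean2 by blast
    then show "\<forall>\<^sub>F n in sequentially. ?f n x = (cmod (ivl_ft a b x))\<^sup>2"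
      by (intro eventually_sequentiallyI[of N]) (auto simp: indicator_def)
  qed
  show "(\<lambda>n. LINT t|lborel. ?f n t) \<longlonglongrightarrow> 2 * pi * measure lborel ({a<..b} \<inter> {a<..b})"
  proof -
    have "indicator {- real n<..<real n} t *\<^sub>R (ivl_ft a b t * cnj (ivl_ft a b t)) = complex_of_real (?f n t)"
      for n t
      by (simp only: scaleR_conv_of_real of_real_mult complex_norm_square)
    then have "(LINT t|lborel. indicator {- real n<..<real n} t *\<^sub>R (ivl_ft a b t * cnj (ivl_ft a b t)))
      = complex_of_real (LINT t|lborel. ?f n t)" for n
      by (simp only: integral_complex_of_real)
    then show ?thesis
      using tendsto_Re[OF ivl_ft_truncated[OF assms assms]] by (simp only: Re_complex_of_real)
  qed
qed auto

text \<open>Levy inversion gives only a limit over symmetric truncations. Square integrability of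
  both factors provides the dominating function that turns this limit into an integral.\<close>

lemma ivl_ft_inner:
  assumes "a < b" "c < d"
  shows "integrable lborel (\<lambda>t. ivl_ft a b t * cnj (ivl_ft c d t))"
    and "(LINT t|lborel. ivl_ft a b t * cnj (ivl_ft c d t)) = 2 * pi * measure lborel ({a<..b} \<inter> {c<..d})"
proof -
  show int: "integrable lborel (\<lambda>t. ivl_ft a b t * cnj (ivl_ft c d t))"
  proof (rule Bochner_Integration.integrable_bound)
    show "integrable lborel (\<lambda>t. (cmod (ivl_ft a b t))\<^sup>2 + (cmod (ivl_ft c d t))\<^sup>2)"
      by (intro Bochner_Integration.integrable_add ivl_ft_square_integrable assms)
    have "x * y \<le> x\<^sup>2 + y\<^sup>2" if "x \<ge> 0" "y \<ge> 0" for x y :: real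
      using sum_squares_bound[of x y] mult_nonneg_nonneg[OF that] by simp
    then show "AE x in lborel. norm (ivl_ft a b x * cnj (ivl_ft c d x))
      \<le> norm ((cmod (ivl_ft a b x))\<^sup>2 + (cmod (ivl_ft c d x))\<^sup>2)"
      by (intro AE_I2) (simp add: norm_mult)
  qed measurable
  have "(\<lambda>n. LINT t|lborel. indicator {- real n<..<real n} t *\<^sub>R (ivl_ft a b t * cnj (ivl_ft c d t)))
     \<longlonglongrightarrow> (LINT t|lborel. ivl_ft a b t * cnj (ivl_ft c d t))"
  proof (rule integral_dominated_convergence[where w="\<lambda>t. norm (ivl_ft a b t * cnj (ivl_ft c d t))"])
    show "AE x in lborel. (\<lambda>n. indicator {- real n<..<real n} x *\<^sub>R (ivl_ft a b x * cnj (ivl_ft c d x)))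
      \<longlonglongrightarrow> ivl_ft a b x * cnj (ivl_ft c d x)"
    proof (intro AE_I2 tendsto_eventually)
      fix x :: real
      obtain N where "\<bar>x\<bar> < real N" using reals_Archimedean2 by blast
      then show "\<forall>\<^sub>F n in sequentially. indicator {- real n<..<real n} x *\<^sub>R (ivl_ft a b x * cnj (ivl_ft c d x))
          = ivl_ft a b x * cnj (ivl_ft c d x)"
        by (intro eventually_sequentiallyI[of N]) (auto simp: indicator_def)
    qed
    show "integrable lborel (\<lambda>t. norm (ivl_ft a b t * cnj (ivl_ft c d t)))"
      using int by (rule integrable_norm)
    show "AE x in lborel. norm (indicator {- real n<..<real n} x *\<^sub>R (ivl_ft a b x * cnj (ivl_ft c d x)))
      \<le> norm (ivl_ft a b x * cnj (ivl_ft c d x))" for n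
      by (intro AE_I2) (simp add: indicator_def)
  qed measurable
  from LIMSEQ_unique[OF this ivl_ft_truncated[OF assms]]
  show "(LINT t|lborel. ivl_ft a b t * cnj (ivl_ft c d t)) = 2 * pi * measure lborel ({a<..b} \<inter> {c<..d})" .
qed

section \<open>Square norms and rectangles\<close>

lemma integral_tensor:
  fixes f :: "'a::euclidean_space \<Rightarrow> complex" and g :: "'b::euclidean_space \<Rightarrow> complex"
  assumes [measurable]: "integrable lborel f" "integrable lborel g"
  shows "integrable lborel (\<lambda>x. f (fst x) * g (snd x))"
    and "(LINT x|lborel. f (fst x) * g (snd x)) = (LINT x|lborel. f x) * (LINT x|lborel. g x)"
proof -
  have [measurable]: "f \<in> borel_measurable borel" "g \<in> borel_measurable borel"
    using assms by (auto dest: borel_measurable_integrable)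
  have *: "integrable (lborel \<Otimes>\<^sub>M lborel) (\<lambda>x. f (fst x) * g (snd x))"
  proof (rule lborel_pair.Fubini_integrable)
    show "integrable lborel (\<lambda>x. LINT y|lborel. norm (f (fst (x, y)) * g (snd (x, y))))"
      using assms by (simp add: norm_mult)
    show "AE x in lborel. integrable lborel (\<lambda>y. f (fst (x, y)) * g (snd (x, y)))"
      using assms by simp
  qed measurable
  then show "integrable lborel (\<lambda>x. f (fst x) * g (snd x))" by (simp add: lborel_prod)
  have "(LINT x|lborel. f (fst x) * g (snd x)) = (LINT x|lborel. LINT y|lborel. f x * g y)"
    using lborel_pair.integral_fst'[OF *] by (simp add: lborel_prod)
  then show "(LINT x|lborel. f (fst x) * g (snd x)) = (LINT x|lborel. f x) * (LINT x|lborel. g x)"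
    by simp
qed

abbreviation char2 :: "real \<times> real \<Rightarrow> real \<times> real \<Rightarrow> complex" where
  "char2 \<xi> x \<equiv> exp (- 2 * pi * \<i> * of_real (\<xi> \<bullet> x))"

text \<open>The squared norm in \<open>ennreal\<close> is defined for every function and additive in
  the squares, so Fatou and Tonelli apply to it directly and no roots appear.\<close>

definition nsq :: "(real \<times> real \<Rightarrow> complex) \<Rightarrow> ennreal" where
  "nsq f = (\<integral>\<^sup>+ x. ennreal ((cmod (f x))\<^sup>2) \<partial>lborel)"

lemma L2_iff: "f \<in> L2 \<longleftrightarrow> f \<in> borel_measurable borel \<and> nsq f < \<infinity>"
  unfolding L2_def nsq_def by (auto simp: integrable_iff_bounded)

lemma L2_measurable [measurable_dest]: "f \<in> L2 \<Longrightarrow> f \<in> borel_measurable borel"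
  by (simp add: L2_iff)

lemma nsq_cong: "AE x in lborel. cmod (f x) = cmod (g x) \<Longrightarrow> nsq f = nsq g"
  unfolding nsq_def by (rule nn_integral_cong_AE) auto

text \<open>This weighted inequality stands in for Minkowski's when squares are estimated. The
  weight is free: it tends to 0 where a sharp constant is wanted, and it is tuned to
  \<open>K\<close> in \<open>max_bound_prefix_unions\<close> so that the constant there does not
  grow geometrically.\<close>

lemma power2_sum_le:
  fixes a b t :: real
  assumes "t > 0"
  shows "(a + b)\<^sup>2 \<le> (1 + t) * a\<^sup>2 + (1 + 1 / t) * b\<^sup>2"
proof -
  have "0 \<le> (t * a - b)\<^sup>2 / t" using assms by simp
  also have "\<dots> = (1 + t) * a\<^sup>2 + (1 + 1 / t) * b\<^sup>2 - (a + b)\<^sup>2"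
    using assms by (simp add: field_simps power2_eq_square)
  finally show ?thesis by simp
qed

lemma nsq_add_le:
  assumes [measurable]: "f \<in> borel_measurable borel" "g \<in> borel_measurable borel" and t: "t > 0"
  shows "nsq (\<lambda>x. f x + g x) \<le> ennreal (1 + t) * nsq f + ennreal (1 + 1 / t) * nsq g"
proof -
  have "nsq (\<lambda>x. f x + g x) \<le> (\<integral>\<^sup>+ x. ennreal (1 + t) * ennreal ((cmod (f x))\<^sup>2)
      + ennreal (1 + 1 / t) * ennreal ((cmod (g x))\<^sup>2) \<partial>lborel)"
    unfolding nsq_def
  proof (rule nn_integral_mono)
    fix x
    have "(cmod (f x + g x))\<^sup>2 \<le> (cmod (f x) + cmod (g x))\<^sup>2"
      by (intro power_mono norm_triangle_ineq) simp
    also have "\<dots> \<le> (1 + t) * (cmod (f x))\<^sup>2 + (1 + 1 / t) * (cmod (g x))\<^sup>2"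
      using t by (rule power2_sum_le)
    finally show "ennreal ((cmod (f x + g x))\<^sup>2) \<le> ennreal (1 + t) * ennreal ((cmod (f x))\<^sup>2)
      + ennreal (1 + 1 / t) * ennreal ((cmod (g x))\<^sup>2)"
      using t by (simp add: ennreal_plus[symmetric] ennreal_mult'[symmetric] del: ennreal_plus)
  qed
  also have "\<dots> = ennreal (1 + t) * nsq f + ennreal (1 + 1 / t) * nsq g"
    unfolding nsq_def by (subst nn_integral_add) (simp_all add: nn_integral_cmult)
  finally show ?thesis .
qed

lemma nsq_cmult:
  assumes [measurable]: "f \<in> borel_measurable borel"
  shows "nsq (\<lambda>x. c * f x) = ennreal ((cmod c)\<^sup>2) * nsq f"
  unfolding nsq_def by (simp add: norm_mult power_mult_distrib ennreal_mult' nn_integral_cmult)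

lemma nsq_minus: "nsq (\<lambda>x. f x - g x) = nsq (\<lambda>x. g x - f x)"
  unfolding nsq_def by (simp add: norm_minus_commute)

lemma nsq_cnj [simp]: "nsq (\<lambda>x. cnj (f x)) = nsq f"
  unfolding nsq_def by simp

lemma L2_add [intro]: assumes "f \<in> L2" "g \<in> L2" shows "(\<lambda>x. f x + g x) \<in> L2"
proof -
  have "nsq (\<lambda>x. f x + g x) \<le> ennreal (1 + 1) * nsq f + ennreal (1 + 1 / 1) * nsq g"
    using assms by (intro nsq_add_le) auto
  also have "\<dots> < \<infinity>" using assms by (simp add: L2_iff ennreal_mult_less_top)
  finally show ?thesis using assms by (auto simp: L2_iff)
qed

lemma L2_cmult [intro]: "f \<in> L2 \<Longrightarrow> (\<lambda>x. c * f x) \<in> L2"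
  by (auto simp: L2_iff nsq_cmult ennreal_mult_less_top)

lemma L2_diff [intro]: "f \<in> L2 \<Longrightarrow> g \<in> L2 \<Longrightarrow> (\<lambda>x. f x - g x) \<in> L2"
  using L2_add[of f "\<lambda>x. (-1) * g x"] L2_cmult[of g "-1"] by simp

lemma L2_cnj [intro]: "f \<in> L2 \<Longrightarrow> (\<lambda>x. cnj (f x)) \<in> L2"
  by (auto simp: L2_iff)

lemma L2_zero [intro, simp]: "(\<lambda>x. 0) \<in> L2"
  by (simp add: L2_iff nsq_def)

lemma L2_integrable_square: "f \<in> L2 \<Longrightarrow> integrable lborel (\<lambda>x. (cmod (f x))\<^sup>2)"
  by (simp add: L2_def)

lemma nsq_eq_integral: "f \<in> L2 \<Longrightarrow> nsq f = ennreal (LINT x|lborel. (cmod (f x))\<^sup>2)"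
  unfolding nsq_def by (intro nn_integral_eq_integral L2_integrable_square) auto

lemma L2_integrable_mult:
  assumes "f \<in> L2" "g \<in> L2"
  shows "integrable lborel (\<lambda>x. f x * g x)"
proof (rule Bochner_Integration.integrable_bound)
  note [measurable] = assms
  show "integrable lborel (\<lambda>x. (cmod (f x))\<^sup>2 + (cmod (g x))\<^sup>2)"
    by (intro Bochner_Integration.integrable_add L2_integrable_square assms)
  have "x * y \<le> x\<^sup>2 + y\<^sup>2" if "x \<ge> 0" "y \<ge> 0" for x y :: real
    using sum_squares_bound[of x y] mult_nonneg_nonneg[OF that] by simp
  then show "AE x in lborel. norm (f x * g x) \<le> norm ((cmod (f x))\<^sup>2 + (cmod (g x))\<^sup>2)"
    by (intro AE_I2) (simp add: norm_mult)
  show "(\<lambda>x. f x * g x) \<in> borel_measurable lborel"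
    by measurable
qed

definition rect :: "real \<Rightarrow> real \<Rightarrow> real \<Rightarrow> real \<Rightarrow> real \<times> real \<Rightarrow> complex" where
  "rect a b c d x = indicator {a<..b} (fst x) * indicator {c<..d} (snd x)"

lemma integrable_ivl: "integrable lborel (indicator {a<..b::real} :: real \<Rightarrow> complex)"
proof -
  have "integrable lborel (\<lambda>x. complex_of_real (indicator {a<..b} x))"
    by (intro integrable_of_real integrable_real_indicator emeasure_bounded_finite) auto
  then show ?thesis by (simp add: of_real_indicator)
qed

lemma rect_integrable: "integrable lborel (rect a b c d)"
  unfolding rect_def[abs_def] by (intro integral_tensor integrable_ivl)

lemma rect_measurable [measurable]: "rect a b c d \<in> borel_measurable borel"
  using rect_integrable[THEN borel_measurable_integrable] by simp

lemma rect_L2: "rect a b c d \<in> L2"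
proof -
  have "(cmod (rect a b c d x))\<^sup>2 = cmod (rect a b c d x)" for x
    by (auto simp: rect_def indicator_def)
  then show ?thesis
    using rect_integrable[THEN integrable_norm] by (simp add: L2_def)
qed

lemma integrable_exp_mult:
  fixes f :: "real \<Rightarrow> complex"
  assumes f: "integrable lborel f"
  shows "integrable lborel (\<lambda>x. iexp (- (t * x)) * f x)"
proof -
  have [measurable]: "f \<in> borel_measurable borel" using f by auto
  show ?thesis
    by (rule Bochner_Integration.integrable_bound[OF f]) (auto simp: norm_mult)
qed

lemma fourier_rect: "fourier_L1 (rect a b c d) \<xi> = ivl_ft a b (2 * pi * fst \<xi>) * ivl_ft c d (2 * pi * snd \<xi>)"
proof -
  have "char2 \<xi> x =
     iexp (- (2 * pi * fst \<xi> * fst x)) * iexp (- (2 * pi * snd \<xi> * snd x))" for x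
    by (simp add: inner_prod_def mult_exp_exp algebra_simps)
  then have "char2 \<xi> x * rect a b c d x =
     (iexp (- (2 * pi * fst \<xi> * fst x)) * indicator {a<..b} (fst x)) *
     (iexp (- (2 * pi * snd \<xi> * snd x)) * indicator {c<..d} (snd x))" for x
    by (simp add: rect_def)
  then have "fourier_L1 (rect a b c d) \<xi> = (LINT x|lborel.
     (iexp (- (2 * pi * fst \<xi> * fst x)) * indicator {a<..b} (fst x)) *
     (iexp (- (2 * pi * snd \<xi> * snd x)) * indicator {c<..d} (snd x)))"
    unfolding fourier_L1_def by simp
  also have "\<dots> = (LINT x|lborel. iexp (- (2 * pi * fst \<xi> * x)) * indicator {a<..b} x) *
     (LINT x|lborel. iexp (- (2 * pi * snd \<xi> * x)) * indicator {c<..d} x)"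
    by (intro integral_tensor(2) integrable_exp_mult integrable_ivl)
  also have "\<dots> = ivl_ft a b (2 * pi * fst \<xi>) * ivl_ft c d (2 * pi * snd \<xi>)"
    unfolding ivl_ft_def
    by (intro arg_cong2[where f="(*)"] Bochner_Integration.integral_cong) (auto simp: indicator_def)
  finally show ?thesis .
qed

text \<open>Substituting \<open>2 * pi * t\<close> cancels exactly the factor \<open>2 * pi\<close>
  in \<open>ivl_ft_inner\<close>.\<close>

lemma ivl_ft_scaled_inner:
  assumes "a < b" "c < d"
  shows "integrable lborel (\<lambda>t. ivl_ft a b (2 * pi * t) * cnj (ivl_ft c d (2 * pi * t)))"
    and "(LINT t|lborel. ivl_ft a b (2 * pi * t) * cnj (ivl_ft c d (2 * pi * t)))
      = (LINT t|lborel. indicator {a<..b} t * cnj (indicator {c<..d} t))"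
proof -
  show "integrable lborel (\<lambda>t. ivl_ft a b (2 * pi * t) * cnj (ivl_ft c d (2 * pi * t)))"
    using lborel_integrable_real_affine[OF ivl_ft_inner(1)[OF assms], of "2 * pi" 0] by simp
  have "(LINT t|lborel. ivl_ft a b (2 * pi * t) * cnj (ivl_ft c d (2 * pi * t)))
    = complex_of_real (measure lborel ({a<..b} \<inter> {c<..d}))"
    using lborel_integral_real_affine[of "2 * pi" "\<lambda>t. ivl_ft a b t * cnj (ivl_ft c d t)" 0]
      ivl_ft_inner(2)[OF assms] by (simp add: scaleR_conv_of_real)
  also have "\<dots> = complex_of_real (LINT t|lborel. indicator ({a<..b} \<inter> {c<..d}) t)"
    by (simp del: Int_greaterThanAtMost)
  also have "\<dots> = (LINT t|lborel. indicator {a<..b} t * cnj (indicator {c<..d} t))"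
    unfolding integral_complex_of_real[symmetric]
    by (rule Bochner_Integration.integral_cong) (auto simp: indicator_def)
  finally show "(LINT t|lborel. ivl_ft a b (2 * pi * t) * cnj (ivl_ft c d (2 * pi * t)))
      = (LINT t|lborel. indicator {a<..b} t * cnj (indicator {c<..d} t))" .
qed

lemma fourier_rect_inner:
  assumes "a < b" "c < d" "a' < b'" "c' < d'"
  shows "integrable lborel (\<lambda>x. fourier_L1 (rect a b c d) x * cnj (fourier_L1 (rect a' b' c' d') x))"
   and "(LINT x|lborel. fourier_L1 (rect a b c d) x * cnj (fourier_L1 (rect a' b' c' d') x))
      = (LINT x|lborel. rect a b c d x * cnj (rect a' b' c' d' x))"
proof -
  have eq: "fourier_L1 (rect a b c d) x * cnj (fourier_L1 (rect a' b' c' d') x) =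
     (\<lambda>t. ivl_ft a b (2 * pi * t) * cnj (ivl_ft a' b' (2 * pi * t))) (fst x) *
     (\<lambda>t. ivl_ft c d (2 * pi * t) * cnj (ivl_ft c' d' (2 * pi * t))) (snd x)" for x
    by (simp add: fourier_rect)
  show "integrable lborel (\<lambda>x. fourier_L1 (rect a b c d) x * cnj (fourier_L1 (rect a' b' c' d') x))"
    unfolding eq by (intro integral_tensor ivl_ft_scaled_inner assms)
  have ind: "integrable lborel (\<lambda>t. indicator {a<..b} t * cnj (indicator {a'<..b'::real} t))" for a b a' b'
    using integrable_ivl[of "max a a'" "min b b'"]
    by (rule Bochner_Integration.integrable_cong[THEN iffD1, rotated -1]) (auto simp: indicator_def)
  have eq2: "rect a b c d x * cnj (rect a' b' c' d' x) =
     (\<lambda>t. indicator {a<..b} t * cnj (indicator {a'<..b'} t)) (fst x) *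
     (\<lambda>t. indicator {c<..d} t * cnj (indicator {c'<..d'} t)) (snd x)" for x
    by (simp add: rect_def)
  show "(LINT x|lborel. fourier_L1 (rect a b c d) x * cnj (fourier_L1 (rect a' b' c' d') x))
      = (LINT x|lborel. rect a b c d x * cnj (rect a' b' c' d' x))"
    unfolding eq eq2
    by (subst (1 2) integral_tensor(2)) (intro ind ivl_ft_scaled_inner assms | simp only: ivl_ft_scaled_inner assms)+
qed

section \<open>Isometry on step functions\<close>

lemma fourier_L1_measurable [measurable]:
  assumes [measurable]: "f \<in> borel_measurable borel"
  shows "fourier_L1 f \<in> borel_measurable borel"
  unfolding fourier_L1_def[abs_def] by measurable

lemma fourier_L1_integrable:
  assumes "integrable lborel f"
  shows "integrable lborel (\<lambda>x. char2 \<xi> x * f x)"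
proof -
  have [measurable]: "f \<in> borel_measurable borel" using assms by auto
  show ?thesis
    by (rule Bochner_Integration.integrable_bound[OF assms]) (auto simp: norm_mult)
qed

lemma fourier_L1_add:
  assumes "integrable lborel f" "integrable lborel g"
  shows "fourier_L1 (\<lambda>x. f x + c * g x) \<xi> = fourier_L1 f \<xi> + c * fourier_L1 g \<xi>"
  unfolding fourier_L1_def
  using fourier_L1_integrable[OF assms(1), of \<xi>] fourier_L1_integrable[OF assms(2), of \<xi>]
  by (simp add: ring_distribs mult.left_commute[of _ c] Bochner_Integration.integral_add)

lemma fourier_L1_diff:
  assumes "integrable lborel f" "integrable lborel g"
  shows "fourier_L1 (\<lambda>x. f x - g x) \<xi> = fourier_L1 f \<xi> - fourier_L1 g \<xi>"
  using fourier_L1_add[OF assms, of "-1"] by simp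

lemma fourier_L1_bound:
  assumes "integrable lborel f"
  shows "ennreal (cmod (fourier_L1 f \<xi>)) \<le> (\<integral>\<^sup>+ x. ennreal (cmod (f x)) \<partial>lborel)"
proof -
  have "cmod (fourier_L1 f \<xi>) \<le> (LINT x|lborel. norm (char2 \<xi> x * f x))"
    unfolding fourier_L1_def by (rule integral_norm_bound)
  also have "\<dots> = (LINT x|lborel. cmod (f x))" by (simp add: norm_mult)
  finally show ?thesis using assms by (simp add: nn_integral_eq_integral)
qed

text \<open>The constant 1 must survive the limit, because an isometry is obtained by using this
  lemma in both directions. The two triangle inequalities cost 1 + t each, and t tends to 0 only
  after k has tended to infinity.\<close>

lemma nsq_le_limit:
  assumes [measurable]: "\<And>k. f k \<in> borel_measurable borel" "f' \<in> borel_measurable borel"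
    "\<And>k. g k \<in> borel_measurable borel" "g' \<in> borel_measurable borel"
    and f: "(\<lambda>k. nsq (\<lambda>x. f k x - f' x)) \<longlonglongrightarrow> 0" and g: "(\<lambda>k. nsq (\<lambda>x. g k x - g' x)) \<longlonglongrightarrow> 0"
    and le: "\<And>k. nsq (g k) \<le> nsq (f k)"
  shows "nsq g' \<le> nsq f'"
proof -
  have main: "nsq g' \<le> ennreal (1 + t) * (ennreal (1 + t) * nsq f')" if t: "t > 0" for t
  proof (rule LIMSEQ_le_const)
    let ?r = "\<lambda>k. ennreal (1 + t) * (ennreal (1 + t) * nsq f' + ennreal (1 + 1 / t) * nsq (\<lambda>x. f k x - f' x))
      + ennreal (1 + 1 / t) * nsq (\<lambda>x. g k x - g' x)"
    have "?r \<longlonglongrightarrow> ennreal (1 + t) * (ennreal (1 + t) * nsq f' + ennreal (1 + 1 / t) * 0) + ennreal (1 + 1 / t) * 0"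
      by (intro tendsto_add ennreal_tendsto_cmult f g tendsto_const) auto
    then show "?r \<longlonglongrightarrow> ennreal (1 + t) * (ennreal (1 + t) * nsq f')" by simp
    have "nsq g' \<le> ?r k" for k
    proof -
      have "nsq g' = nsq (\<lambda>x. g k x + (g' x - g k x))" by simp
      also have "\<dots> \<le> ennreal (1 + t) * nsq (g k) + ennreal (1 + 1 / t) * nsq (\<lambda>x. g' x - g k x)"
        by (rule nsq_add_le) (use t in auto)
      also have "nsq (g k) \<le> nsq (\<lambda>x. f' x + (f k x - f' x))" using le by simp
      also have "\<dots> \<le> ennreal (1 + t) * nsq f' + ennreal (1 + 1 / t) * nsq (\<lambda>x. f k x - f' x)"
        by (rule nsq_add_le) (use t in auto)
      finally show ?thesis by (simp add: nsq_minus[of g'] mult_left_mono add_right_mono)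
    qed
    then show "\<exists>N. \<forall>n\<ge>N. nsq g' \<le> ?r n" by blast
  qed
  show ?thesis
  proof (rule LIMSEQ_le_const)
    have "(\<lambda>n. ennreal ((1 + 1 / real (Suc n)) * (1 + 1 / real (Suc n))) * nsq f') \<longlonglongrightarrow> ennreal ((1 + 0) * (1 + 0)) * nsq f'"
      by (intro tendsto_mult_ennreal tendsto_const tendsto_ennrealI tendsto_mult tendsto_add
          LIMSEQ_Suc[OF lim_1_over_n]) auto
    then show "(\<lambda>n. ennreal ((1 + 1 / real (Suc n)) * (1 + 1 / real (Suc n))) * nsq f') \<longlonglongrightarrow> nsq f'"
      by simp
    show "\<exists>N. \<forall>n\<ge>N. nsq g' \<le> ennreal ((1 + 1 / real (Suc n)) * (1 + 1 / real (Suc n))) * nsq f'"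
      using main[of "1 / real (Suc n)" for n]
      by (auto simp: ennreal_mult mult.assoc simp del: of_nat_Suc)
  qed
qed

text \<open>The bound 2 |f| is the one that comes with approximation by simple functions; it makes
  (3 |f|)^p a dominating function. The cases p = 1 and p = 2 are used.\<close>

lemma power_dominated_convergence:
  fixes s :: "nat \<Rightarrow> real \<times> real \<Rightarrow> complex"
  assumes [measurable]: "\<And>k. s k \<in> borel_measurable borel" "f \<in> borel_measurable borel"
    and p: "p > 0" and fin: "(\<integral>\<^sup>+ x. ennreal (cmod (f x) ^ p) \<partial>lborel) < \<infinity>"
    and lim: "\<And>x. (\<lambda>k. s k x) \<longlonglongrightarrow> f x" and bd: "\<And>k x. cmod (s k x) \<le> 2 * cmod (f x)"
  shows "(\<lambda>k. \<integral>\<^sup>+ x. ennreal (cmod (s k x - f x) ^ p) \<partial>lborel) \<longlonglongrightarrow> 0"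
proof -
  have "(\<lambda>k. \<integral>\<^sup>+ x. ennreal (cmod (s k x - f x) ^ p) \<partial>lborel)
      \<longlonglongrightarrow> (\<integral>\<^sup>+ x. 0 \<partial>(lborel :: (real \<times> real) measure))"
  proof (rule nn_integral_dominated_convergence[where w="\<lambda>x. ennreal (3 ^ p) * ennreal (cmod (f x) ^ p)"])
    show "AE x in lborel. ennreal (cmod (s k x - f x) ^ p) \<le> ennreal (3 ^ p) * ennreal (cmod (f x) ^ p)" for k
    proof (rule AE_I2)
      fix x
      have "cmod (s k x - f x) \<le> 3 * cmod (f x)"
        using bd[of k x] norm_triangle_ineq4[of "s k x" "f x"] by simp
      then have "cmod (s k x - f x) ^ p \<le> (3 * cmod (f x)) ^ p" by (intro power_mono) auto
      then show "ennreal (cmod (s k x - f x) ^ p) \<le> ennreal (3 ^ p) * ennreal (cmod (f x) ^ p)"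
        by (subst ennreal_mult'[symmetric]) (auto simp: power_mult_distrib intro!: ennreal_leI)
    qed
    show "AE x in lborel. (\<lambda>k. ennreal (cmod (s k x - f x) ^ p)) \<longlonglongrightarrow> 0"
    proof (rule AE_I2)
      fix x
      have "(\<lambda>k. ennreal (cmod (s k x - f x) ^ p)) \<longlonglongrightarrow> ennreal (cmod (f x - f x) ^ p)"
        by (intro tendsto_ennrealI tendsto_intros lim)
      then show "(\<lambda>k. ennreal (cmod (s k x - f x) ^ p)) \<longlonglongrightarrow> 0"
        by (simp only: diff_self norm_zero zero_power[OF p] ennreal_0)
    qed
    show "(\<integral>\<^sup>+ x. ennreal (3 ^ p) * ennreal (cmod (f x) ^ p) \<partial>lborel) < \<infinity>"
      using fin by (subst nn_integral_cmult) (auto simp: ennreal_mult_less_top)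
  qed measurable
  then show ?thesis by simp
qed

lemma nsq_dominated_convergence:
  assumes "\<And>k. s k \<in> borel_measurable borel" "f \<in> L2"
    and "\<And>x. (\<lambda>k. s k x) \<longlonglongrightarrow> f x" "\<And>k x. cmod (s k x) \<le> 2 * cmod (f x)"
  shows "(\<lambda>k. nsq (\<lambda>x. s k x - f x)) \<longlonglongrightarrow> 0"
  unfolding nsq_def using assms(2)
  by (intro power_dominated_convergence assms) (auto simp: L2_iff nsq_def)

lemma L1_dominated_convergence:
  fixes s :: "nat \<Rightarrow> real \<times> real \<Rightarrow> complex"
  assumes "\<And>k. s k \<in> borel_measurable borel" "integrable lborel f"
    and "\<And>x. (\<lambda>k. s k x) \<longlonglongrightarrow> f x" "\<And>k x. cmod (s k x) \<le> 2 * cmod (f x)"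
  shows "(\<lambda>k. \<integral>\<^sup>+ x. ennreal (cmod (s k x - f x)) \<partial>lborel) \<longlonglongrightarrow> 0"
  using power_dominated_convergence[OF assms(1) _ _ _ assms(3,4), of 1] assms(2)
  by (simp add: integrable_iff_bounded)

definition L12 :: "(real \<times> real \<Rightarrow> complex) set" where
  "L12 = {f. integrable lborel f \<and> f \<in> L2}"

lemma L12_D: "f \<in> L12 \<Longrightarrow> integrable lborel f" "f \<in> L12 \<Longrightarrow> f \<in> L2"
  by (auto simp: L12_def)

lemma L12_measurable [measurable_dest]: "f \<in> L12 \<Longrightarrow> f \<in> borel_measurable borel"
  by (auto simp: L12_def)

lemma L12_zero [simp]: "(\<lambda>x. 0) \<in> L12" by (auto simp: L12_def)

lemma L12_add: "f \<in> L12 \<Longrightarrow> g \<in> L12 \<Longrightarrow> (\<lambda>x. f x + c * g x) \<in> L12"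
  by (auto simp: L12_def)

lemma L12_diff: "f \<in> L12 \<Longrightarrow> g \<in> L12 \<Longrightarrow> (\<lambda>x. f x - g x) \<in> L12"
  by (auto simp: L12_def)

lemma L12_rect: "rect a b c d \<in> L12" by (simp add: L12_def rect_integrable rect_L2)

text \<open>Each rectangle is nondegenerate, as in \<open>fourier_rect_inner\<close>. Induction
  peels off one rectangle at a time, so Parseval's identity extends by linearity first in one
  argument and then in the other.\<close>

inductive_set stepf :: "(real \<times> real \<Rightarrow> complex) set" where
  zero: "(\<lambda>x. 0) \<in> stepf"
| add: "f \<in> stepf \<Longrightarrow> a < b \<Longrightarrow> c < d \<Longrightarrow> (\<lambda>x. f x + k * rect a b c d x) \<in> stepf"

lemma stepf_L12: "f \<in> stepf \<Longrightarrow> f \<in> L12"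
  by (induction rule: stepf.induct) (auto intro!: L12_add L12_rect)

lemma stepf_add_cmult:
  assumes "f \<in> stepf" shows "g \<in> stepf \<Longrightarrow> (\<lambda>x. f x + c * g x) \<in> stepf"
proof (induction rule: stepf.induct)
  case (add g a b c' d k)
  then show ?case
    using stepf.add[of "\<lambda>x. f x + c * g x" a b c' d "c * k"] by (simp add: algebra_simps)
qed (use assms in simp)

lemma rect_fourier_L2: "a < b \<Longrightarrow> c < d \<Longrightarrow> fourier_L1 (rect a b c d) \<in> L2"
proof -
  assume *: "a < b" "c < d"
  have "integrable lborel (\<lambda>x. cmod (fourier_L1 (rect a b c d) x * cnj (fourier_L1 (rect a b c d) x)))"
    by (intro integrable_norm fourier_rect_inner *)
  then show ?thesis by (simp add: L2_def norm_mult power2_eq_square)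
qed

lemma L2_integrable_mult_cnj: "f \<in> L2 \<Longrightarrow> g \<in> L2 \<Longrightarrow> integrable lborel (\<lambda>x. f x * cnj (g x))"
  by (intro L2_integrable_mult L2_cnj)

lemma fourier_L1_zero [simp]: "fourier_L1 (\<lambda>x. 0) = (\<lambda>x. 0)"
  by (simp add: fourier_L1_def fun_eq_iff)

text \<open>Square integrability of the transform is carried along in the induction because it
  justifies splitting the integral of a sum.\<close>

lemma stepf_fourier:
  assumes "f \<in> stepf"
  shows "fourier_L1 f \<in> L2 \<and> (\<forall>a b c d. a < b \<longrightarrow> c < d \<longrightarrow>
    (LINT x|lborel. fourier_L1 f x * cnj (fourier_L1 (rect a b c d) x)) = (LINT x|lborel. f x * cnj (rect a b c d x)))"
  using assms
proof (induction rule: stepf.induct)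
  case (add f a b c d k)
  have eq: "fourier_L1 (\<lambda>x. f x + k * rect a b c d x) = (\<lambda>x. fourier_L1 f x + k * fourier_L1 (rect a b c d) x)"
    using add by (intro ext fourier_L1_add rect_integrable) (auto dest: stepf_L12 L12_D)
  have L: "f \<in> L2" using add by (auto dest: stepf_L12 L12_D)
  show ?case
  proof (intro conjI allI impI)
    show "fourier_L1 (\<lambda>x. f x + k * rect a b c d x) \<in> L2"
      unfolding eq using add by (intro L2_add L2_cmult rect_fourier_L2) auto
    fix a' b' c' d' :: real assume *: "a' < b'" "c' < d'"
    note i = L2_integrable_mult_cnj[OF _ rect_fourier_L2[OF *]] L2_integrable_mult_cnj[OF _ rect_L2[of a' b' c' d']]
    have "(LINT x|lborel. fourier_L1 (\<lambda>x. f x + k * rect a b c d x) x * cnj (fourier_L1 (rect a' b' c' d') x))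
      = (LINT x|lborel. fourier_L1 f x * cnj (fourier_L1 (rect a' b' c' d') x)) +
        k * (LINT x|lborel. fourier_L1 (rect a b c d) x * cnj (fourier_L1 (rect a' b' c' d') x))"
      unfolding eq using add
      by (simp add: ring_distribs mult.assoc Bochner_Integration.integral_add i rect_fourier_L2)
    also have "\<dots> = (LINT x|lborel. f x * cnj (rect a' b' c' d' x)) +
        k * (LINT x|lborel. rect a b c d x * cnj (rect a' b' c' d' x))"
      using add * by (simp add: fourier_rect_inner)
    also have "\<dots> = (LINT x|lborel. (f x + k * rect a b c d x) * cnj (rect a' b' c' d' x))"
      using L by (simp add: ring_distribs mult.assoc Bochner_Integration.integral_add i rect_L2)
    finally show "(LINT x|lborel. fourier_L1 (\<lambda>x. f x + k * rect a b c d x) x * cnj (fourier_L1 (rect a' b' c' d') x))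
      = (LINT x|lborel. (f x + k * rect a b c d x) * cnj (rect a' b' c' d' x))" .
  qed
qed auto

lemma stepf_fourier_inner:
  assumes f: "f \<in> stepf" and "g \<in> stepf"
  shows "(LINT x|lborel. fourier_L1 f x * cnj (fourier_L1 g x)) = (LINT x|lborel. f x * cnj (g x))"
  using assms(2)
proof (induction rule: stepf.induct)
  case (add g a b c d k)
  have eq: "fourier_L1 (\<lambda>x. g x + k * rect a b c d x) = (\<lambda>x. fourier_L1 g x + k * fourier_L1 (rect a b c d) x)"
    using add by (intro ext fourier_L1_add rect_integrable) (auto dest: stepf_L12 L12_D)
  have L: "f \<in> L2" "g \<in> L2" using add f by (auto dest: stepf_L12 L12_D)
  note i = L2_integrable_mult_cnj[OF conjunct1[OF stepf_fourier[OF f]]] L2_integrable_mult_cnj[OF L(1)]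
  have "(LINT x|lborel. fourier_L1 f x * cnj (fourier_L1 (\<lambda>x. g x + k * rect a b c d x) x))
    = (LINT x|lborel. fourier_L1 f x * cnj (fourier_L1 g x)) +
      cnj k * (LINT x|lborel. fourier_L1 f x * cnj (fourier_L1 (rect a b c d) x))"
    unfolding eq using add
    by (simp add: ring_distribs mult.left_commute Bochner_Integration.integral_add i rect_fourier_L2 stepf_fourier)
  also have "\<dots> = (LINT x|lborel. f x * cnj (g x)) + cnj k * (LINT x|lborel. f x * cnj (rect a b c d x))"
    using stepf_fourier[OF f] add by simp
  also have "\<dots> = (LINT x|lborel. f x * cnj (g x + k * rect a b c d x))"
    using L by (simp add: ring_distribs mult.left_commute Bochner_Integration.integral_add i rect_L2)
  finally show ?case .
qed auto

lemma nsq_eq_inner: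
  assumes "f \<in> L2"
  shows "nsq f = ennreal (Re (LINT x|lborel. f x * cnj (f x)))"
proof -
  have "Re (LINT x|lborel. f x * cnj (f x)) = (LINT x|lborel. Re (f x * cnj (f x)))"
    by (rule integral_Re[symmetric], intro L2_integrable_mult_cnj assms)
  also have "\<dots> = (LINT x|lborel. (cmod (f x))\<^sup>2)"
    by (simp add: cmod_power2) (simp add: power2_eq_square)
  finally show ?thesis using assms by (simp add: nsq_eq_integral)
qed

lemma stepf_plancherel: "f \<in> stepf \<Longrightarrow> nsq (fourier_L1 f) = nsq f"
  using stepf_fourier_inner[of f f] stepf_fourier[of f]
  by (simp add: nsq_eq_inner L12_D stepf_L12)

section \<open>Density of step functions\<close>

definition L1n :: "(real \<times> real \<Rightarrow> complex) \<Rightarrow> ennreal" where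
  "L1n f = (\<integral>\<^sup>+ x. ennreal (cmod (f x)) \<partial>lborel)"

text \<open>Approximation in both norms by the same step function: the L^1 part makes the Fourier
  integrals converge pointwise, the L^2 part feeds Parseval's identity.\<close>

definition step_approx :: "(real \<times> real \<Rightarrow> complex) \<Rightarrow> bool" where
  "step_approx f \<longleftrightarrow> f \<in> L12 \<and> (\<forall>e>0. \<exists>s\<in>stepf. nsq (\<lambda>x. s x - f x) < ennreal e \<and> L1n (\<lambda>x. s x - f x) < ennreal e)"

lemma L1n_add_le:
  assumes [measurable]: "f \<in> borel_measurable borel" "g \<in> borel_measurable borel"
  shows "L1n (\<lambda>x. f x + g x) \<le> L1n f + L1n g"
  unfolding L1n_def
  by (subst nn_integral_add[symmetric])
     (auto intro!: nn_integral_mono norm_triangle_ineq simp flip: ennreal_plus)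

lemma L1n_cmult:
  assumes [measurable]: "f \<in> borel_measurable borel"
  shows "L1n (\<lambda>x. c * f x) = ennreal (cmod c) * L1n f"
  unfolding L1n_def by (simp add: norm_mult ennreal_mult' nn_integral_cmult)

lemma nsq_add_le2:
  assumes "f \<in> borel_measurable borel" "g \<in> borel_measurable borel"
  shows "nsq (\<lambda>x. f x + g x) \<le> 2 * nsq f + 2 * nsq g"
  using nsq_add_le[OF assms, of 1] by simp

lemma ennreal_two_mult_add_less:
  assumes "a < ennreal (e / 4)" "b < ennreal (e / 4)" "e > 0"
  shows "2 * a + 2 * b < ennreal e" "a + b < ennreal e"
proof -
  obtain a' b' where ab: "a = ennreal a'" "b = ennreal b'" "a' \<ge> 0" "b' \<ge> 0"
    using assms by (cases a; cases b) auto
  have l: "a' < e / 4" "b' < e / 4" using assms ab by (auto simp: ennreal_less_iff)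
  have "2 * a + 2 * b = ennreal (2 * a' + 2 * b')" "a + b = ennreal (a' + b')"
    using ab by (simp_all add: ennreal_mult)
  then show "2 * a + 2 * b < ennreal e" "a + b < ennreal e"
    using l ab(3,4) by (simp_all only: ennreal_less_iff add_nonneg_nonneg mult_nonneg_nonneg)
qed

lemma step_approx_zero: "step_approx (\<lambda>x. 0)"
  unfolding step_approx_def by (auto intro!: bexI[of _ "\<lambda>x. 0"] stepf.zero simp: nsq_def L1n_def)

lemma step_approx_add_cmult:
  assumes "step_approx f" "step_approx g"
  shows "step_approx (\<lambda>x. f x + c * g x)"
  unfolding step_approx_def
proof (intro conjI allI impI)
  have L: "f \<in> L12" "g \<in> L12" using assms by (auto simp: step_approx_def)
  note [measurable] = L
  show "(\<lambda>x. f x + c * g x) \<in> L12" by (intro L12_add L)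
  fix e :: real assume e: "e > 0"
  \<comment> \<open>Multiplying by \<open>c\<close> scales \<open>L1n\<close> by |c| and
    \<open>nsq\<close> by |c|^2; \<open>K\<close> dominates both factors and is positive even for c
    = 0.\<close>
  define K where "K = 1 + cmod c + (cmod c)\<^sup>2"
  define d where "d = e / 4 / K"
  have K: "K \<ge> 1" by (simp add: K_def)
  have d: "d > 0" unfolding d_def using e K by (intro divide_pos_pos) linarith+
  have dle: "(cmod c)\<^sup>2 * d \<le> e / 4" "cmod c * d \<le> e / 4"
  proof -
    have "x * d \<le> e / 4" if "0 \<le> x" "x \<le> K" for x
    proof -
      have "x * d \<le> K * d" using that d by (intro mult_right_mono) auto
      also have "\<dots> = e / 4" using K unfolding d_def by simp
      finally show ?thesis .
    qed
    then show "(cmod c)\<^sup>2 * d \<le> e / 4" "cmod c * d \<le> e / 4" unfolding K_def by auto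
  qed
  obtain s where s: "s \<in> stepf" "nsq (\<lambda>x. s x - f x) < ennreal (e / 4)" "L1n (\<lambda>x. s x - f x) < ennreal (e / 4)"
    using assms(1) e unfolding step_approx_def by (meson divide_pos_pos zero_less_numeral)
  obtain t where t: "t \<in> stepf" "nsq (\<lambda>x. t x - g x) < ennreal d" "L1n (\<lambda>x. t x - g x) < ennreal d"
    using assms(2) d unfolding step_approx_def by blast
  note [measurable] = stepf_L12[OF s(1)] stepf_L12[OF t(1)]
  have less: "k * y < ennreal (e / 4)" if "k * d \<le> e / 4" "k \<ge> 0" "y < ennreal d" for k y
  proof (cases "k = 0")
    case False
    then have "ennreal k * y < ennreal k * ennreal d"
      using that by (intro ennreal_mult_strict_left_mono) (auto simp: ennreal_zero_less_mult_iff)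
    also have "\<dots> \<le> ennreal (e / 4)" using that d by (simp add: ennreal_mult'[symmetric] ennreal_leI)
    finally show ?thesis .
  qed (use e in simp)
  have eq: "(\<lambda>x. s x + c * t x - (f x + c * g x)) = (\<lambda>x. (s x - f x) + c * (t x - g x))"
    by (simp add: fun_eq_iff algebra_simps)
  have "nsq (\<lambda>x. c * (t x - g x)) < ennreal (e / 4)" "L1n (\<lambda>x. c * (t x - g x)) < ennreal (e / 4)"
    using less[OF dle(1) _ t(2)] less[OF dle(2) _ t(3)] by (simp_all add: nsq_cmult L1n_cmult)
  note * = ennreal_two_mult_add_less[OF s(2) this(1) e] ennreal_two_mult_add_less[OF s(3) this(2) e]
  show "\<exists>s\<in>stepf. nsq (\<lambda>x. s x - (f x + c * g x)) < ennreal e \<and> L1n (\<lambda>x. s x - (f x + c * g x)) < ennreal e"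
  proof (rule bexI[of _ "\<lambda>x. s x + c * t x"], unfold eq, intro conjI)
    show "nsq (\<lambda>x. (s x - f x) + c * (t x - g x)) < ennreal e"
      by (rule order.strict_trans1[OF nsq_add_le2 *(1)]) measurable
    show "L1n (\<lambda>x. (s x - f x) + c * (t x - g x)) < ennreal e"
      by (rule order.strict_trans1[OF L1n_add_le *(4)]) measurable
  qed (intro stepf_add_cmult s t)
qed

lemma step_approx_sum:
  assumes "finite I" "\<And>i. i \<in> I \<Longrightarrow> step_approx (f i)"
  shows "step_approx (\<lambda>x. \<Sum>i\<in>I. f i x)"
  using assms
proof (induction I rule: finite_induct)
  case (insert i I)
  then show ?case using step_approx_add_cmult[of "\<lambda>x. \<Sum>i\<in>I. f i x" "f i" 1] by (simp add: add.commute)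
qed (simp add: step_approx_zero)

lemma step_approx_limit:
  assumes "\<And>k. step_approx (u k)" and f: "f \<in> L12" and lim: "\<And>x. (\<lambda>k. u k x) \<longlonglongrightarrow> f x"
    and bd: "\<And>k x. cmod (u k x) \<le> 2 * cmod (f x)"
  shows "step_approx f"
  unfolding step_approx_def
proof (intro conjI allI impI f)
  fix e :: real assume e: "e > 0"
  have L: "u k \<in> L12" for k using assms(1) by (auto simp: step_approx_def)
  note [measurable] = L f
  have "\<forall>\<^sub>F k in sequentially. nsq (\<lambda>x. u k x - f x) < ennreal (e / 4)"
    using nsq_dominated_convergence[OF _ L12_D(2)[OF f] lim bd] e
    by (intro order_tendstoD) auto
  moreover have "\<forall>\<^sub>F k in sequentially. L1n (\<lambda>x. u k x - f x) < ennreal (e / 4)"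
    using L1_dominated_convergence[OF _ L12_D(1)[OF f] lim bd] e unfolding L1n_def
    by (intro order_tendstoD) auto
  ultimately have "\<forall>\<^sub>F k in sequentially. nsq (\<lambda>x. u k x - f x) < ennreal (e / 4) \<and> L1n (\<lambda>x. u k x - f x) < ennreal (e / 4)"
    by eventually_elim simp
  then obtain k where k: "nsq (\<lambda>x. u k x - f x) < ennreal (e / 4)" "L1n (\<lambda>x. u k x - f x) < ennreal (e / 4)"
    by (auto simp: eventually_sequentially)
  obtain s where s: "s \<in> stepf" "nsq (\<lambda>x. s x - u k x) < ennreal (e / 4)" "L1n (\<lambda>x. s x - u k x) < ennreal (e / 4)"
    using assms(1)[of k] e unfolding step_approx_def by (meson divide_pos_pos zero_less_numeral)
  note [measurable] = stepf_L12[OF s(1)]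
  have eq: "(\<lambda>x. s x - f x) = (\<lambda>x. (s x - u k x) + (u k x - f x))" by simp
  note * = ennreal_two_mult_add_less[OF s(2) k(1) e] ennreal_two_mult_add_less[OF s(3) k(2) e]
  show "\<exists>s\<in>stepf. nsq (\<lambda>x. s x - f x) < ennreal e \<and> L1n (\<lambda>x. s x - f x) < ennreal e"
  proof (rule bexI[OF _ s(1)], unfold eq, intro conjI)
    show "nsq (\<lambda>x. (s x - u k x) + (u k x - f x)) < ennreal e"
      by (rule order.strict_trans1[OF nsq_add_le2 *(1)]) measurable
    show "L1n (\<lambda>x. (s x - u k x) + (u k x - f x)) < ennreal e"
      by (rule order.strict_trans1[OF L1n_add_le *(4)]) measurable
  qed
qed

lemma step_approx_rect: "step_approx (rect a b c d)"
proof (cases "a < b \<and> c < d")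
  case True
  then have "rect a b c d \<in> stepf" using stepf.add[OF stepf.zero, of a b c d 1] by simp
  then show ?thesis unfolding step_approx_def
    by (auto intro!: L12_rect bexI[of _ "rect a b c d"] simp: nsq_def L1n_def)
next
  case False
  then have "rect a b c d = (\<lambda>x. 0)" by (auto simp: rect_def fun_eq_iff indicator_def)
  then show ?thesis by (simp add: step_approx_zero)
qed

lemma indicator_L12:
  assumes "S \<in> sets borel" "emeasure lborel S < \<infinity>"
  shows "(indicator S :: real \<times> real \<Rightarrow> complex) \<in> L12"
proof -
  have "integrable lborel (\<lambda>x. complex_of_real (indicator S x))"
    using assms by (intro integrable_of_real integrable_real_indicator) auto
  then have int: "integrable lborel (indicator S :: real \<times> real \<Rightarrow> complex)" by (simp add: of_real_indicator)
  have "(cmod (indicator S x))\<^sup>2 = cmod (indicator S x)" for x :: "real \<times> real"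
    by (auto simp: indicator_def)
  then show ?thesis
    using int integrable_norm[OF int] by (auto simp: L12_def L2_def)
qed

text \<open>Dynkin's argument with the lower orthants as intersection-stable generator. Cutting with
  a fixed box keeps all measures finite, so that complements stay approximable.\<close>

lemma step_approx_indicator_bounded:
  fixes S :: "(real \<times> real) set" and m :: real
  assumes "S \<in> sets borel"
  shows "step_approx (indicator (S \<inter> {-m<..m} \<times> {-m<..m}))"
proof -
  let ?B = "{-m<..m} \<times> {-m<..m}"
  have B: "?B \<in> sets borel" by (intro borel_Times) auto
  have fin: "emeasure lborel T < \<infinity>" if "T \<subseteq> ?B" for T
    by (rule emeasure_bounded_finite, rule bounded_subset[OF _ that]) (auto intro!: bounded_Times)
  have "{..x} \<inter> {..y} = {..inf x y}" for x y :: "real \<times> real" by auto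
  then have "Int_stable (range (\<lambda>a::real \<times> real. {..a}))" "range (\<lambda>a::real \<times> real. {..a}) \<subseteq> Pow UNIV"
      "S \<in> sigma_sets UNIV (range (\<lambda>a. {..a}))"
    using assms by (auto simp: borel_eq_atMost Int_stable_def)
  then show ?thesis
  proof (induction rule: sigma_sets_induct_disjoint)
    case (basic S)
    then obtain p q where S: "S = {..(p, q)}" by auto
    have "indicator (S \<inter> ?B) = rect (-m) (min p m) (-m) (min q m)"
      by (auto simp: S rect_def fun_eq_iff indicator_def less_eq_prod_def)
    then show ?case by (simp add: step_approx_rect)
  next
    case empty
    show ?case by (simp add: step_approx_zero)
  next
    case (compl S)
    have "indicator ((UNIV - S) \<inter> ?B) = (\<lambda>x. rect (-m) m (-m) m x + (-1) * indicator (S \<inter> ?B) x)"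
      by (auto simp: rect_def fun_eq_iff indicator_def)
    then show ?case using step_approx_add_cmult[OF step_approx_rect compl(2), of "-m" m "-m" m "-1"] by simp
  next
    case (union S)
    show ?case
    proof (rule step_approx_limit)
      show "step_approx (\<lambda>x. \<Sum>i<k. indicator (S i \<inter> ?B) x)" for k
        by (intro step_approx_sum union) auto
      have "range S \<subseteq> sets borel" using union(2) by (simp add: borel_eq_atMost)
      then have "(\<Union>i. S i) \<in> sets borel" by (rule sets.countable_UN)
      then show "indicator ((\<Union>i. S i) \<inter> ?B) \<in> L12"
        using B by (intro indicator_L12 fin sets.Int) auto
      have eq: "(\<Sum>i<k. indicator (S i \<inter> ?B) x) = (indicator ((\<Union>i<k. S i) \<inter> ?B) x :: complex)" for k x
      proof -
        have "disjoint_family_on (\<lambda>i. S i \<inter> ?B) {..<k}"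
          using union(1) unfolding disjoint_family_on_def by blast
        then have "indicator (\<Union>i<k. S i \<inter> ?B) x = (\<Sum>i<k. indicator (S i \<inter> ?B) x :: complex)"
          by (intro indicator_UN_disjoint) auto
        moreover have "(\<Union>i<k. S i \<inter> ?B) = (\<Union>i<k. S i) \<inter> ?B" by blast
        ultimately show ?thesis by simp
      qed
      show "(\<lambda>k. \<Sum>i<k. indicator (S i \<inter> ?B) x) \<longlonglongrightarrow> (indicator ((\<Union>i. S i) \<inter> ?B) x :: complex)" for x
        unfolding eq
      proof (cases "x \<in> (\<Union>i. S i) \<inter> ?B")
        case True
        then obtain j where "x \<in> S j" by auto
        then show "(\<lambda>k. indicator ((\<Union>i<k. S i) \<inter> ?B) x) \<longlonglongrightarrow> (indicator ((\<Union>i. S i) \<inter> ?B) x :: complex)"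
          using True by (intro tendsto_eventually eventually_sequentiallyI[of "Suc j"]) (auto simp: indicator_def)
      next
        case False
        then show "(\<lambda>k. indicator ((\<Union>i<k. S i) \<inter> ?B) x) \<longlonglongrightarrow> (indicator ((\<Union>i. S i) \<inter> ?B) x :: complex)"
          by (intro tendsto_eventually) (auto simp: indicator_def)
      qed
      show "cmod (\<Sum>i<k. indicator (S i \<inter> ?B) x) \<le> 2 * cmod (indicator ((\<Union>i. S i) \<inter> ?B) x)" for k x
        unfolding eq by (auto simp: indicator_def)
    qed
  qed
qed

lemma step_approx_indicator:
  assumes "S \<in> sets borel" "emeasure lborel S < \<infinity>"
  shows "step_approx (indicator S)"
proof (rule step_approx_limit)
  let ?B = "\<lambda>k. {-real k<..real k} \<times> {-real k<..real k}"
  show "step_approx (indicator (S \<inter> ?B k))" for k by (rule step_approx_indicator_bounded[OF assms(1)])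
  show "indicator S \<in> L12" by (rule indicator_L12[OF assms])
  show "(\<lambda>k. indicator (S \<inter> ?B k) x) \<longlonglongrightarrow> (indicator S x :: complex)" for x
  proof -
    obtain N where N: "\<bar>fst x\<bar> + \<bar>snd x\<bar> < real N" using reals_Archimedean2 by blast
    have "indicator (S \<inter> ?B n) x = (indicator S x :: complex)" if "n \<ge> N" for n
    proof -
      have "real N \<le> real n" using that by simp
      then show ?thesis using N by (cases x) (auto simp: indicator_def)
    qed
    then show ?thesis by (intro tendsto_eventually eventually_sequentiallyI[of N])
  qed
  show "cmod (indicator (S \<inter> ?B k) x) \<le> 2 * cmod (indicator S x)" for k x
    by (auto simp: indicator_def)
qed

lemma L12_step_approx:
  assumes f: "f \<in> L12" shows "step_approx f"
proof -
  note [measurable] = f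
  have "f \<in> borel_measurable lborel" by simp
  then obtain s where s: "\<And>i. simple_function lborel (s i)" "\<And>x. (\<lambda>i. s i x) \<longlonglongrightarrow> f x"
      and bd: "\<And>i x. dist (s i x) 0 \<le> 2 * dist (f x) 0"
    using borel_measurable_implies_sequence_metric[of f lborel 0] by auto
  show ?thesis
  proof (rule step_approx_limit[OF _ f s(2)])
    show bd': "cmod (s k x) \<le> 2 * cmod (f x)" for k x using bd[of k x] by simp
    show "step_approx (s k)" for k
    proof -
      have [measurable]: "s k \<in> borel_measurable borel"
        using s(1)[of k] borel_measurable_simple_function by fastforce
      have fin: "finite (range (s k))" using simple_functionD(1)[OF s(1)[of k]] by simp
      have eq: "s k = (\<lambda>x. \<Sum>y\<in>range (s k) - {0}. 0 + y * indicator (s k -` {y}) x)"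
      proof
        fix x
        have "(\<Sum>y\<in>range (s k) - {0}. 0 + y * indicator (s k -` {y}) x) = (\<Sum>y\<in>range (s k) - {0}. if y = s k x then s k x else 0)"
          by (intro sum.cong) (auto simp: indicator_def)
        also have "\<dots> = s k x" using fin by (auto simp: sum.delta)
        finally show "s k x = (\<Sum>y\<in>range (s k) - {0}. 0 + y * indicator (s k -` {y}) x)" by simp
      qed
      have "step_approx (indicator (s k -` {y}))" if "y \<noteq> 0" for y
      proof (rule step_approx_indicator)
        have "s k -` {y} \<inter> space borel \<in> sets borel" by (rule measurable_sets[of _ borel borel]) auto
        then show S: "s k -` {y} \<in> sets borel" by simp
        \<comment> \<open>Chebyshev's inequality: where \<open>s k\<close> takes the value y, the
          bound \<open>bd'\<close> forces |f| >= |y| / 2, so the fibre has finite measure.\<close>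
        have "ennreal (cmod y / 2) * emeasure lborel (s k -` {y}) = (\<integral>\<^sup>+x. ennreal (cmod y / 2) * indicator (s k -` {y}) x \<partial>lborel)"
          using S by (simp add: nn_integral_cmult_indicator)
        also have "\<dots> \<le> (\<integral>\<^sup>+x. ennreal (cmod (f x)) \<partial>lborel)"
        proof (rule nn_integral_mono)
          show "ennreal (cmod y / 2) * indicator (s k -` {y}) x \<le> ennreal (cmod (f x))" for x
            using bd'[of k x] by (auto simp: indicator_def intro!: ennreal_leI)
        qed
        also have "\<dots> < \<infinity>" using L12_D(1)[OF f] by (simp add: integrable_iff_bounded)
        finally show "emeasure lborel (s k -` {y}) < \<infinity>"
          using that by (auto simp: ennreal_mult_less_top)
      qed
      then show ?thesis
        by (subst eq) (intro step_approx_sum step_approx_add_cmult step_approx_zero finite_Diff fin, auto)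
    qed
  qed
qed

text \<open>Truncation to a box makes \<open>f\<close> integrable, being a product of two square
  integrable functions, and so reduces the claim to \<open>L12_step_approx\<close>.\<close>

lemma L2_step_approx:
  assumes f: "f \<in> L2" and e: "e > 0"
  shows "\<exists>s\<in>stepf. nsq (\<lambda>x. s x - f x) < ennreal e"
proof -
  note [measurable] = f
  let ?B = "\<lambda>k. {-real k<..real k} \<times> {-real k<..real k}"
  have [measurable]: "?B k \<in> sets borel" for k by (intro borel_Times) auto
  define u where "u k x = indicator (?B k) x * f x" for k x
  have [measurable]: "u k \<in> borel_measurable borel" for k unfolding u_def[abs_def] by measurable
  have "indicator (?B k) \<in> L12" for k
    by (intro indicator_L12 emeasure_bounded_finite bounded_Times) auto
  then have "u k \<in> L12" for k
  proof -
    assume i: "indicator (?B k) \<in> L12" for k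
    have "integrable lborel (u k)"
      unfolding u_def[abs_def] by (intro L2_integrable_mult f L12_D(2) i)
    moreover have "nsq (u k) \<le> nsq f"
      unfolding nsq_def u_def by (intro nn_integral_mono) (auto simp: indicator_def)
    ultimately show ?thesis using f by (auto simp: L12_def L2_iff)
  qed
  have lim: "(\<lambda>k. u k x) \<longlonglongrightarrow> f x" for x
  proof -
    obtain N where N: "\<bar>fst x\<bar> + \<bar>snd x\<bar> < real N" using reals_Archimedean2 by blast
    have "u n x = f x" if "n \<ge> N" for n
    proof -
      have "real N \<le> real n" using that by simp
      then show ?thesis using N by (cases x) (auto simp: indicator_def u_def)
    qed
    then show ?thesis by (intro tendsto_eventually eventually_sequentiallyI[of N])
  qed
  have "(\<lambda>k. nsq (\<lambda>x. u k x - f x)) \<longlonglongrightarrow> 0"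
    by (rule nsq_dominated_convergence[OF _ f lim]) (auto simp: u_def indicator_def)
  then have "\<forall>\<^sub>F k in sequentially. nsq (\<lambda>x. u k x - f x) < ennreal (e / 4)"
    using e by (intro order_tendstoD) auto
  then obtain k where k: "nsq (\<lambda>x. u k x - f x) < ennreal (e / 4)"
    by (auto simp: eventually_sequentially)
  obtain s where s: "s \<in> stepf" "nsq (\<lambda>x. s x - u k x) < ennreal (e / 4)"
    using L12_step_approx[OF \<open>u k \<in> L12\<close>] e unfolding step_approx_def by (meson divide_pos_pos zero_less_numeral)
  note [measurable] = stepf_L12[OF s(1)]
  have "nsq (\<lambda>x. (s x - u k x) + (u k x - f x)) < ennreal e"
    by (rule order.strict_trans1[OF nsq_add_le2 ennreal_two_mult_add_less(1)[OF s(2) k e]]) measurable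
  then show ?thesis using s(1) by auto
qed

section \<open>Plancherel's theorem for integrable functions\<close>

text \<open>A crude constant is enough at this stage: the aim is that transforms lie in L^2 and
  depend continuously on \<open>f\<close>. L^1 convergence gives pointwise convergence of the
  transforms, Parseval controls the step functions, and Fatou's lemma joins the two.\<close>

lemma nsq_fourier_L1_le:
  assumes f: "f \<in> L12" shows "nsq (fourier_L1 f) \<le> 2 * nsq f"
proof (rule ennreal_le_epsilon)
  fix e :: real assume e: "e > 0"
  \<comment> \<open>The bound \<open>e / 2\<close> pays for the doubled error in
    \<open>nsq_add_le2\<close>, and 1 / (k + 1) forces convergence.\<close>
  have "\<exists>s\<in>stepf. nsq (\<lambda>x. s x - f x) < ennreal (min (e / 2) (1 / real (Suc k))) \<and>
      L1n (\<lambda>x. s x - f x) < ennreal (min (e / 2) (1 / real (Suc k)))" for k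
    using L12_step_approx[OF f] e unfolding step_approx_def by (auto simp del: of_nat_Suc)
  then obtain s where s: "\<And>k. s k \<in> stepf" "\<And>k. nsq (\<lambda>x. s k x - f x) < ennreal (min (e / 2) (1 / real (Suc k)))"
      "\<And>k. L1n (\<lambda>x. s k x - f x) < ennreal (min (e / 2) (1 / real (Suc k)))"
    by metis
  note [measurable] = f stepf_L12[OF s(1)]
  have conv: "(\<lambda>k. fourier_L1 (s k) x) \<longlonglongrightarrow> fourier_L1 f x" for x
  proof (rule LIM_zero_cancel, rule tendsto_norm_zero_cancel, rule tendsto_sandwich[OF _ _ tendsto_const LIMSEQ_Suc[OF lim_1_over_n]])
    show "\<forall>\<^sub>F k in sequentially. norm (fourier_L1 (s k) x - fourier_L1 f x) \<le> 1 / real (Suc k)"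
    proof (intro always_eventually allI)
      fix k
      have "ennreal (cmod (fourier_L1 (\<lambda>x. s k x - f x) x)) \<le> L1n (\<lambda>x. s k x - f x)"
        unfolding L1n_def by (intro fourier_L1_bound) (use stepf_L12[OF s(1)[of k]] f in \<open>auto dest: L12_D\<close>)
      also have "\<dots> \<le> ennreal (1 / real (Suc k))"
        using order.strict_implies_order[OF s(3)[of k]] by (rule order_trans) (intro ennreal_leI, simp)
      finally have "cmod (fourier_L1 (\<lambda>x. s k x - f x) x) \<le> 1 / real (Suc k)"
        by (simp del: of_nat_Suc)
      then show "norm (fourier_L1 (s k) x - fourier_L1 f x) \<le> 1 / real (Suc k)"
        using stepf_L12[OF s(1)[of k]] f by (simp add: fourier_L1_diff L12_D del: of_nat_Suc)
    qed
  qed (auto intro!: always_eventually)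
  have "nsq (fourier_L1 f) = (\<integral>\<^sup>+x. liminf (\<lambda>k. ennreal ((cmod (fourier_L1 (s k) x))\<^sup>2)) \<partial>lborel)"
    unfolding nsq_def
  proof (rule nn_integral_cong)
    fix x
    have "(\<lambda>k. ennreal ((cmod (fourier_L1 (s k) x))\<^sup>2)) \<longlonglongrightarrow> ennreal ((cmod (fourier_L1 f x))\<^sup>2)"
      by (intro tendsto_ennrealI tendsto_intros conv)
    then show "ennreal ((cmod (fourier_L1 f x))\<^sup>2) = liminf (\<lambda>k. ennreal ((cmod (fourier_L1 (s k) x))\<^sup>2))"
      by (rule lim_imp_Liminf[OF sequentially_bot, symmetric])
  qed
  also have "\<dots> \<le> liminf (\<lambda>k. nsq (fourier_L1 (s k)))"
    unfolding nsq_def by (rule nn_integral_liminf) measurable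
  also have "\<dots> \<le> liminf (\<lambda>k. 2 * nsq f + ennreal e)"
  proof (intro Liminf_mono always_eventually allI)
    fix k
    have "nsq (fourier_L1 (s k)) = nsq (\<lambda>x. f x + (s k x - f x))"
      using stepf_plancherel[OF s(1)[of k]] by simp
    also have "\<dots> \<le> 2 * nsq f + 2 * nsq (\<lambda>x. s k x - f x)"
      by (intro nsq_add_le2) measurable
    also have "\<dots> \<le> 2 * nsq f + 2 * ennreal (e / 2)"
      using order.strict_implies_order[OF s(2)[of k]]
      by (intro add_left_mono mult_left_mono) (auto elim!: order_trans intro!: ennreal_leI)
    also have "2 * ennreal (e / 2) = ennreal e"
      using ennreal_mult'[of 2 "e / 2"] by simp
    finally show "nsq (fourier_L1 (s k)) \<le> 2 * nsq f + ennreal e" .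
  qed
  also have "\<dots> = 2 * nsq f + ennreal e" by (simp add: Liminf_const)
  finally show "nsq (fourier_L1 f) \<le> 2 * nsq f + ennreal e" .
qed

lemma fourier_L1_L2: "f \<in> L12 \<Longrightarrow> fourier_L1 f \<in> L2"
proof -
  assume f: "f \<in> L12"
  note [measurable] = f
  have "2 * nsq f < \<infinity>" using L12_D(2)[OF f] by (simp add: L2_iff ennreal_mult_less_top)
  then show ?thesis
    using nsq_fourier_L1_le[OF f] by (auto simp: L2_iff intro: order.strict_trans1)
qed

lemma ennreal_tendsto_0_I:
  fixes u :: "nat \<Rightarrow> ennreal"
  assumes "\<And>k. u k \<le> ennreal (v k)" "v \<longlonglongrightarrow> 0"
  shows "u \<longlonglongrightarrow> 0"
proof (rule tendsto_sandwich[OF _ _ tendsto_const])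
  show "(\<lambda>k. ennreal (v k)) \<longlonglongrightarrow> 0" using tendsto_ennrealI[OF assms(2)] by simp
qed (auto intro!: always_eventually assms)

text \<open>The crude bound, applied to \<open>s k - f\<close>, shows that the transforms of the
  step functions converge in L^2; hence the isometry passes to the limit in both directions.\<close>

lemma plancherel_L12:
  assumes f: "f \<in> L12" shows "nsq (fourier_L1 f) = nsq f"
proof -
  have "\<exists>s\<in>stepf. nsq (\<lambda>x. s x - f x) < ennreal (1 / real (Suc k))" for k
    by (rule L2_step_approx) (use f in \<open>auto dest: L12_D\<close>)
  then obtain s where s: "\<And>k. s k \<in> stepf" "\<And>k. nsq (\<lambda>x. s k x - f x) < ennreal (1 / real (Suc k))"
    by metis
  note [measurable] = f stepf_L12[OF s(1)]
  have lim: "(\<lambda>k. nsq (\<lambda>x. s k x - f x)) \<longlonglongrightarrow> 0"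
    using order.strict_implies_order[OF s(2)] LIMSEQ_Suc[OF lim_1_over_n] by (rule ennreal_tendsto_0_I)
  have lim2: "(\<lambda>k. nsq (\<lambda>x. fourier_L1 (s k) x - fourier_L1 f x)) \<longlonglongrightarrow> 0"
  proof (rule tendsto_sandwich[OF _ _ tendsto_const])
    show "(\<lambda>k. 2 * nsq (\<lambda>x. s k x - f x)) \<longlonglongrightarrow> 0"
      using ennreal_tendsto_cmult[OF _ lim, of 2] by simp
    show "\<forall>\<^sub>F k in sequentially. nsq (\<lambda>x. fourier_L1 (s k) x - fourier_L1 f x) \<le> 2 * nsq (\<lambda>x. s k x - f x)"
    proof (intro always_eventually allI)
      fix k
      have "(\<lambda>x. fourier_L1 (s k) x - fourier_L1 f x) = fourier_L1 (\<lambda>x. s k x - f x)"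
        using stepf_L12[OF s(1)[of k]] f by (intro ext) (simp add: fourier_L1_diff L12_D)
      then show "nsq (\<lambda>x. fourier_L1 (s k) x - fourier_L1 f x) \<le> 2 * nsq (\<lambda>x. s k x - f x)"
        using nsq_fourier_L1_le[OF L12_diff[OF stepf_L12[OF s(1)] f], of k] by simp
    qed
  qed auto
  show ?thesis
  proof (rule antisym)
    show "nsq (fourier_L1 f) \<le> nsq f"
      by (rule nsq_le_limit[OF _ _ _ _ lim lim2]) (auto simp: stepf_plancherel s)
    show "nsq f \<le> nsq (fourier_L1 f)"
      by (rule nsq_le_limit[OF _ _ _ _ lim2 lim]) (auto simp: stepf_plancherel s)
  qed
qed

text \<open>The transform is symmetric for the bilinear pairing, since its kernel is symmetric. This
  identity is the source of surjectivity in \<open>fourier_surj\<close>.\<close>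

lemma fourier_L1_mult_formula:
  assumes f: "f \<in> L12" and g: "g \<in> L12"
  shows "(LINT x|lborel. fourier_L1 f x * g x) = (LINT x|lborel. f x * fourier_L1 g x)"
proof -
  have [measurable]: "f \<in> borel_measurable borel" "g \<in> borel_measurable borel"
    using f g by (auto dest: L12_measurable)
  let ?h = "\<lambda>x y. exp (- 2 * pi * \<i> * of_real (x \<bullet> y)) * (g x * f y)"
  have "integrable (lborel \<Otimes>\<^sub>M lborel) (\<lambda>x. g (fst x) * f (snd x))"
    using integral_tensor(1)[OF L12_D(1)[OF g] L12_D(1)[OF f]] by (simp add: lborel_prod)
  then have int: "integrable (lborel \<Otimes>\<^sub>M lborel) (\<lambda>(x, y). ?h x y)"
  proof (rule Bochner_Integration.integrable_bound)
    show "(\<lambda>(x, y). ?h x y) \<in> borel_measurable (lborel \<Otimes>\<^sub>M lborel)" by measurable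
  qed (auto simp: norm_mult)
  have "(LINT x|lborel. fourier_L1 f x * g x) = (LINT x|lborel. LINT y|lborel. ?h x y)"
    unfolding fourier_L1_def by (simp add: mult_ac flip: integral_mult_right_zero)
  also have "\<dots> = (LINT y|lborel. LINT x|lborel. ?h x y)"
    by (rule lborel_pair.Fubini_integral[OF int, symmetric])
  also have "\<dots> = (LINT x|lborel. f x * fourier_L1 g x)"
    unfolding fourier_L1_def
    by (simp add: mult_ac inner_commute flip: integral_mult_right_zero)
  finally show ?thesis .
qed

text \<open>The Riesz--Fischer argument at a fixed geometric rate. Weighting the k-th squared
  increment by 4^k still leaves the summable 4^-k out of 16^-k; finiteness of the weighted sum at a
  point then bounds the k-th increment there by a multiple of 2^-k, and Fatou's lemma gives the rate
  for the limit.\<close>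

lemma L2_complete:
  assumes u: "\<And>k. u k \<in> L2" and cauchy: "\<And>k l. k \<le> l \<Longrightarrow> nsq (\<lambda>x. u l x - u k x) \<le> ennreal ((1 / 16) ^ k)"
  shows "\<exists>g\<in>L2. \<forall>k. nsq (\<lambda>x. u k x - g x) \<le> ennreal ((1 / 16) ^ k)"
proof -
  note [measurable] = u
  define w where "w x = (\<Sum>k. ennreal (4 ^ k * (cmod (u (Suc k) x - u k x))\<^sup>2))" for x
  have [measurable]: "w \<in> borel_measurable borel" unfolding w_def[abs_def] by measurable
  have "(\<integral>\<^sup>+x. w x \<partial>lborel) = (\<Sum>k. ennreal (4 ^ k) * nsq (\<lambda>x. u (Suc k) x - u k x))"
    unfolding w_def nsq_def
    by (subst nn_integral_suminf) (simp_all add: ennreal_mult' nn_integral_cmult)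
  also have "\<dots> \<le> (\<Sum>k. ennreal ((1 / 4) ^ k))"
  proof (rule suminf_le)
    fix k
    have "ennreal (4 ^ k) * nsq (\<lambda>x. u (Suc k) x - u k x) \<le> ennreal (4 ^ k) * ennreal ((1 / 16) ^ k)"
      by (intro mult_left_mono cauchy) auto
    also have "\<dots> = ennreal ((1 / 4) ^ k)"
      by (simp add: ennreal_mult'[symmetric] power_mult_distrib[symmetric])
    finally show "ennreal (4 ^ k) * nsq (\<lambda>x. u (Suc k) x - u k x) \<le> ennreal ((1 / 4) ^ k)" .
  qed auto
  also have "\<dots> = ennreal (\<Sum>k. (1 / 4) ^ k)"
    by (rule suminf_ennreal2) (auto intro!: summable_geometric)
  finally have "(\<integral>\<^sup>+x. w x \<partial>lborel) < \<infinity>" by (auto intro: order.strict_trans1)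
  then have "AE x in lborel. w x \<noteq> \<infinity>" by (intro nn_integral_noteq_infinite) auto
  then have AEc: "AE x in lborel. convergent (\<lambda>k. u k x)"
  proof eventually_elim
    fix x assume "w x \<noteq> \<infinity>"
    then obtain C where C: "w x = ennreal C" "C \<ge> 0" by (cases "w x") auto
    have le: "cmod (u (Suc k) x - u k x) \<le> sqrt C * (1 / 2) ^ k" for k
    proof -
      define F where "F j = ennreal (4 ^ j * (cmod (u (Suc j) x - u j x))\<^sup>2)" for j
      have "sum F {k} \<le> suminf F" by (intro sum_le_suminf) auto
      then have "F k \<le> w x" unfolding w_def F_def[symmetric] by simp
      then have "ennreal (4 ^ k * (cmod (u (Suc k) x - u k x))\<^sup>2) \<le> ennreal C"
        unfolding F_def C .
      then have "4 ^ k * (cmod (u (Suc k) x - u k x))\<^sup>2 \<le> C" by (subst (asm) ennreal_le_iff[OF C(2)])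
      moreover have "(2 ^ k * cmod (u (Suc k) x - u k x))\<^sup>2 = 4 ^ k * (cmod (u (Suc k) x - u k x))\<^sup>2"
        by (simp only: power_mult_distrib power_mult[symmetric] mult.commute[of k]) (simp only: power_mult, simp)
      ultimately have "(2 ^ k * cmod (u (Suc k) x - u k x))\<^sup>2 \<le> C" by simp
      then have "2 ^ k * cmod (u (Suc k) x - u k x) \<le> sqrt C" by (rule real_le_rsqrt)
      then show ?thesis by (simp add: field_simps)
    qed
    have "summable (\<lambda>k. sqrt C * (1 / 2) ^ k)"
      by (intro summable_mult summable_geometric) simp
    then have "summable (\<lambda>k. u (Suc k) x - u k x)"
      by (rule summable_comparison_test'[where N=0]) (rule le)
    then have "convergent (\<lambda>n. (u n x - u 0 x) + u 0 x)"
      unfolding summable_iff_convergent sum_lessThan_telescope[of "\<lambda>k. u k x"]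
      by (rule convergent_add[OF _ convergent_const])
    then show "convergent (\<lambda>k. u k x)" by simp
  qed
  define g where "g x = lim (\<lambda>k. u k x)" for x
  have [measurable]: "g \<in> borel_measurable borel" unfolding g_def[abs_def] by measurable
  have lim: "AE x in lborel. (\<lambda>k. u k x) \<longlonglongrightarrow> g x"
    using AEc by eventually_elim (simp add: g_def convergent_LIMSEQ_iff)
  have le: "nsq (\<lambda>x. u k x - g x) \<le> ennreal ((1 / 16) ^ k)" for k
  proof -
    have "nsq (\<lambda>x. u k x - g x) = (\<integral>\<^sup>+x. liminf (\<lambda>l. ennreal ((cmod (u l x - u k x))\<^sup>2)) \<partial>lborel)"
      unfolding nsq_def
    proof (rule nn_integral_cong_AE)
      show "AE x in lborel. ennreal ((cmod (u k x - g x))\<^sup>2) = liminf (\<lambda>l. ennreal ((cmod (u l x - u k x))\<^sup>2))"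
        using lim
      proof eventually_elim
        fix x assume "(\<lambda>k. u k x) \<longlonglongrightarrow> g x"
        then have "(\<lambda>l. ennreal ((cmod (u l x - u k x))\<^sup>2)) \<longlonglongrightarrow> ennreal ((cmod (g x - u k x))\<^sup>2)"
          by (intro tendsto_ennrealI tendsto_intros)
        then show "ennreal ((cmod (u k x - g x))\<^sup>2) = liminf (\<lambda>l. ennreal ((cmod (u l x - u k x))\<^sup>2))"
          by (subst norm_minus_commute) (rule lim_imp_Liminf[OF sequentially_bot, symmetric])
      qed
    qed
    also have "\<dots> \<le> liminf (\<lambda>l. nsq (\<lambda>x. u l x - u k x))"
      unfolding nsq_def by (rule nn_integral_liminf) measurable
    also have "\<dots> \<le> liminf (\<lambda>l. ennreal ((1 / 16) ^ k))"
      by (intro Liminf_mono eventually_sequentiallyI[of k] cauchy)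
    also have "\<dots> = ennreal ((1 / 16) ^ k)" by (simp add: Liminf_const)
    finally show ?thesis .
  qed
  have "(\<lambda>x. u 0 x - g x) \<in> L2"
    using le[of 0] by (auto simp: L2_iff intro: order.strict_trans1)
  then have "g \<in> L2" using L2_diff[OF u[of 0], of "\<lambda>x. u 0 x - g x"] by simp
  then show ?thesis using le by blast
qed

section \<open>The Fourier transform on square integrable functions\<close>

lemma L2_norm_squared: "(L2_norm g)\<^sup>2 = (\<integral>\<^sup>+x. (g x)\<^sup>2 \<partial>lborel)"
proof (cases "(\<integral>\<^sup>+x. (g x)\<^sup>2 \<partial>lborel)")
  case (real r)
  then show ?thesis by (simp add: L2_norm_def ennreal_power)
next
  case top
  then show ?thesis by (simp add: L2_norm_def ennreal_top_eq_mult_iff power2_eq_square)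
qed

lemma L2_norm_cmod_squared: "(L2_norm (\<lambda>x. ennreal (cmod (f x))))\<^sup>2 = nsq f"
  by (simp add: L2_norm_squared nsq_def ennreal_power)

lemma ennreal_power2_tendsto_0_iff:
  fixes a :: "nat \<Rightarrow> ennreal"
  shows "(\<lambda>k. (a k)\<^sup>2) \<longlonglongrightarrow> 0 \<longleftrightarrow> a \<longlonglongrightarrow> 0"
proof
  assume a: "(\<lambda>k. (a k)\<^sup>2) \<longlonglongrightarrow> 0"
  show "a \<longlonglongrightarrow> 0"
  proof (rule order_tendstoI)
    fix e :: ennreal assume "0 < e"
    then have "0 < e\<^sup>2" by (simp add: power2_eq_square ennreal_zero_less_mult_iff)
    then have "\<forall>\<^sub>F k in sequentially. (a k)\<^sup>2 < e\<^sup>2" using a by (rule order_tendstoD(2)[rotated])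
    then show "\<forall>\<^sub>F k in sequentially. a k < e"
      by eventually_elim (metis linorder_not_le power_mono zero_le)
  qed simp
next
  assume a: "a \<longlonglongrightarrow> 0"
  have "(\<lambda>k. a k * a k) \<longlonglongrightarrow> 0 * 0" by (intro tendsto_mult_ennreal a) auto
  then show "(\<lambda>k. (a k)\<^sup>2) \<longlonglongrightarrow> 0" by (simp add: power2_eq_square)
qed

lemma L2_tendsto_iff: "L2_tendsto u f \<longleftrightarrow> (\<lambda>k. nsq (\<lambda>x. u k x - f x)) \<longlonglongrightarrow> 0"
  unfolding L2_tendsto_def by (subst ennreal_power2_tendsto_0_iff[symmetric]) (simp add: L2_norm_cmod_squared)

lemma is_fourier_iff: "is_fourier f g \<longleftrightarrow> g \<in> L2 \<and> (\<exists>u. (\<forall>k. u k \<in> L12) \<and>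
    (\<lambda>k. nsq (\<lambda>x. u k x - f x)) \<longlonglongrightarrow> 0 \<and> (\<lambda>k. nsq (\<lambda>x. fourier_L1 (u k) x - g x)) \<longlonglongrightarrow> 0)"
  unfolding is_fourier_def L2_tendsto_iff L12_def by simp

lemma is_fourier_exists:
  assumes f: "f \<in> L2" shows "\<exists>g. is_fourier f g"
proof -
  \<comment> \<open>The quarter compensates for \<open>nsq_add_le2\<close>, which counts each of two
    errors twice.\<close>
  have "\<exists>s\<in>stepf. nsq (\<lambda>x. s x - f x) < ennreal ((1 / 16) ^ k / 4)" for k :: nat
    by (rule L2_step_approx[OF f]) simp
  then obtain s where s: "\<And>k. s k \<in> stepf" "\<And>k. nsq (\<lambda>x. s k x - f x) < ennreal ((1 / 16) ^ k / 4)"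
    by metis
  note [measurable] = f stepf_L12[OF s(1)]
  have L: "s k \<in> L12" for k by (intro stepf_L12 s)
  have "\<exists>g\<in>L2. \<forall>k. nsq (\<lambda>x. fourier_L1 (s k) x - g x) \<le> ennreal ((1 / 16) ^ k)"
  proof (rule L2_complete)
    fix k l :: nat assume kl: "k \<le> l"
    have "nsq (\<lambda>x. fourier_L1 (s l) x - fourier_L1 (s k) x) = nsq (fourier_L1 (\<lambda>x. s l x - s k x))"
      by (intro arg_cong[where f=nsq] ext) (simp add: fourier_L1_diff L L12_D)
    also have "\<dots> = nsq (\<lambda>x. (s l x - f x) + (f x - s k x))"
      by (subst plancherel_L12) (auto intro!: L12_diff L)
    also have "\<dots> \<le> 2 * nsq (\<lambda>x. s l x - f x) + 2 * nsq (\<lambda>x. f x - s k x)"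
      by (rule nsq_add_le2) measurable
    also have "\<dots> \<le> 2 * ennreal ((1 / 16) ^ l / 4) + 2 * ennreal ((1 / 16) ^ k / 4)"
      using s(2) by (intro add_mono mult_left_mono) (auto simp: nsq_minus[of f] less_imp_le)
    also have "\<dots> \<le> 2 * ennreal ((1 / 16) ^ k / 4) + 2 * ennreal ((1 / 16) ^ k / 4)"
      using kl by (intro add_mono mult_left_mono ennreal_leI divide_right_mono power_decreasing) auto
    also have "2 * ennreal ((1 / 16) ^ k / 4) = ennreal (2 * ((1 / 16) ^ k / 4))"
      by (simp only: ennreal_mult' ennreal_numeral zero_le_numeral)
    also have "ennreal (2 * ((1 / 16) ^ k / 4)) + ennreal (2 * ((1 / 16) ^ k / 4)) = ennreal ((1 / 16) ^ k)"
      by (subst ennreal_plus[symmetric]) auto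
    finally show "nsq (\<lambda>x. fourier_L1 (s l) x - fourier_L1 (s k) x) \<le> ennreal ((1 / 16) ^ k)" .
  qed (intro fourier_L1_L2 L)
  then obtain g where g: "g \<in> L2" "\<And>k. nsq (\<lambda>x. fourier_L1 (s k) x - g x) \<le> ennreal ((1 / 16) ^ k)"
    by blast
  have "is_fourier f g"
    unfolding is_fourier_iff
  proof (intro conjI g exI[of _ s] allI L)
    have p: "(\<lambda>k. (1 / 16 :: real) ^ k) \<longlonglongrightarrow> 0" by (rule LIMSEQ_power_zero) simp
    show "(\<lambda>k. nsq (\<lambda>x. fourier_L1 (s k) x - g x)) \<longlonglongrightarrow> 0"
      using g(2) p by (rule ennreal_tendsto_0_I)
    show "(\<lambda>k. nsq (\<lambda>x. s k x - f x)) \<longlonglongrightarrow> 0"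
      by (rule ennreal_tendsto_0_I[OF less_imp_le[OF s(2)]]) (intro tendsto_divide_zero p)
  qed
  then show ?thesis by blast
qed

lemma is_fourier_nsq:
  assumes "is_fourier f g" "f \<in> L2" shows "nsq g = nsq f"
proof -
  obtain u where u: "\<And>k. u k \<in> L12" and 1: "(\<lambda>k. nsq (\<lambda>x. u k x - f x)) \<longlonglongrightarrow> 0"
    and 2: "(\<lambda>k. nsq (\<lambda>x. fourier_L1 (u k) x - g x)) \<longlonglongrightarrow> 0" and g: "g \<in> L2"
    using assms(1) unfolding is_fourier_iff by blast
  note [measurable] = u g assms(2)
  show ?thesis
    by (intro antisym nsq_le_limit[OF _ _ _ _ 1 2] nsq_le_limit[OF _ _ _ _ 2 1])
       (auto simp: plancherel_L12 u)
qed

lemma nsq_tendsto_add_cmult: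
  assumes [measurable]: "\<And>k. u k \<in> borel_measurable borel" "f \<in> borel_measurable borel"
    "\<And>k. v k \<in> borel_measurable borel" "g \<in> borel_measurable borel"
    and 1: "(\<lambda>k. nsq (\<lambda>x. u k x - f x)) \<longlonglongrightarrow> 0" and 2: "(\<lambda>k. nsq (\<lambda>x. v k x - g x)) \<longlonglongrightarrow> 0"
  shows "(\<lambda>k. nsq (\<lambda>x. (u k x + c * v k x) - (f x + c * g x))) \<longlonglongrightarrow> 0"
proof (rule tendsto_sandwich[OF _ _ tendsto_const])
  show "\<forall>\<^sub>F k in sequentially. nsq (\<lambda>x. (u k x + c * v k x) - (f x + c * g x))
     \<le> 2 * nsq (\<lambda>x. u k x - f x) + 2 * (ennreal ((cmod c)\<^sup>2) * nsq (\<lambda>x. v k x - g x))"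
  proof (intro always_eventually allI)
    fix k
    have "(\<lambda>x. (u k x + c * v k x) - (f x + c * g x)) = (\<lambda>x. (u k x - f x) + c * (v k x - g x))"
      by (simp add: algebra_simps fun_eq_iff)
    then show "nsq (\<lambda>x. (u k x + c * v k x) - (f x + c * g x))
     \<le> 2 * nsq (\<lambda>x. u k x - f x) + 2 * (ennreal ((cmod c)\<^sup>2) * nsq (\<lambda>x. v k x - g x))"
      using nsq_add_le2[of "\<lambda>x. u k x - f x" "\<lambda>x. c * (v k x - g x)"] by (simp add: nsq_cmult)
  qed
  have "(\<lambda>k. 2 * nsq (\<lambda>x. u k x - f x) + 2 * (ennreal ((cmod c)\<^sup>2) * nsq (\<lambda>x. v k x - g x)))
     \<longlonglongrightarrow> 2 * 0 + 2 * (ennreal ((cmod c)\<^sup>2) * 0)"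
    by (intro tendsto_add ennreal_tendsto_cmult 1 2) auto
  then show "(\<lambda>k. 2 * nsq (\<lambda>x. u k x - f x) + 2 * (ennreal ((cmod c)\<^sup>2) * nsq (\<lambda>x. v k x - g x))) \<longlonglongrightarrow> 0"
    by simp
qed auto

lemma is_fourier_add_cmult:
  assumes "is_fourier f g" "is_fourier f' g'" "f \<in> L2" "f' \<in> L2"
  shows "is_fourier (\<lambda>x. f x + c * f' x) (\<lambda>x. g x + c * g' x)"
proof -
  obtain u where u: "\<And>k. u k \<in> L12" and 1: "(\<lambda>k. nsq (\<lambda>x. u k x - f x)) \<longlonglongrightarrow> 0"
    and 2: "(\<lambda>k. nsq (\<lambda>x. fourier_L1 (u k) x - g x)) \<longlonglongrightarrow> 0" and g: "g \<in> L2"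
    using assms(1) unfolding is_fourier_iff by blast
  obtain v where v: "\<And>k. v k \<in> L12" and 3: "(\<lambda>k. nsq (\<lambda>x. v k x - f' x)) \<longlonglongrightarrow> 0"
    and 4: "(\<lambda>k. nsq (\<lambda>x. fourier_L1 (v k) x - g' x)) \<longlonglongrightarrow> 0" and g': "g' \<in> L2"
    using assms(2) unfolding is_fourier_iff by blast
  note [measurable] = u v assms(3,4) g g'
  show ?thesis
    unfolding is_fourier_iff
  proof (intro conjI exI[of _ "\<lambda>k x. u k x + c * v k x"] allI)
    show "(\<lambda>x. g x + c * g' x) \<in> L2" using g g' by auto
    show "(\<lambda>x. u k x + c * v k x) \<in> L12" for k by (intro L12_add u v)
    have eq: "fourier_L1 (\<lambda>x. u k x + c * v k x) x = fourier_L1 (u k) x + c * fourier_L1 (v k) x" for k x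
      by (rule fourier_L1_add) (simp_all add: u v L12_D)
    show "(\<lambda>k. nsq (\<lambda>x. u k x + c * v k x - (f x + c * f' x))) \<longlonglongrightarrow> 0"
      by (rule nsq_tendsto_add_cmult[OF _ _ _ _ 1 3]) measurable
    show "(\<lambda>k. nsq (\<lambda>x. fourier_L1 (\<lambda>x. u k x + c * v k x) x - (g x + c * g' x))) \<longlonglongrightarrow> 0"
      unfolding eq by (rule nsq_tendsto_add_cmult[OF _ _ _ _ 2 4]) measurable
  qed
qed

section \<open>Translations and their Fourier transforms\<close>

lemma nn_integral_translate:
  assumes [measurable]: "f \<in> borel_measurable borel"
  shows "(\<integral>\<^sup>+x. f (x - a) \<partial>(lborel :: 'a::euclidean_space measure)) = (\<integral>\<^sup>+x. f x \<partial>lborel)"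
proof -
  have "(\<integral>\<^sup>+x. f x \<partial>lborel) = (\<integral>\<^sup>+x. f x \<partial>distr lborel borel ((+) (- a)))"
    by (simp add: lborel_distr_plus)
  also have "\<dots> = (\<integral>\<^sup>+x. f (x - a) \<partial>lborel)"
    by (subst nn_integral_distr) auto
  finally show ?thesis ..
qed

lemma nsq_translate:
  assumes [measurable]: "f \<in> borel_measurable borel"
  shows "nsq (\<lambda>x. f (x - a)) = nsq f"
  unfolding nsq_def by (rule nn_integral_translate) measurable

lemma fourier_L1_translate:
  assumes f: "f \<in> borel_measurable borel"
  shows "fourier_L1 (\<lambda>x. f (x - a)) \<xi> = char2 \<xi> a * fourier_L1 f \<xi>"
proof -
  note [measurable] = f
  have "fourier_L1 (\<lambda>x. f (x - a)) \<xi> =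
      (LINT x|distr lborel borel ((+) a). char2 \<xi> x * f (x - a))"
    unfolding fourier_L1_def by (simp add: lborel_distr_plus)
  also have "\<dots> = (LINT x|lborel. char2 \<xi> a * (char2 \<xi> x * f x))"
    by (subst integral_distr)
       (auto intro!: Bochner_Integration.integral_cong simp: inner_add_right mult_exp_exp algebra_simps exp_diff exp_minus divide_simps)
  finally show ?thesis by (simp add: fourier_L1_def)
qed

lemma L2_translate: "f \<in> L2 \<Longrightarrow> (\<lambda>x. f (x - a)) \<in> L2"
proof -
  assume f: "f \<in> L2"
  have [measurable]: "f \<in> borel_measurable borel" using f by (rule L2_measurable)
  show ?thesis using f by (simp add: L2_iff nsq_translate)
qed

lemma L12_translate: "f \<in> L12 \<Longrightarrow> (\<lambda>x. f (x - a)) \<in> L12"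
proof -
  assume f: "f \<in> L12"
  have [measurable]: "f \<in> borel_measurable borel" using f by (rule L12_measurable)
  have "integrable lborel (\<lambda>x. f (x - a))"
    using L12_D(1)[OF f] nn_integral_translate[of "\<lambda>x. ennreal (cmod (f x))" a]
    by (simp add: integrable_iff_bounded)
  then show ?thesis using L2_translate[OF L12_D(2)[OF f]] by (simp add: L12_def)
qed

lemma is_fourier_translate:
  assumes "is_fourier f g" "f \<in> L2"
  shows "is_fourier (\<lambda>x. f (x - a)) (\<lambda>\<xi>. char2 \<xi> a * g \<xi>)"
proof -
  obtain u where u: "\<And>k. u k \<in> L12" and 1: "(\<lambda>k. nsq (\<lambda>x. u k x - f x)) \<longlonglongrightarrow> 0"
    and 2: "(\<lambda>k. nsq (\<lambda>x. fourier_L1 (u k) x - g x)) \<longlonglongrightarrow> 0" and g: "g \<in> L2"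
    using assms(1) unfolding is_fourier_iff by blast
  note [measurable] = u g assms(2)
  have cm: "nsq (\<lambda>\<xi>. char2 \<xi> a * h \<xi>) = nsq h" for h
    by (rule nsq_cong) (simp add: norm_mult)
  show ?thesis
    unfolding is_fourier_iff
  proof (intro conjI exI[of _ "\<lambda>k x. u k (x - a)"] allI)
    show "(\<lambda>\<xi>. char2 \<xi> a * g \<xi>) \<in> L2"
      using g by (simp only: L2_iff cm) measurable
    show "(\<lambda>x. u k (x - a)) \<in> L12" for k by (intro L12_translate u)
    show "(\<lambda>k. nsq (\<lambda>x. u k (x - a) - f (x - a))) \<longlonglongrightarrow> 0"
      using 1 by (subst nsq_translate[of "\<lambda>x. u k x - f x" for k]) auto
    have "(\<lambda>x. fourier_L1 (\<lambda>x. u k (x - a)) x - exp (- 2 * pi * \<i> * of_real (x \<bullet> a)) * g x)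
      = (\<lambda>x. exp (- 2 * pi * \<i> * of_real (x \<bullet> a)) * (fourier_L1 (u k) x - g x))" for k
      by (intro ext, subst fourier_L1_translate) (simp_all add: right_diff_distrib)
    then show "(\<lambda>k. nsq (\<lambda>x. fourier_L1 (\<lambda>x. u k (x - a)) x - exp (- 2 * pi * \<i> * of_real (x \<bullet> a)) * g x)) \<longlonglongrightarrow> 0"
      using 2 by (simp only: cm)
  qed
qed

section \<open>The bilinear pairing, uniqueness and surjectivity of the transform\<close>

lemma integral_mult_bound:
  assumes "p \<in> L2" "q \<in> L2"
  shows "(ennreal (cmod (LINT x|lborel. p x * q x)))\<^sup>2 \<le> nsq p * nsq q"
proof -
  note [measurable] = assms
  have "cmod (LINT x|lborel. p x * q x) \<le> (LINT x|lborel. cmod (p x * q x))"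
    by (rule integral_norm_bound)
  then have "ennreal (cmod (LINT x|lborel. p x * q x)) \<le> (\<integral>\<^sup>+x. ennreal (cmod (p x)) * ennreal (cmod (q x)) \<partial>lborel)"
    using nn_integral_eq_integral[OF integrable_norm[OF L2_integrable_mult[OF assms]]]
    by (simp add: norm_mult ennreal_mult' ennreal_leI)
  then have "(ennreal (cmod (LINT x|lborel. p x * q x)))\<^sup>2 \<le> (\<integral>\<^sup>+x. ennreal (cmod (p x)) * ennreal (cmod (q x)) \<partial>lborel)\<^sup>2"
    by (intro power_mono) auto
  also have "\<dots> \<le> nsq p * nsq q"
    using Cauchy_Schwarz_nn_integral[of "\<lambda>x. ennreal (cmod (p x))" lborel "\<lambda>x. ennreal (cmod (q x))"]
    by (simp add: nsq_def ennreal_power)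
  finally show ?thesis .
qed

lemma integral_mult_tendsto:
  assumes u: "\<And>k. u k \<in> L2" "f \<in> L2" and v: "\<And>k. v k \<in> L2" "g \<in> L2"
    and 1: "(\<lambda>k. nsq (\<lambda>x. u k x - f x)) \<longlonglongrightarrow> 0" and 2: "(\<lambda>k. nsq (\<lambda>x. v k x - g x)) \<longlonglongrightarrow> 0"
  shows "(\<lambda>k. LINT x|lborel. u k x * v k x) \<longlonglongrightarrow> (LINT x|lborel. f x * g x)"
proof -
  have z: "(\<lambda>k. LINT x|lborel. p k x * q k x) \<longlonglongrightarrow> 0"
    if "\<And>k. p k \<in> L2" "\<And>k. q k \<in> L2" "(\<lambda>k. nsq (p k) * nsq (q k)) \<longlonglongrightarrow> 0" for p q :: "nat \<Rightarrow> real \<times> real \<Rightarrow> complex"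
  proof -
    have "(\<lambda>k. (ennreal (cmod (LINT x|lborel. p k x * q k x)))\<^sup>2) \<longlonglongrightarrow> 0"
      by (rule tendsto_sandwich[OF _ _ tendsto_const that(3)])
         (auto intro!: always_eventually integral_mult_bound that)
    then have "(\<lambda>k. ennreal (cmod (LINT x|lborel. p k x * q k x))) \<longlonglongrightarrow> ennreal 0"
      by (simp add: ennreal_power2_tendsto_0_iff)
    then show ?thesis by (subst (asm) tendsto_ennreal_iff) (auto intro: tendsto_norm_zero_cancel)
  qed
  have fin: "nsq f \<noteq> \<infinity>" "nsq g \<noteq> \<infinity>" using u(2) v(2) by (auto simp: L2_iff)
  have "(\<lambda>k. LINT x|lborel. (u k x - f x) * (v k x - g x)) \<longlonglongrightarrow> 0"
    using tendsto_mult_ennreal[OF 1 2] by (intro z L2_diff u v) auto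
  moreover have "(\<lambda>k. LINT x|lborel. f x * (v k x - g x)) \<longlonglongrightarrow> 0"
    using ennreal_tendsto_cmult[OF _ 2, of "nsq f"] fin by (intro z L2_diff u v) (auto simp: less_top)
  moreover have "(\<lambda>k. LINT x|lborel. g x * (u k x - f x)) \<longlonglongrightarrow> 0"
    using ennreal_tendsto_cmult[OF _ 1, of "nsq g"] fin by (intro z L2_diff u v) (auto simp: less_top)
  \<comment> \<open>The product \<open>u k * v k\<close> is expanded about \<open>f * g\<close>;
    each remaining term contains a difference tending to 0.\<close>
  ultimately have "(\<lambda>k. (LINT x|lborel. (u k x - f x) * (v k x - g x)) + (LINT x|lborel. f x * (v k x - g x)) +
     (LINT x|lborel. g x * (u k x - f x)) + (LINT x|lborel. f x * g x)) \<longlonglongrightarrow> 0 + 0 + 0 + (LINT x|lborel. f x * g x)"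
    by (intro tendsto_add tendsto_const)
  moreover have "(LINT x|lborel. (u k x - f x) * (v k x - g x)) + (LINT x|lborel. f x * (v k x - g x)) +
     (LINT x|lborel. g x * (u k x - f x)) + (LINT x|lborel. f x * g x) = (LINT x|lborel. u k x * v k x)" for k
  proof -
    note i = L2_integrable_mult L2_diff u v Bochner_Integration.integrable_add
    have "(LINT x|lborel. (u k x - f x) * (v k x - g x)) + (LINT x|lborel. f x * (v k x - g x)) +
      (LINT x|lborel. g x * (u k x - f x)) + (LINT x|lborel. f x * g x) =
      (LINT x|lborel. (u k x - f x) * (v k x - g x) + f x * (v k x - g x) + g x * (u k x - f x) + f x * g x)"
      by (subst Bochner_Integration.integral_add, (intro i)+)+ simp
    also have "\<dots> = (LINT x|lborel. u k x * v k x)"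
      by (intro Bochner_Integration.integral_cong refl) (simp add: algebra_simps)
    finally show ?thesis .
  qed
  ultimately show ?thesis by simp
qed

lemma is_fourier_mult_formula:
  assumes "is_fourier f f'" "is_fourier h h'" "f \<in> L2" "h \<in> L2"
  shows "(LINT x|lborel. f' x * h x) = (LINT x|lborel. f x * h' x)"
proof -
  obtain u where u: "\<And>k. u k \<in> L12" and 1: "(\<lambda>k. nsq (\<lambda>x. u k x - f x)) \<longlonglongrightarrow> 0"
    and 2: "(\<lambda>k. nsq (\<lambda>x. fourier_L1 (u k) x - f' x)) \<longlonglongrightarrow> 0" and f': "f' \<in> L2"
    using assms(1) unfolding is_fourier_iff by blast
  obtain v where v: "\<And>k. v k \<in> L12" and 3: "(\<lambda>k. nsq (\<lambda>x. v k x - h x)) \<longlonglongrightarrow> 0"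
    and 4: "(\<lambda>k. nsq (\<lambda>x. fourier_L1 (v k) x - h' x)) \<longlonglongrightarrow> 0" and h': "h' \<in> L2"
    using assms(2) unfolding is_fourier_iff by blast
  have "(\<lambda>k. LINT x|lborel. fourier_L1 (u k) x * v k x) \<longlonglongrightarrow> (LINT x|lborel. f' x * h x)"
    by (intro integral_mult_tendsto 2 3 fourier_L1_L2 u f' assms L12_D(2)[OF v])
  moreover have "(\<lambda>k. LINT x|lborel. u k x * fourier_L1 (v k) x) \<longlonglongrightarrow> (LINT x|lborel. f x * h' x)"
    by (intro integral_mult_tendsto 1 4 fourier_L1_L2 v h' assms L12_D(2)[OF u])
  ultimately show ?thesis
    using fourier_L1_mult_formula[OF u v] by (simp add: LIMSEQ_unique)
qed

lemma is_fourier_fourier: "f \<in> L2 \<Longrightarrow> is_fourier f (fourier f)"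
  unfolding fourier_def by (metis is_fourier_exists someI_ex)

lemma fourier_L2: "f \<in> L2 \<Longrightarrow> fourier f \<in> L2"
  using is_fourier_fourier by (auto simp: is_fourier_def)

lemma plancherel: "f \<in> L2 \<Longrightarrow> nsq (fourier f) = nsq f"
  using is_fourier_nsq is_fourier_fourier by blast

lemma nsq_0_iff: "f \<in> borel_measurable borel \<Longrightarrow> nsq f = 0 \<longleftrightarrow> (AE x in lborel. f x = 0)"
  unfolding nsq_def by (subst nn_integral_0_iff_AE) auto

text \<open>The difference of two transforms of \<open>f\<close> is a transform of f - f = 0, so it
  has norm 0 by the isometry.\<close>

lemma fourier_unique:
  assumes "is_fourier f g" "f \<in> L2"
  shows "AE x in lborel. fourier f x = g x"
proof -
  note [measurable] = fourier_L2[OF assms(2)]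
  have [measurable]: "g \<in> borel_measurable borel" using assms(1) by (auto simp: is_fourier_def L2_iff)
  have "is_fourier (\<lambda>x. f x + (-1) * f x) (\<lambda>x. fourier f x + (-1) * g x)"
    using assms by (intro is_fourier_add_cmult is_fourier_fourier)
  from is_fourier_nsq[OF this] have "nsq (\<lambda>x. fourier f x - g x) = 0"
    by (simp add: nsq_def)
  then show ?thesis by (simp add: nsq_0_iff)
qed

lemma fourier_add_cmult:
  assumes "f \<in> L2" "g \<in> L2"
  shows "AE x in lborel. fourier (\<lambda>x. f x + c * g x) x = fourier f x + c * fourier g x"
  using assms by (intro fourier_unique is_fourier_add_cmult is_fourier_fourier L2_add L2_cmult)

lemma fourier_translate:
  assumes "f \<in> L2"
  shows "AE \<xi> in lborel. fourier (\<lambda>x. f (x - a)) \<xi> = char2 \<xi> a * fourier f \<xi>"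
  using assms by (intro fourier_unique is_fourier_translate is_fourier_fourier L2_translate)

lemma fourier_inject:
  assumes "f \<in> L2" "g \<in> L2" "AE \<xi> in lborel. fourier f \<xi> = fourier g \<xi>"
  shows "AE x in lborel. f x = g x"
proof -
  note [measurable] = assms(1,2)
  have "AE \<xi> in lborel. fourier (\<lambda>x. f x + (-1) * g x) \<xi> = 0"
    using fourier_add_cmult[OF assms(1,2), of "-1"] assms(3) by eventually_elim simp
  then have "nsq (fourier (\<lambda>x. f x + (-1) * g x)) = 0"
    using assms by (subst nsq_0_iff) (auto intro!: L2_measurable fourier_L2 L2_diff)
  then have "nsq (\<lambda>x. f x - g x) = 0"
    using plancherel[OF L2_add[OF assms(1) L2_cmult[OF assms(2)]], of "-1"] by simp
  then show ?thesis by (simp add: nsq_0_iff)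
qed

text \<open>The candidate preimage of \<open>h\<close> is the conjugate of the transform of the
  conjugate of \<open>h\<close>, which is the formal inverse transform. The multiplication formula
  evaluates the inner product of \<open>fourier f\<close> with \<open>h\<close> as the squared norm
  of \<open>h\<close>; as \<open>fourier f\<close> and \<open>h\<close> have equal norms, expanding
  the square of their distance gives 0.\<close>

lemma fourier_surj:
  assumes h: "h \<in> L2"
  shows "\<exists>f\<in>L2. AE \<xi> in lborel. fourier f \<xi> = h \<xi>"
proof -
  define q where "q x = cnj (h x)" for x
  define f where "f x = cnj (fourier q x)" for x
  have q: "q \<in> L2" and f: "f \<in> L2"
    unfolding q_def[abs_def] f_def[abs_def] by (auto intro!: L2_cnj h fourier_L2 simp: q_def)
  have fh: "fourier f \<in> L2" by (rule fourier_L2[OF f])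
  note [measurable] = h f q fh
  note i = L2_integrable_square
  have nsq_eq: "nsq (fourier f) = nsq h" "nsq (fourier q) = nsq h"
    using plancherel[OF f] plancherel[OF q] unfolding f_def q_def by simp_all
  have "(LINT x|lborel. (cmod (fourier f x))\<^sup>2) = (LINT x|lborel. (cmod (h x))\<^sup>2)"
       "(LINT x|lborel. (cmod (fourier q x))\<^sup>2) = (LINT x|lborel. (cmod (h x))\<^sup>2)"
    using nsq_eq by (simp_all add: nsq_eq_integral fh h fourier_L2[OF q])
  note eqs = this
  have "(LINT x|lborel. fourier f x * q x) = (LINT x|lborel. f x * fourier q x)"
    by (rule is_fourier_mult_formula) (auto intro: is_fourier_fourier f q)
  also have "\<dots> = complex_of_real (LINT x|lborel. (cmod (fourier q x))\<^sup>2)"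
    unfolding f_def integral_complex_of_real[symmetric]
    by (intro Bochner_Integration.integral_cong refl) (simp only: complex_norm_square mult.commute)
  finally have "Re (LINT x|lborel. fourier f x * q x) = (LINT x|lborel. (cmod (h x))\<^sup>2)"
    using eqs by simp
  then have re: "(LINT x|lborel. Re (fourier f x * q x)) = (LINT x|lborel. (cmod (h x))\<^sup>2)"
    by (subst integral_Re) (intro L2_integrable_mult fh q)
  have "(LINT x|lborel. (cmod (fourier f x - h x))\<^sup>2) =
     (LINT x|lborel. (cmod (fourier f x))\<^sup>2 + (cmod (h x))\<^sup>2 - 2 * Re (fourier f x * q x))"
    unfolding q_def
    by (intro Bochner_Integration.integral_cong refl)
       (simp add: cmod_power2, simp add: power2_eq_square algebra_simps)
  also have "\<dots> = (LINT x|lborel. (cmod (fourier f x))\<^sup>2) + (LINT x|lborel. (cmod (h x))\<^sup>2)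
      - 2 * (LINT x|lborel. Re (fourier f x * q x))"
  proof -
    have r: "integrable lborel (\<lambda>x. 2 * Re (fourier f x * q x))"
      by (intro integrable_mult_right integrable_Re L2_integrable_mult fh q)
    show ?thesis
      using Bochner_Integration.integral_diff[OF Bochner_Integration.integrable_add[OF i[OF fh] i[OF h]] r]
        Bochner_Integration.integral_add[OF i[OF fh] i[OF h]]
      by (simp only: integral_mult_right_zero)
  qed
  also have "\<dots> = 0" unfolding re eqs by simp
  finally have "nsq (\<lambda>x. fourier f x - h x) = 0"
    by (simp add: nsq_eq_integral[OF L2_diff[OF fh h]])
  then have "AE \<xi> in lborel. fourier f \<xi> = h \<xi>" by (simp add: nsq_0_iff)
  then show ?thesis using f by blast
qed

lemma inv_fourier:
  assumes "h \<in> L2"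
  shows "inv_fourier h \<in> L2" "AE \<xi> in lborel. fourier (inv_fourier h) \<xi> = h \<xi>"
proof -
  have "\<exists>f. f \<in> L2 \<and> (AE \<xi> in lborel. fourier f \<xi> = h \<xi>)" using fourier_surj[OF assms] by blast
  from someI_ex[OF this] show "inv_fourier h \<in> L2" "AE \<xi> in lborel. fourier (inv_fourier h) \<xi> = h \<xi>"
    unfolding inv_fourier_def by auto
qed

section \<open>The maximal ergodic inequality for translations\<close>

lemma ennreal_less_divide_of_nat:
  fixes s l :: ennreal
  assumes "m \<ge> 1" "l < \<infinity>"
  shows "l < s / of_nat m \<longleftrightarrow> of_nat m * l < s"
proof (cases s)
  case (real s')
  obtain l' where l: "l = ennreal l'" "l' \<ge> 0" using assms by (cases l) auto
  have "s / of_nat m = ennreal (s' / real m)" "of_nat m * l = ennreal (real m * l')"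
    using real l assms by (simp_all add: divide_ennreal ennreal_of_nat_eq_real_of_nat ennreal_mult')
  then show ?thesis using real l assms by (simp add: ennreal_less_iff field_simps)
next
  case top
  then show ?thesis using assms by (simp add: ennreal_top_divide ennreal_mult_less_top of_nat_less_top)
qed

text \<open>With Tonelli's theorem these two formulas convert the level-set inequality
  \<open>maximal_ergodic\<close> into a bound for the square integral in
  \<open>maxavg_L2\<close>.\<close>

lemma layer_cake_ennreal:
  fixes y :: ennreal
  assumes "y < \<infinity>"
  shows "(\<integral>\<^sup>+t. indicator {t. 0 < t \<and> ennreal t < y} t \<partial>lborel) = y"
    and "(\<integral>\<^sup>+t. ennreal (2 * t) * indicator {t. 0 < t \<and> ennreal t < y} t \<partial>lborel) = y\<^sup>2"
proof -
  obtain r where r: "y = ennreal r" "r \<ge> 0" using assms by (cases y) auto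
  have eq: "{t. 0 < t \<and> ennreal t < y} = {0<..<r}"
    using r by (auto simp: ennreal_less_iff)
  show "(\<integral>\<^sup>+t. indicator {t. 0 < t \<and> ennreal t < y} t \<partial>lborel) = y"
    unfolding eq using r by simp
  have "(\<integral>\<^sup>+t. ennreal (2 * t) * indicator {0<..<r} t \<partial>lborel) = (\<integral>\<^sup>+t. ennreal (2 * t) * indicator {0..r} t \<partial>lborel)"
  proof (rule nn_integral_cong_AE)
    show "AE t in lborel. ennreal (2 * t) * indicator {0<..<r} t = ennreal (2 * t) * indicator {0..r} t"
      using AE_lborel_singleton[of 0] AE_lborel_singleton[of r]
      by eventually_elim (auto simp: indicator_def)
  qed
  also have "\<dots> = ennreal (r\<^sup>2 - 0\<^sup>2)"
    using r(2) by (intro nn_integral_FTC_Icc[where F="\<lambda>t. t\<^sup>2"]) (auto intro!: derivative_eq_intros)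
  also have "\<dots> = y\<^sup>2" using r by (simp add: ennreal_power)
  finally show "(\<integral>\<^sup>+t. ennreal (2 * t) * indicator {t. 0 < t \<and> ennreal t < y} t \<partial>lborel) = y\<^sup>2"
    unfolding eq .
qed

locale shift_maximal =
  fixes a :: "'a::euclidean_space" and g :: "'a \<Rightarrow> ennreal"
  assumes g_meas [measurable]: "g \<in> borel_measurable borel"
    and g_fin: "(\<integral>\<^sup>+x. (g x)\<^sup>2 \<partial>lborel) < \<infinity>"
begin

definition ssum :: "nat \<Rightarrow> 'a \<Rightarrow> ennreal" where
  "ssum m x = (\<Sum>k<m. g (x - real k *\<^sub>R a))"

lemma ssum_measurable [measurable]: "ssum m \<in> borel_measurable borel"
  unfolding ssum_def[abs_def] by measurable

lemma ssum_Suc: "ssum (Suc m) x = g x + ssum m (x - a)"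
  unfolding ssum_def by (subst sum.lessThan_Suc_shift) (simp add: algebra_simps)

lemma ssum_Suc': "ssum (Suc m) x = ssum m x + g (x - real m *\<^sub>R a)"
  unfolding ssum_def by simp

text \<open>The quantity of Garsia's proof of the maximal ergodic theorem; truncated subtraction
  takes the positive parts.\<close>

definition garsia :: "ennreal \<Rightarrow> nat \<Rightarrow> 'a \<Rightarrow> ennreal" where
  "garsia l n x = (SUP m\<in>{..n}. ssum m x - of_nat m * l)"

lemma garsia_measurable [measurable]: "garsia l n \<in> borel_measurable borel"
  unfolding garsia_def[abs_def] by measurable

lemma garsia_pos_iff:
  assumes "l < \<infinity>"
  shows "0 < garsia l n x \<longleftrightarrow> (\<exists>m\<in>{1..n}. of_nat m * l < ssum m x)"
proof -
  have "0 < garsia l n x \<longleftrightarrow> (\<exists>m\<in>{..n}. 0 < ssum m x - of_nat m * l)"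
    unfolding garsia_def by (simp add: less_SUP_iff)
  also have "\<dots> \<longleftrightarrow> (\<exists>m\<in>{..n}. of_nat m * l < ssum m x)"
    using assms by (auto simp: diff_gt_0_iff_gt_ennreal ennreal_mult_eq_top_iff)
  also have "\<dots> \<longleftrightarrow> (\<exists>m\<in>{1..n}. of_nat m * l < ssum m x)"
  proof -
    have "m \<noteq> 0" if "of_nat m * l < ssum m x" for m
      using that by (intro notI) (simp add: ssum_def)
    then show ?thesis by (metis atLeastAtMost_iff atMost_iff less_one not_le)
  qed
  finally show ?thesis .
qed

text \<open>A positive maximum is attained at some m = j + 1. Splitting off the first summand leaves
  the sum of length j started at x - a, which competes in the maximum there. The level
  \<open>l\<close> is written on the left because subtraction in \<open>ennreal\<close> is
  truncated.\<close>

lemma garsia_le: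
  assumes l: "l < \<infinity>" and pos: "0 < garsia l n x"
  shows "garsia l n x + l \<le> g x + garsia l n (x - a)"
proof -
  have "garsia l n x \<in> (\<lambda>m. ssum m x - of_nat m * l) ` {..n}"
    unfolding garsia_def by (subst cSup_eq_Max) (auto intro!: Max_in)
  then obtain m where m: "m \<le> n" "garsia l n x = ssum m x - of_nat m * l" by auto
  then have gt: "of_nat m * l < ssum m x"
    using pos l by (auto simp: diff_gt_0_iff_gt_ennreal ennreal_mult_eq_top_iff)
  then have "m \<noteq> 0" by (intro notI) (simp add: ssum_def)
  then obtain j where j: "m = Suc j" by (cases m) auto
  have "garsia l n x + l = ssum m x - (l + of_nat j * l) + l"
    unfolding m j by (simp add: ring_distribs)
  also have "\<dots> = ssum m x - of_nat j * l - l + l"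
    by (simp add: diff_add_eq_diff_diff_swap_ennreal diff_diff_commute_ennreal)
  also have "\<dots> = ssum m x - of_nat j * l"
  proof -
    have "l + of_nat j * l \<le> ssum m x" using gt j by (simp add: ring_distribs less_imp_le)
    then have "l \<le> ssum m x - of_nat j * l" by (simp add: ennreal_le_minus_iff)
    then show ?thesis by (simp add: diff_add_self_ennreal)
  qed
  also have "\<dots> = g x + ssum j (x - a) - of_nat j * l"
    by (simp add: j ssum_Suc)
  also have "\<dots> \<le> g x + (ssum j (x - a) - of_nat j * l)"
    by (rule add_diff_le_ennreal)
  also have "\<dots> \<le> g x + garsia l n (x - a)"
    unfolding garsia_def using m j by (intro add_left_mono SUP_upper) auto
  finally show ?thesis .
qed

text \<open>Finiteness permits cancelling the integral of \<open>garsia\<close> in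
  \<open>maximal_ergodic\<close>. Although \<open>g\<close> is only square integrable, the part of
  \<open>g\<close> above the level \<open>l\<close> is at most g^2 / l and hence integrable.\<close>

lemma garsia_finite:
  assumes l: "0 < l" "l < \<infinity>"
  shows "(\<integral>\<^sup>+x. garsia l n x \<partial>lborel) < \<infinity>"
proof -
  have sub: "ssum m x - of_nat m * l \<le> (\<Sum>k<m. g (x - real k *\<^sub>R a) - l)" for m x
  proof (induction m)
    case (Suc m)
    have "ssum (Suc m) x - of_nat (Suc m) * l = (ssum m x + g (x - real m *\<^sub>R a)) - of_nat m * l - l"
      by (simp add: ssum_Suc' ring_distribs add.commute[of l] diff_add_eq_diff_diff_swap_ennreal)
    also have "\<dots> \<le> (ssum m x - of_nat m * l) + g (x - real m *\<^sub>R a) - l"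
      using add_diff_le_ennreal[of "g (x - real m *\<^sub>R a)" "ssum m x" "of_nat m * l"]
      by (intro ennreal_minus_mono) (auto simp: add.commute)
    also have "\<dots> \<le> (ssum m x - of_nat m * l) + (g (x - real m *\<^sub>R a) - l)"
      by (rule add_diff_le_ennreal)
    also have "\<dots> \<le> (\<Sum>k<Suc m. g (x - real k *\<^sub>R a) - l)"
      using Suc by (simp add: add_right_mono)
    finally show ?case .
  qed (simp add: ssum_def)
  have "garsia l n x \<le> (\<Sum>k<n. g (x - real k *\<^sub>R a) - l)" for x
    unfolding garsia_def
    by (intro SUP_least order_trans[OF sub] sum_mono2) auto
  then have "(\<integral>\<^sup>+x. garsia l n x \<partial>lborel) \<le> (\<integral>\<^sup>+x. (\<Sum>k<n. g (x - real k *\<^sub>R a) - l) \<partial>lborel)"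
    by (intro nn_integral_mono)
  also have "\<dots> = (\<Sum>k<n. \<integral>\<^sup>+x. g (x - real k *\<^sub>R a) - l \<partial>lborel)"
    by (rule nn_integral_sum) measurable
  also have "\<dots> = (\<Sum>k<n. \<integral>\<^sup>+x. g x - l \<partial>lborel)"
    by (intro sum.cong refl nn_integral_translate[of "\<lambda>x. g x - l"]) measurable
  also have "\<dots> < \<infinity>"
  proof -
    have "g x - l \<le> (g x)\<^sup>2 / l" for x
    proof (cases "g x \<le> l")
      case True
      then show ?thesis using l by (auto simp: diff_eq_0_ennreal)
    next
      case False
      have "g x - l \<le> g x * l / l" using l by (simp add: ennreal_mult_divide_eq)
      also have "\<dots> \<le> g x * g x / l"
        using False by (intro divide_right_mono_ennreal mult_left_mono) auto
      finally show ?thesis by (simp add: power2_eq_square)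
    qed
    then have "(\<integral>\<^sup>+x. g x - l \<partial>lborel) \<le> (\<integral>\<^sup>+x. (g x)\<^sup>2 / l \<partial>lborel)"
      by (intro nn_integral_mono)
    also have "\<dots> = (\<integral>\<^sup>+x. (g x)\<^sup>2 \<partial>lborel) / l"
      by (intro nn_integral_divide) measurable
    also have "\<dots> < \<infinity>" using g_fin l by (auto simp: ennreal_divide_eq_top_iff less_top[symmetric])
    finally show ?thesis by (simp add: ennreal_mult_less_top of_nat_less_top)
  qed
  finally show ?thesis .
qed

text \<open>Integrate \<open>garsia_le\<close> over the set where \<open>garsia\<close> is positive;
  off this set \<open>garsia\<close> is 0. Both occurrences of \<open>garsia\<close> have the same
  integral by translation invariance and cancel.\<close>

lemma maximal_ergodic:
  assumes l: "0 < l" "l < \<infinity>"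
  shows "(\<integral>\<^sup>+x. l * indicator {x. 0 < garsia l n x} x \<partial>lborel) \<le> (\<integral>\<^sup>+x. g x * indicator {x. 0 < garsia l n x} x \<partial>lborel)"
proof -
  let ?E = "{x. 0 < garsia l n x}"
  have "(\<integral>\<^sup>+x. garsia l n x \<partial>lborel) + (\<integral>\<^sup>+x. l * indicator ?E x \<partial>lborel)
      = (\<integral>\<^sup>+x. garsia l n x + l * indicator ?E x \<partial>lborel)"
    by (intro nn_integral_add[symmetric]) measurable
  also have "\<dots> \<le> (\<integral>\<^sup>+x. garsia l n (x - a) + g x * indicator ?E x \<partial>lborel)"
  proof (rule nn_integral_mono)
    show "garsia l n x + l * indicator ?E x \<le> garsia l n (x - a) + g x * indicator ?E x" for x
      using garsia_le[OF l(2), of n x] by (cases "x \<in> ?E") (auto simp: add.commute)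
  qed
  also have "\<dots> = (\<integral>\<^sup>+x. garsia l n (x - a) \<partial>lborel) + (\<integral>\<^sup>+x. g x * indicator ?E x \<partial>lborel)"
    by (intro nn_integral_add) measurable
  also have "(\<integral>\<^sup>+x. garsia l n (x - a) \<partial>lborel) = (\<integral>\<^sup>+x. garsia l n x \<partial>lborel)"
    by (intro nn_integral_translate) measurable
  finally show ?thesis
    using garsia_finite[OF l, of n] by (auto simp: ennreal_add_left_cancel_le)
qed

definition maxavg :: "nat \<Rightarrow> 'a \<Rightarrow> ennreal" where
  "maxavg n x = (SUP m\<in>{1..n}. ssum m x / of_nat m)"

lemma maxavg_measurable [measurable]: "maxavg n \<in> borel_measurable borel"
  unfolding maxavg_def[abs_def] by measurable

lemma less_maxavg_iff: "l < \<infinity> \<Longrightarrow> l < maxavg n x \<longleftrightarrow> 0 < garsia l n x"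
  unfolding garsia_pos_iff maxavg_def less_SUP_iff
  by (intro bex_cong refl ennreal_less_divide_of_nat) auto

text \<open>A qualitative fact only: it allows the square integral of \<open>maxavg\<close> to be
  absorbed in \<open>maxavg_L2\<close>.\<close>

lemma maxavg_finite: "(\<integral>\<^sup>+x. (maxavg n x)\<^sup>2 \<partial>lborel) < \<infinity>"
proof -
  have two: "(x + y)\<^sup>2 \<le> 2 * x\<^sup>2 + 2 * y\<^sup>2" for x y :: ennreal
  proof (cases "x = \<infinity> \<or> y = \<infinity>")
    case False
    then obtain x' y' where "x = ennreal x'" "y = ennreal y'" "x' \<ge> 0" "y' \<ge> 0"
      by (cases x; cases y) auto
    moreover have "(x' + y')\<^sup>2 \<le> 2 * x'\<^sup>2 + 2 * y'\<^sup>2" for x' y' :: real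
      using sum_squares_bound[of x' y'] by (simp add: power2_eq_square algebra_simps)
    ultimately show ?thesis
      by (simp add: ennreal_power ennreal_leI flip: ennreal_plus ennreal_mult' ennreal_numeral)
  qed (auto simp: power2_eq_square)
  have fin: "(\<integral>\<^sup>+x. (ssum n x)\<^sup>2 \<partial>lborel) < \<infinity>"
  proof (induction n)
    case (Suc n)
    have "(\<integral>\<^sup>+x. (ssum (Suc n) x)\<^sup>2 \<partial>lborel) \<le> (\<integral>\<^sup>+x. 2 * (g x)\<^sup>2 + 2 * (ssum n (x - a))\<^sup>2 \<partial>lborel)"
      unfolding ssum_Suc by (intro nn_integral_mono two)
    also have "\<dots> = 2 * (\<integral>\<^sup>+x. (g x)\<^sup>2 \<partial>lborel) + 2 * (\<integral>\<^sup>+x. (ssum n (x - a))\<^sup>2 \<partial>lborel)"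
      by (simp add: nn_integral_add nn_integral_cmult)
    also have "(\<integral>\<^sup>+x. (ssum n (x - a))\<^sup>2 \<partial>lborel) = (\<integral>\<^sup>+x. (ssum n x)\<^sup>2 \<partial>lborel)"
      by (rule nn_integral_translate[of "\<lambda>x. (ssum n x)\<^sup>2"]) measurable
    finally show ?case using g_fin Suc by (auto simp: ennreal_mult_less_top intro: order.strict_trans1)
  qed (simp add: ssum_def)
  have "maxavg n x \<le> ssum n x" for x
    unfolding maxavg_def
  proof (rule SUP_least)
    fix m assume m: "m \<in> {1..n}"
    have "1 * ssum m x \<le> of_nat m * ssum m x"
      using m by (intro mult_right_mono) auto
    then have "ssum m x / of_nat m \<le> ssum m x"
      using m by (intro divide_le_posI_ennreal) auto
    also have "\<dots> \<le> ssum n x"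
      unfolding ssum_def using m by (simp add: sum_mono2)
    finally show "ssum m x / of_nat m \<le> ssum n x" .
  qed
  then have "(\<integral>\<^sup>+x. (maxavg n x)\<^sup>2 \<partial>lborel) \<le> (\<integral>\<^sup>+x. (ssum n x)\<^sup>2 \<partial>lborel)"
    by (intro nn_integral_mono power_mono) auto
  with fin show ?thesis by (rule order.strict_trans1[rotated])
qed

text \<open>Integrating the level-set inequality against 2 dt bounds the integral of M^2 by that of
  2 g M, where M is \<open>maxavg n\<close>. After doubling, 4 g M <= 4 g^2 + M^2 lets one copy of
  the integral of M^2 be absorbed, which leaves the constant 4.\<close>

lemma maxavg_L2:
  "(\<integral>\<^sup>+x. (maxavg n x)\<^sup>2 \<partial>lborel) \<le> 4 * (\<integral>\<^sup>+x. (g x)\<^sup>2 \<partial>lborel)"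
proof -
  have "AE x in lborel. (maxavg n x)\<^sup>2 \<noteq> \<infinity>"
    using maxavg_finite[of n] by (intro nn_integral_noteq_infinite) auto
  then have fin: "AE x in lborel. maxavg n x < \<infinity>"
    by eventually_elim (auto simp: power2_eq_square less_top[symmetric] ennreal_mult_eq_top_iff)
  have "(\<integral>\<^sup>+x. (maxavg n x)\<^sup>2 \<partial>lborel) =
      (\<integral>\<^sup>+x. \<integral>\<^sup>+t. ennreal (2 * t) * indicator {t. 0 < t \<and> ennreal t < maxavg n x} t \<partial>lborel \<partial>lborel)"
    by (intro nn_integral_cong_AE) (use fin in \<open>eventually_elim, simp add: layer_cake_ennreal\<close>)
  also have "\<dots> = (\<integral>\<^sup>+t. \<integral>\<^sup>+x. ennreal (2 * t) * indicator {t. 0 < t \<and> ennreal t < maxavg n x} t \<partial>lborel \<partial>lborel)"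
    by (rule lborel_pair.Fubini'[symmetric]) measurable
  also have "\<dots> \<le> (\<integral>\<^sup>+t. \<integral>\<^sup>+x. 2 * g x * indicator {t. 0 < t \<and> ennreal t < maxavg n x} t \<partial>lborel \<partial>lborel)"
  proof (rule nn_integral_mono)
    fix t :: real
    show "(\<integral>\<^sup>+x. ennreal (2 * t) * indicator {t. 0 < t \<and> ennreal t < maxavg n x} t \<partial>lborel)
      \<le> (\<integral>\<^sup>+x. 2 * g x * indicator {t. 0 < t \<and> ennreal t < maxavg n x} t \<partial>lborel)"
    proof (cases "t > 0")
      case True
      have ind: "indicator {t. 0 < t \<and> ennreal t < maxavg n x} t = (indicator {x. 0 < garsia (ennreal t) n x} x :: ennreal)" for x
        using True by (auto simp: indicator_def less_maxavg_iff)
      have "(\<integral>\<^sup>+x. ennreal (2 * t) * indicator {x. 0 < garsia (ennreal t) n x} x \<partial>lborel)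
        = 2 * (\<integral>\<^sup>+x. ennreal t * indicator {x. 0 < garsia (ennreal t) n x} x \<partial>lborel)"
        using True by (subst nn_integral_cmult[symmetric]) (auto simp: ennreal_mult' mult.assoc)
      also have "\<dots> \<le> 2 * (\<integral>\<^sup>+x. g x * indicator {x. 0 < garsia (ennreal t) n x} x \<partial>lborel)"
        using True by (intro mult_left_mono maximal_ergodic) auto
      also have "\<dots> = (\<integral>\<^sup>+x. 2 * g x * indicator {x. 0 < garsia (ennreal t) n x} x \<partial>lborel)"
        by (subst nn_integral_cmult[symmetric]) (auto simp: mult.assoc)
      finally show ?thesis unfolding ind .
    qed simp
  qed
  also have "\<dots> = (\<integral>\<^sup>+x. \<integral>\<^sup>+t. 2 * g x * indicator {t. 0 < t \<and> ennreal t < maxavg n x} t \<partial>lborel \<partial>lborel)"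
    by (rule lborel_pair.Fubini') measurable
  also have "\<dots> = (\<integral>\<^sup>+x. 2 * g x * maxavg n x \<partial>lborel)"
  proof (intro nn_integral_cong_AE)
    show "AE x in lborel. (\<integral>\<^sup>+t. 2 * g x * indicator {t. 0 < t \<and> ennreal t < maxavg n x} t \<partial>lborel) = 2 * g x * maxavg n x"
      using fin by eventually_elim (subst nn_integral_cmult, simp, simp only: layer_cake_ennreal)
  qed
  finally have "2 * (\<integral>\<^sup>+x. (maxavg n x)\<^sup>2 \<partial>lborel) \<le> 2 * (\<integral>\<^sup>+x. 2 * g x * maxavg n x \<partial>lborel)"
    by (intro mult_left_mono) auto
  also have "\<dots> = (\<integral>\<^sup>+x. 4 * g x * maxavg n x \<partial>lborel)"
    by (subst nn_integral_cmult[symmetric]) (auto simp: mult.assoc[symmetric])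
  also have "\<dots> \<le> (\<integral>\<^sup>+x. 4 * (g x)\<^sup>2 + (maxavg n x)\<^sup>2 \<partial>lborel)"
  proof (rule nn_integral_mono)
    have "4 * p * q \<le> 4 * p\<^sup>2 + q\<^sup>2" for p q :: ennreal
    proof (cases "p = \<infinity> \<or> q = \<infinity>")
      case False
      then obtain p' q' where pq: "p = ennreal p'" "q = ennreal q'" "p' \<ge> 0" "q' \<ge> 0"
        by (cases p; cases q) auto
      have "0 \<le> (2 * p' - q')\<^sup>2" by simp
      then have "4 * p' * q' \<le> 4 * p'\<^sup>2 + q'\<^sup>2" by (simp add: power2_eq_square algebra_simps)
      then have "ennreal (4 * p' * q') \<le> ennreal (4 * p'\<^sup>2 + q'\<^sup>2)" by (rule ennreal_leI)
      then show ?thesis using pq by (simp add: ennreal_mult ennreal_power)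
    qed (auto simp: power2_eq_square ennreal_mult_eq_top_iff)
    then show "4 * g x * maxavg n x \<le> 4 * (g x)\<^sup>2 + (maxavg n x)\<^sup>2" for x .
  qed
  also have "\<dots> = 4 * (\<integral>\<^sup>+x. (g x)\<^sup>2 \<partial>lborel) + (\<integral>\<^sup>+x. (maxavg n x)\<^sup>2 \<partial>lborel)"
    by (simp add: nn_integral_add nn_integral_cmult)
  finally have "(\<integral>\<^sup>+x. (maxavg n x)\<^sup>2 \<partial>lborel) + (\<integral>\<^sup>+x. (maxavg n x)\<^sup>2 \<partial>lborel)
      \<le> (\<integral>\<^sup>+x. (maxavg n x)\<^sup>2 \<partial>lborel) + 4 * (\<integral>\<^sup>+x. (g x)\<^sup>2 \<partial>lborel)"
    by (simp add: mult_2 add.commute)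
  then show ?thesis
    using maxavg_finite[of n] by (auto simp: ennreal_add_left_cancel_le)
qed

end

text \<open>The bound for lengths up to n is uniform in n, so monotone convergence removes the
  restriction.\<close>

theorem maximal_average_L2:
  fixes a :: "'a::euclidean_space" and g :: "'a \<Rightarrow> ennreal"
  assumes [measurable]: "g \<in> borel_measurable borel"
  shows "(\<integral>\<^sup>+x. (SUP m\<in>{1..}. (\<Sum>k<m. g (x - real k *\<^sub>R a)) / of_nat m)\<^sup>2 \<partial>lborel) \<le> 4 * (\<integral>\<^sup>+x. (g x)\<^sup>2 \<partial>lborel)"
proof (cases "(\<integral>\<^sup>+x. (g x)\<^sup>2 \<partial>lborel) = \<infinity>")
  case False
  then interpret shift_maximal a g by unfold_locales (auto simp: less_top)
  have "(\<integral>\<^sup>+x. (SUP m\<in>{1..}. (\<Sum>k<m. g (x - real k *\<^sub>R a)) / of_nat m)\<^sup>2 \<partial>lborel)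
     \<le> (\<integral>\<^sup>+x. (SUP n. (maxavg n x)\<^sup>2) \<partial>lborel)"
  proof (rule nn_integral_mono)
    fix x
    have inc: "incseq (\<lambda>n. maxavg n x)"
      unfolding maxavg_def by (intro monoI SUP_subset_mono) auto
    have "(SUP m\<in>{1..}. (\<Sum>k<m. g (x - real k *\<^sub>R a)) / of_nat m) \<le> (SUP n. maxavg n x)"
      unfolding maxavg_def ssum_def
      by (rule SUP_least, rule SUP_upper2[OF UNIV_I], rule SUP_upper) auto
    then have "(SUP m\<in>{1..}. (\<Sum>k<m. g (x - real k *\<^sub>R a)) / of_nat m)\<^sup>2 \<le> (SUP n. maxavg n x)\<^sup>2"
      by (rule power_mono) simp
    also have "\<dots> \<le> (SUP n. (maxavg n x)\<^sup>2)"
      unfolding power2_eq_square SUP_mult_left_ennreal SUP_mult_right_ennreal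
    proof (intro SUP_least)
      fix i j
      have "maxavg i x * maxavg j x \<le> maxavg (max i j) x * maxavg (max i j) x"
        by (intro mult_mono incseqD[OF inc]) auto
      also have "\<dots> \<le> (SUP n. maxavg n x * maxavg n x)" by (rule SUP_upper) simp
      finally show "maxavg j x * maxavg i x \<le> (SUP n. maxavg n x * maxavg n x)" by (simp add: mult.commute)
    qed
    finally show "(SUP m\<in>{1..}. (\<Sum>k<m. g (x - real k *\<^sub>R a)) / of_nat m)\<^sup>2 \<le> (SUP n. (maxavg n x)\<^sup>2)" .
  qed
  also have "\<dots> = (SUP n. \<integral>\<^sup>+x. (maxavg n x)\<^sup>2 \<partial>lborel)"
    by (intro nn_integral_monotone_convergence_SUP)
       (auto simp: incseq_def le_fun_def maxavg_def intro!: power_mono SUP_subset_mono)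
  also have "\<dots> \<le> 4 * (\<integral>\<^sup>+x. (g x)\<^sup>2 \<partial>lborel)" by (intro SUP_least maxavg_L2)
  finally show ?thesis .
qed (simp add: ennreal_mult_top)

section \<open>Averages of characters\<close>

text \<open>Weaker than Jordan's inequality, but immediate from the cubic Taylor remainder.\<close>

lemma sin_lower_bound:
  fixes x :: real
  assumes "\<bar>x\<bar> \<le> pi / 2"
  shows "\<bar>x\<bar> / 2 \<le> \<bar>sin x\<bar>"
proof -
  have "\<bar>sin x - (\<Sum>m<3. sin_coeff m * x ^ m)\<bar> \<le> inverse (fact 3) * \<bar>x\<bar> ^ 3"
    by (rule Maclaurin_sin_bound)
  moreover have "(\<Sum>m<3. sin_coeff m * x ^ m) = x"
    by (simp add: eval_nat_numeral sin_coeff_def)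
  ultimately have "\<bar>sin x - x\<bar> \<le> \<bar>x\<bar> ^ 3 / 6" by (simp add: fact_numeral)
  moreover have "\<bar>x\<bar> ^ 3 / 6 \<le> \<bar>x\<bar> / 2"
  proof -
    have "pi / 2 \<le> 17 / 10" using pi_approx by simp
    then have "\<bar>x\<bar> \<le> 17 / 10" using assms by linarith
    then have "\<bar>x\<bar> ^ 2 \<le> (17 / 10) ^ 2" by (intro power_mono) auto
    also have "\<dots> \<le> (3 :: real)" by (simp add: power2_eq_square)
    finally have "\<bar>x\<bar> * \<bar>x\<bar> ^ 2 \<le> \<bar>x\<bar> * 3" by (intro mult_left_mono) auto
    then show ?thesis by (simp add: eval_nat_numeral)
  qed
  ultimately show ?thesis by linarith
qed

lemma cmod_one_minus_iexp: "cmod (1 - iexp y) = 2 * \<bar>sin (y / 2)\<bar>"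
proof -
  have "(cmod (1 - iexp y))\<^sup>2 = (1 - cos y)\<^sup>2 + (sin y)\<^sup>2"
    by (simp add: cmod_power2 Re_exp Im_exp)
  also have "\<dots> = 2 - 2 * cos (2 * (y / 2))"
    using sin_cos_squared_add[of y] by (simp add: power2_eq_square algebra_simps)
  also have "\<dots> = (2 * \<bar>sin (y / 2)\<bar>)\<^sup>2"
    unfolding cos_double_sin by (simp add: power_mult_distrib)
  finally show ?thesis by (rule power2_eq_imp_eq) auto
qed

text \<open>The average over M powers is close to 1 while M |\<theta>| is small, since each power is
  close to 1; it is small once M |\<theta>| is large, by summing the geometric series. The range
  |\<theta>| <= 1/2 keeps \<open>z\<close> away from 1 except near \<theta> = 0.\<close>

lemma character_average_bounds:
  fixes \<theta> :: real and M :: nat and z :: complex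
  assumes M: "M \<ge> 1" and \<theta>: "\<bar>\<theta>\<bar> \<le> 1 / 2"
  defines "z \<equiv> iexp (- (2 * pi * \<theta>))"
  shows "cmod (1 - (\<Sum>k<M. z ^ k) / M) \<le> 2 * pi * (M * \<bar>\<theta>\<bar>)"
    and "\<theta> \<noteq> 0 \<Longrightarrow> cmod ((\<Sum>k<M. z ^ k) / M) \<le> 2 / (pi * (M * \<bar>\<theta>\<bar>))"
proof -
  have zk: "cmod (1 - z ^ k) \<le> 2 * pi * (M * \<bar>\<theta>\<bar>)" if "k < M" for k
  proof -
    have "z ^ k = iexp (real k * (- (2 * pi * \<theta>)))"
      unfolding z_def by (simp add: exp_of_nat_mult[symmetric] mult_ac)
    then have "cmod (1 - z ^ k) \<le> \<bar>real k * (- (2 * pi * \<theta>))\<bar>"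
      using iexp_approx1[of "real k * (- (2 * pi * \<theta>))" 0] by (simp add: norm_minus_commute)
    also have "\<dots> = 2 * pi * (real k * \<bar>\<theta>\<bar>)" by (simp add: abs_mult)
    also have "\<dots> \<le> 2 * pi * (M * \<bar>\<theta>\<bar>)"
      using that by (intro mult_left_mono mult_right_mono) auto
    finally show ?thesis .
  qed
  have "1 - (\<Sum>k<M. z ^ k) / M = (\<Sum>k<M. 1 - z ^ k) / M"
    using M by (simp add: sum_subtractf field_simps)
  also have "cmod \<dots> \<le> (\<Sum>k<M. cmod (1 - z ^ k)) / M"
    by (simp add: norm_divide divide_right_mono norm_sum)
  also have "\<dots> \<le> (\<Sum>k<M. 2 * pi * (M * \<bar>\<theta>\<bar>)) / M"
    by (intro divide_right_mono sum_mono zk) auto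
  also have "\<dots> = 2 * pi * (M * \<bar>\<theta>\<bar>)" using M by simp
  finally show "cmod (1 - (\<Sum>k<M. z ^ k) / M) \<le> 2 * pi * (M * \<bar>\<theta>\<bar>)" .
  assume "\<theta> \<noteq> 0"
  have "pi * \<bar>\<theta>\<bar> / 2 \<le> \<bar>sin (pi * \<theta>)\<bar>"
    using sin_lower_bound[of "pi * \<theta>"] \<theta> by (simp add: abs_mult)
  then have lower: "pi * \<bar>\<theta>\<bar> \<le> cmod (1 - z)"
    unfolding z_def cmod_one_minus_iexp by simp
  have pos: "0 < pi * \<bar>\<theta>\<bar>" using \<open>\<theta> \<noteq> 0\<close> by simp
  then have "z \<noteq> 1" using lower by auto
  then have "(\<Sum>k<M. z ^ k) = (1 - z ^ M) / (1 - z)" by (simp add: sum_gp_strict)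
  then have "cmod ((\<Sum>k<M. z ^ k) / M) = cmod (1 - z ^ M) / cmod (1 - z) / M"
    by (simp only: norm_divide norm_of_nat)
  also have "\<dots> \<le> 2 / (pi * \<bar>\<theta>\<bar>) / M"
  proof (intro divide_right_mono frac_le)
    have "cmod (1 - z ^ M) \<le> cmod 1 + cmod (z ^ M)" by (rule norm_triangle_ineq4)
    also have "cmod (z ^ M) = 1" unfolding z_def by (simp add: norm_power)
    finally show "cmod (1 - z ^ M) \<le> 2" by simp
  qed (use lower pos in auto)
  also have "\<dots> = 2 / (pi * (M * \<bar>\<theta>\<bar>))" by (simp add: mult_ac)
  finally show "cmod ((\<Sum>k<M. z ^ k) / M) \<le> 2 / (pi * (M * \<bar>\<theta>\<bar>))" .
qed

text \<open>Here x stands for 2^n |\<eta>|, so passing to 2 x is passing to the next scale. The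
  function x^2 / (1 + x^2) increases from 0 to 1, and its increment over a doubling is comparable to
  the smaller of x^2 and 1 / x^2. The left-hand sides are the squares of the two bounds for the
  averages, with 4 pi^2 <= 40; the factor 160/3 covers both ranges, which meet at x = 1/2.\<close>

lemma telescoping_bound:
  fixes x :: real
  assumes "x \<ge> 0"
  shows "x < 1 / 2 \<Longrightarrow> 40 * x\<^sup>2 \<le> 160 / 3 * ((2 * x)\<^sup>2 / (1 + (2 * x)\<^sup>2) - x\<^sup>2 / (1 + x\<^sup>2))"
    and "x \<ge> 1 / 2 \<Longrightarrow> 4 / x\<^sup>2 \<le> 160 / 3 * ((2 * x)\<^sup>2 / (1 + (2 * x)\<^sup>2) - x\<^sup>2 / (1 + x\<^sup>2))"
proof -
  define y where "y = x\<^sup>2"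
  have y0: "y \<ge> 0" by (simp add: y_def)
  have pos: "1 + 4 * y > 0" "1 + y > 0" using y0 by auto
  have eq: "160 / 3 * ((2 * x)\<^sup>2 / (1 + (2 * x)\<^sup>2) - x\<^sup>2 / (1 + x\<^sup>2)) = 160 * y / ((1 + 4 * y) * (1 + y))"
    using pos unfolding power_mult_distrib y_def[symmetric] by (simp add: field_simps)
  show "40 * x\<^sup>2 \<le> 160 / 3 * ((2 * x)\<^sup>2 / (1 + (2 * x)\<^sup>2) - x\<^sup>2 / (1 + x\<^sup>2))" if "x < 1 / 2"
  proof -
    have "y \<le> (1 / 2)\<^sup>2" unfolding y_def using that assms by (intro power_mono) auto
    then have y4: "y \<le> 1 / 4" by (simp add: power2_eq_square)
    then have "(1 + 4 * y) * (1 + y) \<le> 2 * 2" using y0 by (intro mult_mono) auto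
    then have "y * ((1 + 4 * y) * (1 + y)) \<le> y * 4" using y0 by (intro mult_left_mono) auto
    then show ?thesis
      unfolding eq unfolding y_def[symmetric] by (subst pos_le_divide_eq[OF mult_pos_pos[OF pos]]) (simp add: algebra_simps)
  qed
  show "4 / x\<^sup>2 \<le> 160 / 3 * ((2 * x)\<^sup>2 / (1 + (2 * x)\<^sup>2) - x\<^sup>2 / (1 + x\<^sup>2))" if "x \<ge> 1 / 2"
  proof -
    have "(1 / 2)\<^sup>2 \<le> y" unfolding y_def using that assms by (intro power_mono) auto
    then have y4: "1 / 4 \<le> y" by (simp add: power2_eq_square)
    have "(1 + 4 * y) * (1 + y) \<le> (8 * y) * (5 * y)" using y4 by (intro mult_mono) auto
    then have "4 * ((1 + 4 * y) * (1 + y)) \<le> 160 * y * y" by (simp add: algebra_simps)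
    then show ?thesis
      unfolding eq unfolding y_def[symmetric] using pos y4 by (simp add: divide_le_eq le_divide_eq mult_ac)
  qed
qed

text \<open>\<open>\<eta>\<close> is the displacement from a frequency in one coordinate. The cutoff
  jumps at 2^n |\<eta>| = 1/2, the scale at which the average changes from about 1 to small, so
  their difference decays geometrically in n on either side of it. As 2^N is within a factor 2 of Q,
  the parameter M |Q \<eta>| lies between x / 2 and x for x = 2^n |\<eta>|, and |Q \<eta>| <= 1/2.
  The telescoping sum is at most 160/3, which is below 54.\<close>

lemma cutoff_square_sum:
  fixes Q \<eta> :: real and N :: nat and z :: complex
  assumes Q: "0 < Q" "Q \<le> 2 ^ N" "2 ^ N \<le> 2 * Q" and \<eta>: "\<bar>\<eta>\<bar> < 1 / 2 ^ (N + 1)"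
  defines "z \<equiv> iexp (- (2 * pi * (Q * \<eta>)))"
  shows "(\<Sum>n. ennreal ((cmod (if N \<le> n then of_bool (\<bar>\<eta>\<bar> < 1 / 2 ^ (n + 1)) - (\<Sum>k<2 ^ (n - N). z ^ k) / of_nat (2 ^ (n - N)) else 0))\<^sup>2)) \<le> 54"
proof -
  let ?w = "\<lambda>n. if N \<le> n then of_bool (\<bar>\<eta>\<bar> < 1 / 2 ^ (n + 1)) - (\<Sum>k<2 ^ (n - N). z ^ k) / of_nat (2 ^ (n - N)) else 0"
  let ?\<psi> = "\<lambda>n. (2 ^ n * \<bar>\<eta>\<bar>)\<^sup>2 / (1 + (2 ^ n * \<bar>\<eta>\<bar>)\<^sup>2)"
  have q: "0 < 1 + (2 ^ n * \<bar>\<eta>\<bar>)\<^sup>2" for n by (intro add_pos_nonneg) auto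
  have \<psi>01: "0 \<le> ?\<psi> n" "?\<psi> n \<le> 1" for n
    using q[of n] by (auto simp only: divide_le_eq_1_pos intro!: divide_nonneg_pos) auto
  have mono: "?\<psi> n \<le> ?\<psi> (Suc n)" for n
  proof -
    have m: "(2 ^ n * \<bar>\<eta>\<bar>)\<^sup>2 \<le> (2 ^ Suc n * \<bar>\<eta>\<bar>)\<^sup>2" by (intro power_mono mult_right_mono) auto
    have "a / (1 + a) \<le> b / (1 + b)" if "a \<le> b" "0 < 1 + a" "0 < 1 + b" for a b :: real
      using that by (simp add: divide_le_eq le_divide_eq algebra_simps)
    from this[OF m q q] show ?thesis .
  qed
  have \<theta>: "\<bar>Q * \<eta>\<bar> \<le> 1 / 2"
  proof -
    have "\<bar>Q * \<eta>\<bar> = Q * \<bar>\<eta>\<bar>" using Q by (simp add: abs_mult)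
    also have "\<dots> \<le> 2 ^ N * (1 / 2 ^ (N + 1))" using Q \<eta> by (intro mult_mono) auto
    finally show ?thesis by simp
  qed
  have main: "(cmod (?w n))\<^sup>2 \<le> 160 / 3 * (?\<psi> (Suc n) - ?\<psi> n)" for n
  proof (cases "N \<le> n")
    case True
    define M :: nat where "M = 2 ^ (n - N)"
    define x where "x = 2 ^ n * \<bar>\<eta>\<bar>"
    have M1: "M \<ge> 1" by (simp add: M_def)
    have x0: "x \<ge> 0" by (simp add: x_def)
    have MN: "real M * 2 ^ N = 2 ^ n" unfolding M_def using True by (simp flip: power_add)
    have M\<theta>: "M * \<bar>Q * \<eta>\<bar> = M * Q * \<bar>\<eta>\<bar>" using Q by (simp add: abs_mult)
    have "real M * Q \<le> real M * 2 ^ N" using Q by (intro mult_left_mono) auto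
    then have upper: "M * \<bar>Q * \<eta>\<bar> \<le> x" unfolding M\<theta> x_def MN by (rule mult_right_mono) simp
    have "real M * 2 ^ N \<le> real M * (2 * Q)" using Q by (intro mult_left_mono) auto
    then have "2 ^ n * \<bar>\<eta>\<bar> \<le> M * (2 * Q) * \<bar>\<eta>\<bar>" unfolding MN by (rule mult_right_mono) simp
    then have lower: "x / 2 \<le> M * \<bar>Q * \<eta>\<bar>" unfolding M\<theta> x_def by simp
    have iff: "\<bar>\<eta>\<bar> < 1 / 2 ^ (n + 1) \<longleftrightarrow> x < 1 / 2" by (simp add: x_def field_simps)
    have wn: "?w n = of_bool (x < 1 / 2) - (\<Sum>k<M. z ^ k) / M"
      by (simp only: iff M_def True if_True)
    have \<psi>: "?\<psi> n = x\<^sup>2 / (1 + x\<^sup>2)" "?\<psi> (Suc n) = (2 * x)\<^sup>2 / (1 + (2 * x)\<^sup>2)" by (simp_all add: x_def mult.assoc)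
    show ?thesis
    proof (cases "x < 1 / 2")
      case small: True
      have "cmod (?w n) = cmod (1 - (\<Sum>k<M. z ^ k) / M)"
        unfolding wn using small by (simp only: of_bool_eq)
      also have "\<dots> \<le> 2 * pi * (M * \<bar>Q * \<eta>\<bar>)"
        unfolding z_def by (rule character_average_bounds(1)[OF M1 \<theta>])
      also have "\<dots> \<le> 2 * pi * x" using upper by (intro mult_left_mono) auto
      finally have "(cmod (?w n))\<^sup>2 \<le> (2 * pi * x)\<^sup>2" by (intro power_mono) auto
      also have "\<dots> = 4 * pi\<^sup>2 * x\<^sup>2" by (simp add: power_mult_distrib)
      also have "\<dots> \<le> 40 * x\<^sup>2"
      proof (rule mult_right_mono)
        have "pi \<le> 316 / 100" using pi_approx by simp
        then have "pi\<^sup>2 \<le> (316 / 100)\<^sup>2" by (intro power_mono) auto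
        also have "\<dots> \<le> 10" by (simp add: power2_eq_square)
        finally show "4 * pi\<^sup>2 \<le> 40" by simp
      qed simp
      also have "\<dots> \<le> 160 / 3 * (?\<psi> (Suc n) - ?\<psi> n)"
        unfolding \<psi> by (rule telescoping_bound(1)[OF x0 small])
      finally show ?thesis .
    next
      case large: False
      then have "\<eta> \<noteq> 0" by (auto simp: x_def)
      have x: "x \<ge> 1 / 2" using large by simp
      have "cmod (?w n) = cmod ((\<Sum>k<M. z ^ k) / M)"
        unfolding wn using large by (simp only: of_bool_eq norm_minus_cancel diff_0)
      also have "\<dots> \<le> 2 / (pi * (M * \<bar>Q * \<eta>\<bar>))"
        unfolding z_def using Q \<open>\<eta> \<noteq> 0\<close> by (intro character_average_bounds(2)[OF M1 \<theta>]) auto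
      also have "\<dots> \<le> 2 / x"
      proof (rule divide_left_mono)
        have "x = 2 * (x / 2)" by simp
        also have "\<dots> \<le> pi * (M * \<bar>Q * \<eta>\<bar>)"
          using lower pi_gt3 x by (intro mult_mono) auto
        finally show "x \<le> pi * (M * \<bar>Q * \<eta>\<bar>)" .
        then show "0 < pi * (M * \<bar>Q * \<eta>\<bar>) * x" using x by (intro mult_pos_pos[of _ x]) linarith+
      qed simp
      finally have "(cmod (?w n))\<^sup>2 \<le> (2 / x)\<^sup>2" by (intro power_mono) auto
      also have "\<dots> = 4 / x\<^sup>2" by (simp add: power_divide)
      also have "\<dots> \<le> 160 / 3 * (?\<psi> (Suc n) - ?\<psi> n)"
        unfolding \<psi> by (rule telescoping_bound(2)[OF x0 x])
      finally show ?thesis .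
    qed
  next
    case False
    then show ?thesis using mono[of n] by simp
  qed
  show ?thesis
  proof (rule suminf_le_const)
    fix L
    have "(\<Sum>n<L. (cmod (?w n))\<^sup>2) \<le> (\<Sum>n<L. 160 / 3 * (?\<psi> (Suc n) - ?\<psi> n))"
      by (intro sum_mono main)
    also have "\<dots> = 160 / 3 * (?\<psi> L - ?\<psi> 0)"
      unfolding sum_distrib_left[symmetric] sum_lessThan_telescope[of ?\<psi>] ..
    also have "\<dots> \<le> 160 / 3 * (1 - 0)" by (intro mult_left_mono diff_mono \<psi>01) simp
    finally have "ennreal (\<Sum>n<L. (cmod (?w n))\<^sup>2) \<le> ennreal 54" by (intro ennreal_leI) simp
    then show "(\<Sum>n<L. ennreal ((cmod (?w n))\<^sup>2)) \<le> 54" by (subst sum_ennreal) auto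
  qed simp
qed

section \<open>Maximal functions of multiplier operators\<close>

definition bdd_mult :: "(real \<times> real \<Rightarrow> complex) \<Rightarrow> bool" where
  "bdd_mult m \<longleftrightarrow> m \<in> borel_measurable borel \<and> (\<exists>B. \<forall>\<xi>. cmod (m \<xi>) \<le> B)"

lemma bdd_multI: "m \<in> borel_measurable borel \<Longrightarrow> (\<And>\<xi>. cmod (m \<xi>) \<le> B) \<Longrightarrow> bdd_mult m"
  by (auto simp: bdd_mult_def)

lemma bdd_mult_const [intro, simp]: "bdd_mult (\<lambda>\<xi>. c)"
  by (rule bdd_multI[of _ "cmod c"]) auto

lemma bdd_mult_indicator [intro]: "S \<in> sets borel \<Longrightarrow> bdd_mult (indicator S)"
  by (rule bdd_multI[of _ 1]) (auto simp: indicator_def)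

lemma bdd_mult_mult [intro]:
  assumes "bdd_mult m" "bdd_mult m'" shows "bdd_mult (\<lambda>\<xi>. m \<xi> * m' \<xi>)"
proof -
  obtain B B' where "\<And>\<xi>. cmod (m \<xi>) \<le> B" "\<And>\<xi>. cmod (m' \<xi>) \<le> B'" using assms by (auto simp: bdd_mult_def)
  moreover from this have "0 \<le> B" using norm_ge_zero order_trans by blast
  ultimately have "cmod (m \<xi> * m' \<xi>) \<le> B * B'" for \<xi> by (simp add: norm_mult mult_mono)
  moreover have "(\<lambda>\<xi>. m \<xi> * m' \<xi>) \<in> borel_measurable borel"
    using assms by (auto simp: bdd_mult_def)
  ultimately show ?thesis by (rule bdd_multI[rotated])
qed

lemma bdd_mult_add [intro]:
  assumes "bdd_mult m" "bdd_mult m'" shows "bdd_mult (\<lambda>\<xi>. m \<xi> + m' \<xi>)"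
proof -
  obtain B B' where "\<And>\<xi>. cmod (m \<xi>) \<le> B" "\<And>\<xi>. cmod (m' \<xi>) \<le> B'" using assms by (auto simp: bdd_mult_def)
  then have "cmod (m \<xi> + m' \<xi>) \<le> B + B'" for \<xi> by (meson norm_triangle_mono)
  moreover have "(\<lambda>\<xi>. m \<xi> + m' \<xi>) \<in> borel_measurable borel"
    using assms by (auto simp: bdd_mult_def)
  ultimately show ?thesis by (rule bdd_multI[rotated])
qed

lemma bdd_mult_uminus [intro]: "bdd_mult m \<Longrightarrow> bdd_mult (\<lambda>\<xi>. - m \<xi>)"
  using bdd_mult_mult[OF bdd_mult_const[of "-1"], of m] by simp

lemma bdd_mult_diff [intro]: "bdd_mult m \<Longrightarrow> bdd_mult m' \<Longrightarrow> bdd_mult (\<lambda>\<xi>. m \<xi> - m' \<xi>)"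
  using bdd_mult_add[of m "\<lambda>\<xi>. - m' \<xi>"] by auto

lemma bdd_mult_sum [intro]: "(\<And>i. i \<in> I \<Longrightarrow> bdd_mult (m i)) \<Longrightarrow> bdd_mult (\<lambda>\<xi>. \<Sum>i\<in>I. m i \<xi>)"
  by (induction I rule: infinite_finite_induct) auto

lemma bdd_mult_character [intro]: "bdd_mult (\<lambda>\<xi>. char2 \<xi> a)"
  by (rule bdd_multI[of _ 1]) auto

lemma bdd_mult_L2:
  assumes m: "bdd_mult m" and h: "h \<in> L2" shows "(\<lambda>\<xi>. m \<xi> * h \<xi>) \<in> L2"
proof -
  have [measurable]: "m \<in> borel_measurable borel" "h \<in> borel_measurable borel"
    using m h by (auto simp: bdd_mult_def L2_iff)
  obtain B where B: "\<And>\<xi>. cmod (m \<xi>) \<le> B" using m by (auto simp: bdd_mult_def)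
  have "nsq (\<lambda>\<xi>. m \<xi> * h \<xi>) \<le> nsq (\<lambda>\<xi>. of_real B * h \<xi>)"
    unfolding nsq_def norm_mult
  proof (intro nn_integral_mono ennreal_leI power_mono mult_right_mono)
    show "cmod (m \<xi>) \<le> cmod (of_real B)" for \<xi> using B[of \<xi>] by simp
  qed auto
  also have "\<dots> < \<infinity>" using L2_cmult[OF h, of "of_real B"] by (simp add: L2_iff)
  finally show ?thesis by (simp add: L2_iff)
qed

text \<open>\<open>inv_fourier\<close> chooses representatives, so algebraic identities between
  these operators hold only almost everywhere.\<close>

definition mult_op :: "(real \<times> real \<Rightarrow> complex) \<Rightarrow> (real \<times> real \<Rightarrow> complex) \<Rightarrow> real \<times> real \<Rightarrow> complex" where
  "mult_op m f = inv_fourier (\<lambda>\<xi>. m \<xi> * fourier f \<xi>)"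

lemma mult_op_L2: "bdd_mult m \<Longrightarrow> f \<in> L2 \<Longrightarrow> mult_op m f \<in> L2"
  unfolding mult_op_def by (intro inv_fourier bdd_mult_L2 fourier_L2)

lemma fourier_mult_op:
  "bdd_mult m \<Longrightarrow> f \<in> L2 \<Longrightarrow> AE \<xi> in lborel. fourier (mult_op m f) \<xi> = m \<xi> * fourier f \<xi>"
  unfolding mult_op_def by (intro inv_fourier bdd_mult_L2 fourier_L2)

lemma mult_op_eqI:
  assumes "bdd_mult m" "f \<in> L2" "g \<in> L2" "AE \<xi> in lborel. fourier g \<xi> = m \<xi> * fourier f \<xi>"
  shows "AE x in lborel. mult_op m f x = g x"
proof (rule fourier_inject[OF mult_op_L2[OF assms(1,2)] assms(3)])
  show "AE \<xi> in lborel. fourier (mult_op m f) \<xi> = fourier g \<xi>"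
    using fourier_mult_op[OF assms(1,2)] assms(4) by eventually_elim simp
qed

lemma nsq_mult_op:
  assumes "bdd_mult m" "f \<in> L2" shows "nsq (mult_op m f) = nsq (\<lambda>\<xi>. m \<xi> * fourier f \<xi>)"
proof -
  have "nsq (mult_op m f) = nsq (fourier (mult_op m f))"
    by (rule plancherel[symmetric]) (intro mult_op_L2 assms)
  also have "\<dots> = nsq (\<lambda>\<xi>. m \<xi> * fourier f \<xi>)"
    by (rule nsq_cong) (use fourier_mult_op[OF assms] in \<open>eventually_elim, simp\<close>)
  finally show ?thesis .
qed

lemma mult_op_one: "f \<in> L2 \<Longrightarrow> AE x in lborel. mult_op (\<lambda>\<xi>. 1) f x = f x"
  by (rule mult_op_eqI) auto

lemma mult_op_compose:
  assumes "bdd_mult m" "bdd_mult m'" "f \<in> L2"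
  shows "AE x in lborel. mult_op (\<lambda>\<xi>. m \<xi> * m' \<xi>) f x = mult_op m (mult_op m' f) x"
proof (rule mult_op_eqI)
  show "AE \<xi> in lborel. fourier (mult_op m (mult_op m' f)) \<xi> = m \<xi> * m' \<xi> * fourier f \<xi>"
    using fourier_mult_op[OF assms(1) mult_op_L2[OF assms(2,3)]] fourier_mult_op[OF assms(2,3)]
    by eventually_elim simp
qed (intro bdd_mult_mult mult_op_L2 assms)+

lemma mult_op_add_cmult:
  assumes "bdd_mult m" "bdd_mult m'" "f \<in> L2"
  shows "AE x in lborel. mult_op (\<lambda>\<xi>. m \<xi> + c * m' \<xi>) f x = mult_op m f x + c * mult_op m' f x"
proof (rule mult_op_eqI)
  show "AE \<xi> in lborel. fourier (\<lambda>x. mult_op m f x + c * mult_op m' f x) \<xi> = (m \<xi> + c * m' \<xi>) * fourier f \<xi>"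
    using fourier_add_cmult[OF mult_op_L2[OF assms(1,3)] mult_op_L2[OF assms(2,3)], of c]
      fourier_mult_op[OF assms(1,3)] fourier_mult_op[OF assms(2,3)]
    by eventually_elim (simp add: algebra_simps)
qed (intro bdd_mult_add bdd_mult_mult bdd_mult_const L2_add L2_cmult mult_op_L2 assms)+

lemma mult_op_sum:
  assumes "finite I" "\<And>i. i \<in> I \<Longrightarrow> bdd_mult (m i)" "f \<in> L2"
  shows "AE x in lborel. mult_op (\<lambda>\<xi>. \<Sum>i\<in>I. c * m i \<xi>) f x = (\<Sum>i\<in>I. c * mult_op (m i) f x)"
  using assms(1,2)
proof (induction I rule: finite_induct)
  case empty
  \<comment> \<open>The zero multiplier is written as 1 + (-1) * 1, so that linearity alone shows
    that its operator vanishes.\<close>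
  have "AE x in lborel. mult_op (\<lambda>\<xi>. 1 + (-1) * 1) f x = mult_op (\<lambda>\<xi>. 1) f x + (-1) * mult_op (\<lambda>\<xi>. 1) f x"
    by (rule mult_op_add_cmult[OF _ _ assms(3)]) auto
  then show ?case by simp
next
  case (insert i I)
  have "bdd_mult (\<lambda>\<xi>. \<Sum>i\<in>I. c * m i \<xi>)"
    by (intro bdd_mult_sum bdd_mult_mult bdd_mult_const) (simp add: insert)
  from mult_op_add_cmult[OF this _ assms(3), of "m i" c] insert
  have "AE x in lborel. mult_op (\<lambda>\<xi>. (\<Sum>i\<in>I. c * m i \<xi>) + c * m i \<xi>) f x
     = mult_op (\<lambda>\<xi>. \<Sum>i\<in>I. c * m i \<xi>) f x + c * mult_op (m i) f x" by simp
  moreover have "AE x in lborel. mult_op (\<lambda>\<xi>. \<Sum>i\<in>I. c * m i \<xi>) f x = (\<Sum>i\<in>I. c * mult_op (m i) f x)"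
    using insert by simp
  ultimately show ?case
    unfolding sum.insert[OF insert(1,2)] by eventually_elim (simp add: add.commute)
qed

lemma mult_op_translate:
  assumes "bdd_mult m" "f \<in> L2"
  shows "AE x in lborel. mult_op (\<lambda>\<xi>. char2 \<xi> a * m \<xi>) f x = mult_op m f (x - a)"
proof (rule mult_op_eqI)
  show "AE \<xi> in lborel. fourier (\<lambda>x. mult_op m f (x - a)) \<xi> = char2 \<xi> a * m \<xi> * fourier f \<xi>"
    using fourier_translate[OF mult_op_L2[OF assms], of a] fourier_mult_op[OF assms]
    by eventually_elim simp
qed (intro bdd_mult_mult bdd_mult_character L2_translate mult_op_L2 assms)+

section \<open>Maximal inequalities for families of multipliers\<close>

definition max_op :: "'j set \<Rightarrow> ('j \<Rightarrow> real \<times> real \<Rightarrow> complex) \<Rightarrow> (real \<times> real \<Rightarrow> complex) \<Rightarrow> real \<times> real \<Rightarrow> ennreal" where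
  "max_op J v f x = (SUP j\<in>J. ennreal (cmod (mult_op (v j) f x)))"

text \<open>\<open>B\<close> bounds the square of the operator norm, which suits square functions
  and makes the constants of two successive parameters multiply. Countability of \<open>J\<close>
  lets the exceptional null sets of its members be united and keeps the supremum measurable.\<close>

definition max_bound :: "'j set \<Rightarrow> ('j \<Rightarrow> real \<times> real \<Rightarrow> complex) \<Rightarrow> real \<Rightarrow> bool" where
  "max_bound J v B \<longleftrightarrow> B \<ge> 0 \<and> countable J \<and> (\<forall>j\<in>J. bdd_mult (v j)) \<and>
    (\<forall>f\<in>L2. (\<integral>\<^sup>+x. (max_op J v f x)\<^sup>2 \<partial>lborel) \<le> ennreal B * nsq f)"

lemma max_op_measurable:
  assumes "countable J" "\<And>j. j \<in> J \<Longrightarrow> bdd_mult (v j)" "f \<in> L2"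
  shows "max_op J v f \<in> borel_measurable borel"
proof -
  have "mult_op (v j) f \<in> borel_measurable borel" if "j \<in> J" for j
    using assms that by (auto intro!: L2_measurable mult_op_L2)
  then show ?thesis
    unfolding max_op_def[abs_def] using assms(1) by (intro borel_measurable_SUP) auto
qed

lemma max_boundD:
  assumes "max_bound J v B"
  shows "B \<ge> 0" "countable J" "\<And>j. j \<in> J \<Longrightarrow> bdd_mult (v j)"
    "\<And>f. f \<in> L2 \<Longrightarrow> (\<integral>\<^sup>+x. (max_op J v f x)\<^sup>2 \<partial>lborel) \<le> ennreal B * nsq f"
    "\<And>f. f \<in> L2 \<Longrightarrow> max_op J v f \<in> borel_measurable borel"
  using assms by (auto simp: max_bound_def intro: max_op_measurable)

lemma max_bound_mono: "max_bound J v B \<Longrightarrow> B \<le> B' \<Longrightarrow> max_bound J v B'"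
  by (fastforce simp: max_bound_def intro: order_trans mult_right_mono ennreal_leI)

text \<open>The square of a supremum is a supremum over pairs, and a product is at most the square
  of its larger factor.\<close>

lemma SUP_squared_le:
  fixes y :: "'i \<Rightarrow> ennreal"
  assumes "\<And>i. i \<in> I \<Longrightarrow> (y i)\<^sup>2 \<le> X"
  shows "(SUP i\<in>I. y i)\<^sup>2 \<le> X"
  unfolding power2_eq_square SUP_mult_left_ennreal SUP_mult_right_ennreal
proof (intro SUP_least)
  fix i j assume ij: "i \<in> I" "j \<in> I"
  have "y j * y i \<le> (max (y i) (y j))\<^sup>2"
    unfolding power2_eq_square by (intro mult_mono) auto
  also have "\<dots> \<le> X" using assms ij by (auto simp: max_def)
  finally show "y j * y i \<le> X" .
qed

lemma ennreal_power2_sum_le: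
  fixes a b :: ennreal and t :: real
  assumes "t > 0"
  shows "(a + b)\<^sup>2 \<le> ennreal (1 + t) * a\<^sup>2 + ennreal (1 + 1 / t) * b\<^sup>2"
proof (cases "a = \<infinity> \<or> b = \<infinity>")
  case False
  then obtain a' b' where ab: "a = ennreal a'" "b = ennreal b'" "a' \<ge> 0" "b' \<ge> 0"
    by (cases a; cases b) auto
  have "ennreal ((a' + b')\<^sup>2) \<le> ennreal ((1 + t) * a'\<^sup>2 + (1 + 1 / t) * b'\<^sup>2)"
    using assms by (intro ennreal_leI power2_sum_le)
  also have "\<dots> = ennreal ((1 + t) * a'\<^sup>2) + ennreal ((1 + 1 / t) * b'\<^sup>2)"
    using assms ab by (intro ennreal_plus) auto
  also have "\<dots> = ennreal (1 + t) * a\<^sup>2 + ennreal (1 + 1 / t) * b\<^sup>2"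
    using assms ab by (simp add: ennreal_mult' ennreal_power del: ennreal_plus)
  also have "ennreal ((a' + b')\<^sup>2) = (a + b)\<^sup>2"
    using ab by (simp add: ennreal_power flip: ennreal_plus)
  finally show ?thesis .
next
  case True
  have "ennreal (1 + s) * (\<infinity>\<^sup>2) = \<infinity>" if "s > 0" for s
    using that by (auto simp: power2_eq_square ennreal_mult_eq_top_iff)
  with True assms show ?thesis by auto
qed

text \<open>The inequality for \<open>v\<close> is used once for each \<open>i\<close>. By
  Plancherel the sum of the norms of \<open>mult_op (w i) f\<close> becomes an integral of |fourier
  f|^2 against the sum of |w i|^2, which is at most \<open>D\<close> at every frequency.\<close>

lemma square_function_bound:
  fixes w :: "nat \<Rightarrow> real \<times> real \<Rightarrow> complex"
  assumes v: "max_bound J v B" and w: "\<And>i. bdd_mult (w i)" and f: "f \<in> L2"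
    and D: "\<And>\<xi>. (\<Sum>i. ennreal ((cmod (w i \<xi>))\<^sup>2)) \<le> ennreal D" "D \<ge> 0"
  shows "(\<integral>\<^sup>+x. (\<Sum>i. (max_op J v (mult_op (w i) f) x)\<^sup>2) \<partial>lborel) \<le> ennreal (B * D) * nsq f"
proof -
  note v = max_boundD[OF v]
  have [measurable]: "max_op J v (mult_op (w i) f) \<in> borel_measurable borel" for i
    by (intro v(5) mult_op_L2 w f)
  have [measurable]: "w i \<in> borel_measurable borel" for i using w by (auto simp: bdd_mult_def)
  have [measurable]: "fourier f \<in> borel_measurable borel" by (intro L2_measurable fourier_L2 f)
  have "(\<integral>\<^sup>+x. (\<Sum>i. (max_op J v (mult_op (w i) f) x)\<^sup>2) \<partial>lborel) =
    (\<Sum>i. \<integral>\<^sup>+x. (max_op J v (mult_op (w i) f) x)\<^sup>2 \<partial>lborel)"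
    by (rule nn_integral_suminf) measurable
  also have "\<dots> \<le> (\<Sum>i. ennreal B * nsq (mult_op (w i) f))"
    by (intro suminf_le v(4) mult_op_L2 w f) auto
  also have "\<dots> = ennreal B * (\<Sum>i. nsq (mult_op (w i) f))" by simp
  also have "(\<Sum>i. nsq (mult_op (w i) f)) = (\<Sum>i. \<integral>\<^sup>+\<xi>. ennreal ((cmod (w i \<xi>))\<^sup>2) * ennreal ((cmod (fourier f \<xi>))\<^sup>2) \<partial>lborel)"
    unfolding nsq_mult_op[OF w f] by (simp add: nsq_def norm_mult power_mult_distrib ennreal_mult')
  also have "\<dots> = (\<integral>\<^sup>+\<xi>. (\<Sum>i. ennreal ((cmod (w i \<xi>))\<^sup>2) * ennreal ((cmod (fourier f \<xi>))\<^sup>2)) \<partial>lborel)"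
    by (rule nn_integral_suminf[symmetric]) measurable
  also have "\<dots> = (\<integral>\<^sup>+\<xi>. (\<Sum>i. ennreal ((cmod (w i \<xi>))\<^sup>2)) * ennreal ((cmod (fourier f \<xi>))\<^sup>2) \<partial>lborel)"
    by simp
  also have "\<dots> \<le> (\<integral>\<^sup>+\<xi>. ennreal D * ennreal ((cmod (fourier f \<xi>))\<^sup>2) \<partial>lborel)"
    by (intro nn_integral_mono mult_right_mono D) auto
  also have "\<dots> = ennreal D * nsq (fourier f)"
    unfolding nsq_def by (rule nn_integral_cmult) measurable
  also have "ennreal B * (ennreal D * nsq (fourier f)) = ennreal (B * D) * nsq f"
    using v(1) D(2) f by (simp add: plancherel ennreal_mult mult.assoc)
  finally show ?thesis by (simp add: mult_left_mono)
qed

text \<open>The error terms factor through the family \<open>v\<close>, so its maximal inequality can be applied to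
  each \<open>mult_op (w i) f\<close> and the results summed in square.\<close>

lemma max_bound_perturb:
  fixes w :: "nat \<Rightarrow> real \<times> real \<Rightarrow> complex" and i :: "'p \<Rightarrow> nat" and j :: "'p \<Rightarrow> 'j"
  assumes v: "max_bound J v B" and y: "max_bound P y C" and w: "\<And>i. bdd_mult (w i)"
    and D: "\<And>\<xi>. (\<Sum>i. ennreal ((cmod (w i \<xi>))\<^sup>2)) \<le> ennreal D" "D \<ge> 0"
    and z: "\<And>p \<xi>. p \<in> P \<Longrightarrow> z p \<xi> = y p \<xi> + v (j p) \<xi> * w (i p) \<xi>"
    and j: "\<And>p. p \<in> P \<Longrightarrow> j p \<in> J" and t: "t > 0"
  shows "max_bound P z ((1 + t) * C + (1 + 1 / t) * (B * D))"
  unfolding max_bound_def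
proof (intro conjI ballI)
  note v' = max_boundD[OF v] and y' = max_boundD[OF y]
  show "0 \<le> (1 + t) * C + (1 + 1 / t) * (B * D)" using v' y' t D by auto
  show "countable P" by (rule y')
  have z': "z p = (\<lambda>\<xi>. y p \<xi> + 1 * (v (j p) \<xi> * w (i p) \<xi>))" if "p \<in> P" for p
    using z[OF that] by auto
  show "bdd_mult (z p)" if "p \<in> P" for p
    unfolding z'[OF that] using that by (intro bdd_mult_add bdd_mult_mult bdd_mult_const v' y' w j)
  fix f assume f: "f \<in> L2"
  have AE: "AE x in lborel. \<forall>p\<in>P. mult_op (z p) f x = mult_op (y p) f x + mult_op (v (j p)) (mult_op (w (i p)) f) x"
  proof (rule AE_ball_countable'[OF _ y'(2)])
    fix p assume p: "p \<in> P"
    note b = v'(3)[OF j[OF p]] y'(3)[OF p] w[of "i p"]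
    show "AE x in lborel. mult_op (z p) f x = mult_op (y p) f x + mult_op (v (j p)) (mult_op (w (i p)) f) x"
      using mult_op_add_cmult[OF b(2) bdd_mult_mult[OF b(1,3)] f, of 1] mult_op_compose[OF b(1,3) f]
      unfolding z'[OF p] by eventually_elim simp
  qed
  have [measurable]: "max_op J v (mult_op (w i) f) \<in> borel_measurable borel" for i
    by (intro v'(5) mult_op_L2 w f)
  have [measurable]: "max_op P y f \<in> borel_measurable borel" by (intro y'(5) f)
  have "(\<integral>\<^sup>+x. (max_op P z f x)\<^sup>2 \<partial>lborel) \<le> (\<integral>\<^sup>+x. ennreal (1 + t) * (max_op P y f x)\<^sup>2 +
      ennreal (1 + 1 / t) * (\<Sum>i. (max_op J v (mult_op (w i) f) x)\<^sup>2) \<partial>lborel)"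
  proof (rule nn_integral_mono_AE)
    show "AE x in lborel. (max_op P z f x)\<^sup>2 \<le> ennreal (1 + t) * (max_op P y f x)\<^sup>2 +
      ennreal (1 + 1 / t) * (\<Sum>i. (max_op J v (mult_op (w i) f) x)\<^sup>2)"
      using AE
    proof eventually_elim
      fix x assume eq: "\<forall>p\<in>P. mult_op (z p) f x = mult_op (y p) f x + mult_op (v (j p)) (mult_op (w (i p)) f) x"
      show "(max_op P z f x)\<^sup>2 \<le> ennreal (1 + t) * (max_op P y f x)\<^sup>2 +
        ennreal (1 + 1 / t) * (\<Sum>i. (max_op J v (mult_op (w i) f) x)\<^sup>2)"
        unfolding max_op_def[of P z]
      proof (rule SUP_squared_le)
        fix p assume p: "p \<in> P"
        have "ennreal (cmod (mult_op (z p) f x)) \<le> ennreal (cmod (mult_op (y p) f x)) + ennreal (cmod (mult_op (v (j p)) (mult_op (w (i p)) f) x))"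
          using eq p by (auto intro!: ennreal_leI norm_triangle_ineq simp flip: ennreal_plus)
        also have "\<dots> \<le> max_op P y f x + max_op J v (mult_op (w (i p)) f) x"
          unfolding max_op_def using p j by (intro add_mono SUP_upper) auto
        finally have "(ennreal (cmod (mult_op (z p) f x)))\<^sup>2 \<le> (max_op P y f x + max_op J v (mult_op (w (i p)) f) x)\<^sup>2"
          by (rule power_mono) simp
        also have "\<dots> \<le> ennreal (1 + t) * (max_op P y f x)\<^sup>2 + ennreal (1 + 1 / t) * (max_op J v (mult_op (w (i p)) f) x)\<^sup>2"
          by (rule ennreal_power2_sum_le[OF t])
        \<comment> \<open>The index \<open>i p\<close> varies with \<open>p\<close>; one summand is
          dominated by the whole sum, which no longer depends on \<open>p\<close>.\<close>
        also have "(max_op J v (mult_op (w (i p)) f) x)\<^sup>2 \<le> (\<Sum>i. (max_op J v (mult_op (w i) f) x)\<^sup>2)"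
          using sum_le_suminf[OF summableI, of "{i p}" "\<lambda>i. (max_op J v (mult_op (w i) f) x)\<^sup>2"] by simp
        finally show "(ennreal (cmod (mult_op (z p) f x)))\<^sup>2 \<le> ennreal (1 + t) * (max_op P y f x)\<^sup>2 +
          ennreal (1 + 1 / t) * (\<Sum>i. (max_op J v (mult_op (w i) f) x)\<^sup>2)"
          by (simp add: add_left_mono mult_left_mono)
      qed
    qed
  qed
  also have "\<dots> = ennreal (1 + t) * (\<integral>\<^sup>+x. (max_op P y f x)\<^sup>2 \<partial>lborel) +
      ennreal (1 + 1 / t) * (\<integral>\<^sup>+x. (\<Sum>i. (max_op J v (mult_op (w i) f) x)\<^sup>2) \<partial>lborel)"
    by (subst nn_integral_add) (auto simp: nn_integral_cmult)
  also have "\<dots> \<le> ennreal (1 + t) * (ennreal C * nsq f) + ennreal (1 + 1 / t) * (ennreal (B * D) * nsq f)"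
    by (intro add_mono mult_left_mono y'(4) square_function_bound[OF v w f D] f) auto
  also have "\<dots> = ennreal ((1 + t) * C + (1 + 1 / t) * (B * D)) * nsq f"
  proof -
    have "ennreal ((1 + t) * C + (1 + 1 / t) * (B * D)) = ennreal ((1 + t) * C) + ennreal ((1 + 1 / t) * (B * D))"
      using t v'(1) y'(1) D(2) by (intro ennreal_plus) auto
    also have "\<dots> = ennreal (1 + t) * ennreal C + ennreal (1 + 1 / t) * ennreal (B * D)"
      using t v'(1) y'(1) D(2) by (intro arg_cong2[where f="(+)"] ennreal_mult) auto
    finally show ?thesis by (simp only: distrib_right mult.assoc)
  qed
  finally show "(\<integral>\<^sup>+x. (max_op P z f x)\<^sup>2 \<partial>lborel) \<le> ennreal ((1 + t) * C + (1 + 1 / t) * (B * D)) * nsq f" .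
qed

lemma max_bound_reindex:
  assumes y: "max_bound P y C" and "countable P'" "\<And>p. p \<in> P' \<Longrightarrow> h p \<in> P"
    and "\<And>p. p \<in> P' \<Longrightarrow> y' p = y (h p)"
  shows "max_bound P' y' C"
  unfolding max_bound_def
proof (intro conjI ballI)
  note yD = max_boundD[OF y]
  show "0 \<le> C" "countable P'" by (fact yD assms)+
  show "bdd_mult (y' p)" if "p \<in> P'" for p using assms that yD by simp
  fix f assume f: "f \<in> L2"
  have "max_op P' y' f x \<le> max_op P y f x" for x
    unfolding max_op_def
    by (rule SUP_least) (auto simp: assms intro!: SUP_upper2[of "h _"])
  then have "(\<integral>\<^sup>+x. (max_op P' y' f x)\<^sup>2 \<partial>lborel) \<le> (\<integral>\<^sup>+x. (max_op P y f x)\<^sup>2 \<partial>lborel)"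
    by (intro nn_integral_mono power_mono) auto
  also have "\<dots> \<le> ennreal C * nsq f" by (rule yD(4)[OF f])
  finally show "(\<integral>\<^sup>+x. (max_op P' y' f x)\<^sup>2 \<partial>lborel) \<le> ennreal C * nsq f" .
qed

lemma max_bound_Un:
  assumes y: "max_bound P y C" and y': "max_bound P' y C'"
  shows "max_bound (P \<union> P') y (C + C')"
  unfolding max_bound_def
proof (intro conjI ballI)
  note yD = max_boundD[OF y] and yD' = max_boundD[OF y']
  show "0 \<le> C + C'" "countable (P \<union> P')" using yD yD' by auto
  show "bdd_mult (y p)" if "p \<in> P \<union> P'" for p using that yD yD' by blast
  fix f assume f: "f \<in> L2"
  note [measurable] = yD(5)[OF f] yD'(5)[OF f]
  have "(\<integral>\<^sup>+x. (max_op (P \<union> P') y f x)\<^sup>2 \<partial>lborel) \<le>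
    (\<integral>\<^sup>+x. (max_op P y f x)\<^sup>2 + (max_op P' y f x)\<^sup>2 \<partial>lborel)"
  proof (intro nn_integral_mono)
    fix x
    have "(max_op (P \<union> P') y f x)\<^sup>2 = (max (max_op P y f x) (max_op P' y f x))\<^sup>2"
      unfolding max_op_def by (simp add: SUP_union sup_max)
    also have "\<dots> \<le> (max_op P y f x)\<^sup>2 + (max_op P' y f x)\<^sup>2"
      by (auto simp: max_def add_increasing add_increasing2)
    finally show "(max_op (P \<union> P') y f x)\<^sup>2 \<le> (max_op P y f x)\<^sup>2 + (max_op P' y f x)\<^sup>2" .
  qed
  also have "\<dots> = (\<integral>\<^sup>+x. (max_op P y f x)\<^sup>2 \<partial>lborel) + (\<integral>\<^sup>+x. (max_op P' y f x)\<^sup>2 \<partial>lborel)"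
    by (rule nn_integral_add) measurable
  also have "\<dots> \<le> ennreal C * nsq f + ennreal C' * nsq f"
    by (intro add_mono yD(4) yD'(4) f)
  also have "\<dots> = ennreal (C + C') * nsq f"
    using yD(1) yD'(1) by (simp add: distrib_right)
  finally show "(\<integral>\<^sup>+x. (max_op (P \<union> P') y f x)\<^sup>2 \<partial>lborel) \<le> ennreal (C + C') * nsq f" .
qed

section \<open>Small and large scales\<close>

lemma countable_nat_Times: "countable J \<Longrightarrow> countable ((I :: nat set) \<times> J)"
  by (intro countable_SIGMA countableI_type)

lemma max_bound_zero: "countable P \<Longrightarrow> max_bound P (\<lambda>p \<xi>. 0) 0"
  unfolding max_bound_def
proof (intro conjI ballI)
  fix f :: "real \<times> real \<Rightarrow> complex" assume f: "f \<in> L2"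
  have "AE x in lborel. mult_op (\<lambda>\<xi>. \<Sum>i\<in>({} :: nat set). 1 * 0) f x = (\<Sum>i\<in>({} :: nat set). 1 * mult_op (\<lambda>\<xi>. 0) f x)"
    by (rule mult_op_sum[OF _ _ f]) auto
  then have "AE x in lborel. (max_op P (\<lambda>p \<xi>. 0) f x)\<^sup>2 = 0"
  proof eventually_elim
    fix x assume "mult_op (\<lambda>\<xi>. \<Sum>i\<in>({} :: nat set). 1 * 0) f x = (\<Sum>i\<in>({} :: nat set). 1 * mult_op (\<lambda>\<xi>. 0) f x)"
    then have "max_op P (\<lambda>p \<xi>. 0) f x \<le> 0"
      unfolding max_op_def by (intro SUP_least) simp
    then show "(max_op P (\<lambda>p \<xi>. 0) f x)\<^sup>2 = 0" by simp
  qed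
  then have "(\<integral>\<^sup>+x. (max_op P (\<lambda>p \<xi>. 0) f x)\<^sup>2 \<partial>lborel) = (\<integral>\<^sup>+x. 0 \<partial>(lborel :: (real \<times> real) measure))"
    by (rule nn_integral_cong_AE)
  then show "(\<integral>\<^sup>+x. (max_op P (\<lambda>p \<xi>. 0) f x)\<^sup>2 \<partial>lborel) \<le> ennreal 0 * nsq f" by simp
qed auto

lemma suminf_single_le:
  fixes a :: "nat \<Rightarrow> ennreal"
  assumes "\<And>i j. a i \<noteq> 0 \<Longrightarrow> a j \<noteq> 0 \<Longrightarrow> i = j" "\<And>i. a i \<le> c"
  shows "suminf a \<le> c"
proof (cases "\<exists>i. a i \<noteq> 0")
  case True
  then obtain i where "a i \<noteq> 0" ..
  with assms have "suminf a = sum a {i}" by (intro suminf_finite) auto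
  then show ?thesis using assms(2)[of i] by simp
next
  case False
  then have "a = (\<lambda>_. 0)" by auto
  then show ?thesis by simp
qed

text \<open>The Rademacher--Menshov argument: each doubling of the number of sets costs one square
  function. The exponent of \<open>2\<close> thus enters the bound for the norm linearly.\<close>

lemma max_bound_prefix_unions:
  fixes E :: "nat \<Rightarrow> (real \<times> real) set"
  assumes v: "max_bound J v B"
  shows "(\<And>i. E i \<in> sets borel) \<Longrightarrow> disjoint_family_on E {..<2 ^ K} \<Longrightarrow>
    max_bound ({..<2 ^ K} \<times> J) (\<lambda>(n, j) \<xi>. indicator (\<Union>i\<le>n. E i) \<xi> * v j \<xi>) (B * (real K + 2)\<^sup>2)"
proof (induction K arbitrary: E)
  case 0
  define w :: "nat \<Rightarrow> real \<times> real \<Rightarrow> complex" where "w i = (if i = 0 then indicator (E 0) else (\<lambda>_. 0))" for i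
  \<comment> \<open>The single set is treated as a perturbation of the zero family with t = 1; this
    costs 2 B, below the B * (0 + 2)^2 claimed.\<close>
  have "max_bound ({..<2 ^ 0} \<times> J) (\<lambda>(n, j) \<xi>. indicator (\<Union>i\<le>n. E i) \<xi> * v j \<xi>) ((1 + 1) * 0 + (1 + 1 / 1) * (B * 1))"
  proof (rule max_bound_perturb[OF v max_bound_zero, where w=w and i="\<lambda>_. 0" and j=snd])
    show "countable ({..<2 ^ 0 :: nat} \<times> J)" using max_boundD(2)[OF v] by (rule countable_nat_Times)
    show "bdd_mult (w i)" for i using 0 by (auto simp: w_def)
    show "(\<Sum>i. ennreal ((cmod (w i \<xi>))\<^sup>2)) \<le> ennreal 1" for \<xi>
      by (rule suminf_single_le) (auto simp: w_def indicator_def split: if_splits)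
  qed (auto simp: w_def)
  then show ?case
    by (rule max_bound_mono) (use max_boundD(1)[OF v] in \<open>simp add: power2_eq_square\<close>)
next
  case (Suc K)
  \<comment> \<open>Neighbouring sets are merged in pairs. A prefix ending at an odd index is a
    prefix of pairs; one ending at 2 m is the prefix of pairs up to m with
    \<open>E (2 * m + 1)\<close> removed. That correction is stored as \<open>w (m + 1)\<close>,
    while \<open>w 0\<close> is the zero correction for odd indices.\<close>
  define E' where "E' i = E (2 * i) \<union> E (2 * i + 1)" for i
  define w :: "nat \<Rightarrow> real \<times> real \<Rightarrow> complex" where
    "w i = (if i = 0 then (\<lambda>_. 0) else if i - 1 < 2 ^ K then (\<lambda>\<xi>. - indicator (E (2 * (i - 1) + 1)) \<xi>) else (\<lambda>_. 0))" for i
  have dis: "i = j" if "\<xi> \<in> E i" "\<xi> \<in> E j" "i < 2 ^ Suc K" "j < 2 ^ Suc K" for i j \<xi>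
    using Suc(3) that unfolding disjoint_family_on_def by blast
  have "disjoint_family_on E' {..<2 ^ K}"
    unfolding disjoint_family_on_def
  proof (intro ballI impI equals0I)
    fix i j \<xi> assume ij: "i \<in> {..<2 ^ K}" "j \<in> {..<2 ^ K}" "i \<noteq> j" "\<xi> \<in> E' i \<inter> E' j"
    then obtain b b' where b: "b \<le> 1" "b' \<le> 1" "\<xi> \<in> E (2 * i + b)" "\<xi> \<in> E (2 * j + b')"
      unfolding E'_def by (metis Int_iff Un_iff add_0_right le_numeral_extra(4) zero_le_one)
    then have "2 * i + b = 2 * j + b'" using ij by (intro dis[of \<xi>]) auto
    with b ij show False by presburger
  qed
  then have IH: "max_bound ({..<2 ^ K} \<times> J) (\<lambda>(n, j) \<xi>. indicator (\<Union>i\<le>n. E' i) \<xi> * v j \<xi>) (B * (real K + 2)\<^sup>2)"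
    by (rule Suc(1)[rotated]) (use Suc(2) in \<open>simp add: E'_def\<close>)
  have y: "max_bound ({..<2 ^ Suc K} \<times> J) (\<lambda>(n, j) \<xi>. indicator (\<Union>i\<le>n div 2. E' i) \<xi> * v j \<xi>) (B * (real K + 2)\<^sup>2)"
    by (rule max_bound_reindex[OF IH, where h="\<lambda>(n, j). (n div 2, j)"])
       (use max_boundD(2)[OF v] in \<open>auto intro!: countable_nat_Times\<close>)
  \<comment> \<open>The choice t = 1 / (K + 2) makes the recursion exact: (1 + t) (K + 2)^2 + (1 + 1
    / t) = (K + 2) (K + 3) + (K + 3) = (K + 3)^2.\<close>
  have "max_bound ({..<2 ^ Suc K} \<times> J) (\<lambda>(n, j) \<xi>. indicator (\<Union>i\<le>n. E i) \<xi> * v j \<xi>)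
    ((1 + 1 / (real K + 2)) * (B * (real K + 2)\<^sup>2) + (1 + 1 / (1 / (real K + 2))) * (B * 1))"
  proof (rule max_bound_perturb[OF v y, where w=w and i="\<lambda>(n, j). if even n then Suc (n div 2) else 0" and j=snd])
    show "bdd_mult (w i)" for i using Suc(2) by (auto simp: w_def)
    show "(\<Sum>i. ennreal ((cmod (w i \<xi>))\<^sup>2)) \<le> ennreal 1" for \<xi>
    proof (rule suminf_single_le)
      fix i j assume "ennreal ((cmod (w i \<xi>))\<^sup>2) \<noteq> 0" "ennreal ((cmod (w j \<xi>))\<^sup>2) \<noteq> 0"
      then have *: "i \<noteq> 0" "j \<noteq> 0" "i - 1 < 2 ^ K" "j - 1 < 2 ^ K" "\<xi> \<in> E (2 * (i - 1) + 1)" "\<xi> \<in> E (2 * (j - 1) + 1)"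
        by (auto simp: w_def indicator_def split: if_splits)
      then have "2 * (i - 1) + 1 = 2 * (j - 1) + 1" by (intro dis[of \<xi>]) auto
      with * show "i = j" by simp
    qed (auto simp: w_def indicator_def)
    show "(case p of (n, j) \<Rightarrow> \<lambda>\<xi>. indicator (\<Union>i\<le>n. E i) \<xi> * v j \<xi>) \<xi> =
      (case p of (n, j) \<Rightarrow> \<lambda>\<xi>. indicator (\<Union>i\<le>n div 2. E' i) \<xi> * v j \<xi>) \<xi> +
      v (snd p) \<xi> * w (case p of (n, j) \<Rightarrow> if even n then Suc (n div 2) else 0) \<xi>"
      if p: "p \<in> {..<2 ^ Suc K} \<times> J" for p \<xi>
    proof -
      obtain n j where p: "p = (n, j)" "n < 2 ^ Suc K" using p by auto
      define m where "m = n div 2"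
      have m: "m < 2 ^ K" using p by (simp add: m_def)
      have split: "(\<Union>i\<le>m. E' i) = (\<Union>i\<le>2 * m + 1. E i)"
      proof (intro equalityI subsetI)
        fix \<xi> assume "\<xi> \<in> (\<Union>i\<le>m. E' i)"
        then obtain i where "i \<le> m" "\<xi> \<in> E (2 * i) \<or> \<xi> \<in> E (2 * i + 1)" by (auto simp: E'_def)
        then show "\<xi> \<in> (\<Union>i\<le>2 * m + 1. E i)"
          using UN_I[of "2 * i" "{..2 * m + 1}" \<xi> E] UN_I[of "2 * i + 1" "{..2 * m + 1}" \<xi> E] by auto
      next
        fix \<xi> assume "\<xi> \<in> (\<Union>i\<le>2 * m + 1. E i)"
        then obtain i where i: "i \<le> 2 * m + 1" "\<xi> \<in> E i" by auto
        have "\<xi> \<in> E' (i div 2)" using i unfolding E'_def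
          by (cases "even i") (auto elim!: evenE oddE)
        moreover have "i div 2 \<le> m" using i by simp
        ultimately show "\<xi> \<in> (\<Union>i\<le>m. E' i)" by auto
      qed
      show ?thesis
      proof (cases "even n")
        case True
        then have n: "n = 2 * m" by (simp add: m_def)
        have "(\<Union>i\<le>2 * m + 1. E i) = (\<Union>i\<le>n. E i) \<union> E (2 * m + 1)"
          unfolding n by (simp add: atMost_Suc Un_commute)
        moreover have "\<xi> \<notin> E (2 * m + 1)" if "\<xi> \<in> (\<Union>i\<le>n. E i)"
        proof
          assume e: "\<xi> \<in> E (2 * m + 1)"
          obtain i where i: "i \<le> 2 * m" "\<xi> \<in> E i" using \<open>\<xi> \<in> (\<Union>i\<le>n. E i)\<close> n by auto
          then have "i = 2 * m + 1" using e m by (intro dis[of \<xi>]) auto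
          then show False using i by simp
        qed
        ultimately have ind: "indicator (\<Union>i\<le>n. E i) \<xi> = (indicator (\<Union>i\<le>m. E' i) \<xi> - indicator (E (2 * m + 1)) \<xi> :: complex)"
          unfolding split by (auto simp: indicator_def)
        have "indicator (\<Union>i\<le>n. E i) \<xi> * v j \<xi> = indicator (\<Union>i\<le>m. E' i) \<xi> * v j \<xi> + v j \<xi> * w (Suc m) \<xi>"
          unfolding ind using m by (simp add: w_def algebra_simps)
        then show ?thesis
          unfolding p prod.case snd_conv m_def[symmetric] by (simp only: True if_True)
      next
        case False
        then have n: "n = 2 * m + 1" by (simp add: m_def)
        show ?thesis using False unfolding p prod.case m_def[symmetric] split n[symmetric] by (simp add: w_def)
      qed
    qed
  qed auto
  then show ?case
  proof (rule max_bound_mono)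
    have "(1 + 1 / (real K + 2)) * (B * (real K + 2)\<^sup>2) + (1 + 1 / (1 / (real K + 2))) * (B * 1) = B * (real K + 3)\<^sup>2"
      by (simp add: power2_eq_square field_simps)
    also have "\<dots> = B * (real (Suc K) + 2)\<^sup>2" by simp
    finally show "(1 + 1 / (real K + 2)) * (B * (real K + 2)\<^sup>2) + (1 + 1 / (1 / (real K + 2))) * (B * 1) \<le> B * (real (Suc K) + 2)\<^sup>2"
      by simp
  qed
qed

text \<open>Read from the smallest set upwards, a decreasing sequence consists of prefix unions of
  the disjoint differences of consecutive sets; hence the reversal of the index.\<close>

lemma max_bound_decreasing:
  fixes S :: "nat \<Rightarrow> (real \<times> real) set"
  assumes v: "max_bound J v B" and S: "\<And>n. S n \<in> sets borel" and dec: "\<And>m n. m \<le> n \<Longrightarrow> S n \<subseteq> S m"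
  shows "max_bound ({..<2 ^ K} \<times> J) (\<lambda>(n, j) \<xi>. indicator (S n) \<xi> * v j \<xi>) (B * (real K + 2)\<^sup>2)"
proof -
  let ?L = "2 ^ K - 1 :: nat"
  define E where "E i = (if i = 0 then S ?L else S (?L - i) - S (?L - i + 1))" for i
  have inE: "\<xi> \<in> S (?L - i)" if "\<xi> \<in> E i" for \<xi> i using that by (auto simp: E_def split: if_splits)
  have aux: False if "\<xi> \<in> E i" "\<xi> \<in> E j" "i < j" "j \<le> ?L" for \<xi> i j
  proof -
    have "\<xi> \<notin> S (?L - j + 1)" using that by (auto simp: E_def)
    moreover have "S (?L - i) \<subseteq> S (?L - j + 1)" using that by (intro dec) auto
    ultimately show False using inE[OF that(1)] by blast
  qed
  have dis: "disjoint_family_on E {..<2 ^ K}"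
    unfolding disjoint_family_on_def
  proof (intro ballI impI equals0I)
    fix i j \<xi> assume ij: "i \<in> {..<2 ^ K}" "j \<in> {..<2 ^ K}" "i \<noteq> j" "\<xi> \<in> E i \<inter> E j"
    then have "i \<le> ?L" "j \<le> ?L" by simp_all
    with ij show False using aux[of \<xi> i j] aux[of \<xi> j i] by (metis Int_iff nat_neq_iff)
  qed
  have un: "(\<Union>i\<le>m. E i) = S (?L - m)" if "m \<le> ?L" for m
    using that
  proof (induction m)
    case (Suc m)
    have "(\<Union>i\<le>Suc m. E i) = S (?L - m) \<union> (S (?L - Suc m) - S (?L - m))"
      using Suc by (simp add: atMost_Suc E_def Suc_diff_Suc Un_commute)
    also have "\<dots> = S (?L - Suc m)" using dec[OF diff_le_mono2[of m "Suc m" ?L]] by auto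
    finally show ?case .
  qed (simp add: E_def)
  have "max_bound ({..<2 ^ K} \<times> J) (\<lambda>(n, j) \<xi>. indicator (\<Union>i\<le>n. E i) \<xi> * v j \<xi>) (B * (real K + 2)\<^sup>2)"
    by (rule max_bound_prefix_unions[OF v _ dis]) (auto simp: E_def S)
  then show ?thesis
  proof (rule max_bound_reindex[where h="\<lambda>(n, j). (?L - n, j)"])
    show "countable ({..<2 ^ K :: nat} \<times> J)" using max_boundD(2)[OF v] by (rule countable_nat_Times)
    fix p assume p: "p \<in> {..<2 ^ K :: nat} \<times> J"
    then obtain n j where nj: "p = (n, j)" "n \<le> ?L" "j \<in> J" by auto
    show "(case p of (n, j) \<Rightarrow> (?L - n, j)) \<in> {..<2 ^ K} \<times> J" using nj by (simp add: less_imp_diff_less)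
    show "(case p of (n, j) \<Rightarrow> \<lambda>\<xi>. indicator (S n) \<xi> * v j \<xi>) =
      (case case p of (n, j) \<Rightarrow> (?L - n, j) of (n, j) \<Rightarrow> \<lambda>\<xi>. indicator (\<Union>i\<le>n. E i) \<xi> * v j \<xi>)"
      unfolding nj prod.case by (simp only: un[OF diff_le_self] diff_diff_cancel[OF nj(2)])
  qed
qed

section \<open>Averages of translations as multipliers\<close>

definition avg_mult :: "real \<times> real \<Rightarrow> nat \<Rightarrow> real \<times> real \<Rightarrow> complex" where
  "avg_mult a M \<xi> = (\<Sum>k<M. char2 \<xi> (real k *\<^sub>R a)) / of_nat M"

lemma bdd_mult_avg [intro]: "bdd_mult (avg_mult a M)"
proof -
  have "bdd_mult (\<lambda>\<xi>. (1 / of_nat M) * (\<Sum>k<M. char2 \<xi> (real k *\<^sub>R a)))"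
    by (intro bdd_mult_mult bdd_mult_const bdd_mult_sum bdd_mult_character)
  then show ?thesis unfolding avg_mult_def[abs_def] by simp
qed

lemma mult_op_avg:
  assumes v: "bdd_mult v" and S: "bdd_mult s" and f: "f \<in> L2"
  shows "AE x in lborel. mult_op (\<lambda>\<xi>. avg_mult a M \<xi> * (v \<xi> * s \<xi>)) f x =
     (\<Sum>k<M. mult_op v (mult_op s f) (x - real k *\<^sub>R a)) / of_nat M"
proof -
  let ?e = "\<lambda>k \<xi>. char2 \<xi> (real k *\<^sub>R a)"
  have b: "bdd_mult (\<lambda>\<xi>. ?e k \<xi> * v \<xi>)" for k by (intro bdd_mult_mult bdd_mult_character v)
  have "AE x in lborel. mult_op (\<lambda>\<xi>. \<Sum>k<M. (1 / of_nat M) * ((?e k \<xi> * v \<xi>) * s \<xi>)) f x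
    = (\<Sum>k<M. (1 / of_nat M) * mult_op (\<lambda>\<xi>. (?e k \<xi> * v \<xi>) * s \<xi>) f x)"
    by (rule mult_op_sum[OF _ _ f]) (intro finite_lessThan bdd_mult_mult bdd_mult_character v S)+
  moreover have "AE x in lborel. \<forall>k\<in>{..<M}. mult_op (\<lambda>\<xi>. (?e k \<xi> * v \<xi>) * s \<xi>) f x = mult_op v (mult_op s f) (x - real k *\<^sub>R a)"
  proof (rule AE_ball_countable'[OF _ countable_finite[OF finite_lessThan]])
    fix k
    show "AE x in lborel. mult_op (\<lambda>\<xi>. (?e k \<xi> * v \<xi>) * s \<xi>) f x = mult_op v (mult_op s f) (x - real k *\<^sub>R a)"
      using mult_op_compose[OF b[of k] S f] mult_op_translate[OF v mult_op_L2[OF S f], of "real k *\<^sub>R a"]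
      by eventually_elim (simp only:)
  qed
  moreover have "(\<lambda>\<xi>. \<Sum>k<M. (1 / of_nat M) * ((?e k \<xi> * v \<xi>) * s \<xi>)) = (\<lambda>\<xi>. avg_mult a M \<xi> * (v \<xi> * s \<xi>))"
    by (intro ext) (simp add: avg_mult_def sum_divide_distrib sum_distrib_right mult.assoc)
  ultimately have "AE x in lborel. mult_op (\<lambda>\<xi>. avg_mult a M \<xi> * (v \<xi> * s \<xi>)) f x
      = (\<Sum>k<M. (1 / of_nat M) * mult_op (\<lambda>\<xi>. (?e k \<xi> * v \<xi>) * s \<xi>) f x)
    \<and> (\<forall>k\<in>{..<M}. mult_op (\<lambda>\<xi>. (?e k \<xi> * v \<xi>) * s \<xi>) f x = mult_op v (mult_op s f) (x - real k *\<^sub>R a))"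
    by (simp only: AE_conj_iff)
  then show ?thesis
  proof eventually_elim
    fix x assume *: "mult_op (\<lambda>\<xi>. avg_mult a M \<xi> * (v \<xi> * s \<xi>)) f x
      = (\<Sum>k<M. (1 / of_nat M) * mult_op (\<lambda>\<xi>. (?e k \<xi> * v \<xi>) * s \<xi>) f x)
      \<and> (\<forall>k\<in>{..<M}. mult_op (\<lambda>\<xi>. (?e k \<xi> * v \<xi>) * s \<xi>) f x = mult_op v (mult_op s f) (x - real k *\<^sub>R a))"
    have "(\<Sum>k<M. (1 / of_nat M) * mult_op (\<lambda>\<xi>. (?e k \<xi> * v \<xi>) * s \<xi>) f x)
      = (\<Sum>k<M. (1 / of_nat M) * mult_op v (mult_op s f) (x - real k *\<^sub>R a))"
      by (intro sum.cong refl arg_cong2[where f="(*)"]) (use * in blast)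
    with conjunct1[OF *] show "mult_op (\<lambda>\<xi>. avg_mult a M \<xi> * (v \<xi> * s \<xi>)) f x =
      (\<Sum>k<M. mult_op v (mult_op s f) (x - real k *\<^sub>R a)) / of_nat M"
      by (simp only: sum_distrib_left[symmetric]) simp
  qed
qed

text \<open>The supremum over \<open>j\<close> is taken before averaging: each averaged operator is
  dominated pointwise by the average of the single function \<open>g = max_op J v h\<close>. So
  \<open>maximal_average_L2\<close> applies once, with its constant 4, and the cutoff to
  \<open>S\<close> only decreases the norm.\<close>

lemma max_bound_averages:
  fixes M :: "nat \<Rightarrow> nat"
  assumes v: "max_bound J v B" and S: "S \<in> sets borel" and M: "\<And>n. M n \<ge> 1"
  shows "max_bound (I \<times> J) (\<lambda>(n, j) \<xi>. avg_mult a (M n) \<xi> * (v j \<xi> * indicator S \<xi>)) (4 * B)"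
  unfolding max_bound_def
proof (intro conjI ballI)
  note vD = max_boundD[OF v]
  let ?y = "\<lambda>(n, j) \<xi>. avg_mult a (M n) \<xi> * (v j \<xi> * indicator S \<xi>)"
  show "0 \<le> 4 * B" "countable (I \<times> J)" using vD by (auto intro!: countable_nat_Times)
  show "bdd_mult (?y p)" if "p \<in> I \<times> J" for p
    using that vD S by (auto intro!: bdd_mult_mult bdd_mult_avg bdd_mult_indicator)
  fix f assume f: "f \<in> L2"
  define h where "h = mult_op (indicator S) f"
  have hL: "h \<in> L2" unfolding h_def using S by (intro mult_op_L2 f bdd_mult_indicator)
  define g where "g = max_op J v h"
  have [measurable]: "g \<in> borel_measurable borel" unfolding g_def by (rule vD(5)[OF hL])
  have AE: "AE x in lborel. \<forall>p\<in>I \<times> J. mult_op (?y p) f x = (\<Sum>k<M (fst p). mult_op (v (snd p)) h (x - real k *\<^sub>R a)) / of_nat (M (fst p))"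
  proof (rule AE_ball_countable')
    show "countable (I \<times> J)" using vD by (auto intro!: countable_nat_Times)
    show "AE x in lborel. mult_op (?y p) f x = (\<Sum>k<M (fst p). mult_op (v (snd p)) h (x - real k *\<^sub>R a)) / of_nat (M (fst p))"
      if "p \<in> I \<times> J" for p
      using that mult_op_avg[OF vD(3)[of "snd p"] bdd_mult_indicator[OF S] f, of a "M (fst p)"]
      by (auto simp: h_def split_beta)
  qed
  have "(\<integral>\<^sup>+x. (max_op (I \<times> J) ?y f x)\<^sup>2 \<partial>lborel) \<le>
    (\<integral>\<^sup>+x. (SUP m\<in>{1..}. (\<Sum>k<m. g (x - real k *\<^sub>R a)) / of_nat m)\<^sup>2 \<partial>lborel)"
  proof (rule nn_integral_mono_AE)
    show "AE x in lborel. (max_op (I \<times> J) ?y f x)\<^sup>2 \<le> (SUP m\<in>{1..}. (\<Sum>k<m. g (x - real k *\<^sub>R a)) / of_nat m)\<^sup>2"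
      using AE
    proof eventually_elim
      fix x assume eq: "\<forall>p\<in>I \<times> J. mult_op (?y p) f x = (\<Sum>k<M (fst p). mult_op (v (snd p)) h (x - real k *\<^sub>R a)) / of_nat (M (fst p))"
      have "max_op (I \<times> J) ?y f x \<le> (SUP m\<in>{1..}. (\<Sum>k<m. g (x - real k *\<^sub>R a)) / of_nat m)"
        unfolding max_op_def[of "I \<times> J"]
      proof (rule SUP_least)
        fix p assume p: "p \<in> I \<times> J"
        let ?m = "M (fst p)"
        have "cmod (mult_op (?y p) f x) \<le> (\<Sum>k<?m. cmod (mult_op (v (snd p)) h (x - real k *\<^sub>R a))) / real ?m"
          using eq p by (auto simp: norm_divide intro!: divide_right_mono norm_sum)
        then have "ennreal (cmod (mult_op (?y p) f x)) \<le> ennreal ((\<Sum>k<?m. cmod (mult_op (v (snd p)) h (x - real k *\<^sub>R a))) / real ?m)"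
          by (rule ennreal_leI)
        also have "\<dots> = (\<Sum>k<?m. ennreal (cmod (mult_op (v (snd p)) h (x - real k *\<^sub>R a)))) / of_nat ?m"
          using M[of "fst p"] by (simp add: divide_ennreal[symmetric] sum_nonneg ennreal_of_nat_eq_real_of_nat)
        also have "\<dots> \<le> (\<Sum>k<?m. g (x - real k *\<^sub>R a)) / of_nat ?m"
          unfolding g_def max_op_def using p
          by (intro divide_right_mono_ennreal sum_mono SUP_upper) auto
        also have "\<dots> \<le> (SUP m\<in>{1..}. (\<Sum>k<m. g (x - real k *\<^sub>R a)) / of_nat m)"
          using M by (intro SUP_upper) auto
        finally show "ennreal (cmod (mult_op (?y p) f x)) \<le> (SUP m\<in>{1..}. (\<Sum>k<m. g (x - real k *\<^sub>R a)) / of_nat m)" .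
      qed
      then show "(max_op (I \<times> J) ?y f x)\<^sup>2 \<le> (SUP m\<in>{1..}. (\<Sum>k<m. g (x - real k *\<^sub>R a)) / of_nat m)\<^sup>2"
        by (rule power_mono) simp
    qed
  qed
  also have "\<dots> \<le> 4 * (\<integral>\<^sup>+x. (g x)\<^sup>2 \<partial>lborel)"
    by (rule maximal_average_L2) measurable
  also have "\<dots> \<le> 4 * (ennreal B * nsq h)"
    unfolding g_def by (intro mult_left_mono vD(4) hL) auto
  also have "\<dots> \<le> 4 * (ennreal B * nsq f)"
  proof (intro mult_left_mono)
    have "nsq h = nsq (\<lambda>\<xi>. indicator S \<xi> * fourier f \<xi>)"
      unfolding h_def by (intro nsq_mult_op bdd_mult_indicator S f)
    also have "\<dots> \<le> nsq (fourier f)"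
      unfolding nsq_def by (intro nn_integral_mono) (auto simp: indicator_def)
    finally show "nsq h \<le> nsq f" by (simp add: plancherel f)
  qed auto
  also have "\<dots> = ennreal (4 * B) * nsq f"
    using vD(1) by (simp add: ennreal_mult mult.assoc)
  finally show "(\<integral>\<^sup>+x. (max_op (I \<times> J) ?y f x)\<^sup>2 \<partial>lborel) \<le> ennreal (4 * B) * nsq f" .
qed

text \<open>On \<open>S N\<close> the cutoff to \<open>S n\<close> is the average multiplier plus an
  error \<open>w n\<close>, and the errors are square summable by \<open>cutoff_square_sum\<close>.
  The assumption \<open>local\<close> says that near each frequency both multipliers depend only on
  the displacement \<eta>, through formulas common to all frequencies. With t = 1 the constant is 2
  * 4 + 2 * 54 = 116.\<close>

lemma max_bound_large_scales:
  fixes Q :: real and a :: "real \<times> real" and S :: "nat \<Rightarrow> (real \<times> real) set"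
  assumes v: "max_bound J v B" and S: "\<And>n. S n \<in> sets borel" and sub: "\<And>n. N \<le> n \<Longrightarrow> S n \<subseteq> S N"
    and Q: "0 < Q" "Q \<le> 2 ^ N" "2 ^ N \<le> 2 * Q"
    and local: "\<And>\<xi>. \<xi> \<in> S N \<Longrightarrow> \<exists>\<eta>. \<bar>\<eta>\<bar> < 1 / 2 ^ (N + 1) \<and>
      char2 \<xi> a = iexp (- (2 * pi * (Q * \<eta>))) \<and>
      (\<forall>n\<ge>N. \<xi> \<in> S n \<longleftrightarrow> \<bar>\<eta>\<bar> < 1 / 2 ^ (n + 1))"
  shows "max_bound ({N..} \<times> J) (\<lambda>(n, j) \<xi>. indicator (S n) \<xi> * v j \<xi>) (116 * B)"
proof -
  let ?M = "\<lambda>n. 2 ^ (n - N) :: nat"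
  define w :: "nat \<Rightarrow> real \<times> real \<Rightarrow> complex" where
    "w n \<xi> = (if N \<le> n then indicator (S n) \<xi> - avg_mult a (?M n) \<xi> else 0) * indicator (S N) \<xi>" for n \<xi>
  have y: "max_bound ({N..} \<times> J) (\<lambda>(n, j) \<xi>. avg_mult a (?M n) \<xi> * (v j \<xi> * indicator (S N) \<xi>)) (4 * B)"
    by (rule max_bound_averages[OF v S]) simp
  have "max_bound ({N..} \<times> J) (\<lambda>(n, j) \<xi>. indicator (S n) \<xi> * v j \<xi>) ((1 + 1) * (4 * B) + (1 + 1 / 1) * (B * 54))"
  proof (rule max_bound_perturb[OF v y, where w=w and i=fst and j=snd])
    show "bdd_mult (w i)" for i
    proof (cases "N \<le> i")
      case True
      then show ?thesis unfolding w_def[abs_def]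
        using S by (auto intro!: bdd_mult_mult bdd_mult_diff bdd_mult_indicator bdd_mult_avg)
    qed (simp add: w_def[abs_def])
    show "(\<Sum>i. ennreal ((cmod (w i \<xi>))\<^sup>2)) \<le> ennreal 54" for \<xi>
    proof (cases "\<xi> \<in> S N")
      case True
      from local[OF this] obtain \<eta> where \<eta>: "\<bar>\<eta>\<bar> < 1 / 2 ^ (N + 1)"
        "char2 \<xi> a = iexp (- (2 * pi * (Q * \<eta>)))"
        "\<And>n. n \<ge> N \<Longrightarrow> \<xi> \<in> S n \<longleftrightarrow> \<bar>\<eta>\<bar> < 1 / 2 ^ (n + 1)" by blast
      have "char2 \<xi> (real k *\<^sub>R a) = iexp (- (2 * pi * (Q * \<eta>))) ^ k" for k
      proof -
        have "char2 \<xi> (real k *\<^sub>R a) = char2 \<xi> a ^ k"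
          by (simp add: exp_of_nat_mult[symmetric] mult_ac)
        then show ?thesis unfolding \<eta>(2) .
      qed
      then have "w n \<xi> = (if N \<le> n then of_bool (\<bar>\<eta>\<bar> < 1 / 2 ^ (n + 1)) - (\<Sum>k<?M n. iexp (- (2 * pi * (Q * \<eta>))) ^ k) / of_nat (?M n) else 0)" for n
        using True \<eta>(3)[of n] by (simp add: w_def avg_mult_def indicator_def)
      then show ?thesis using cutoff_square_sum[OF Q \<eta>(1)] by simp
    qed (simp add: w_def)
    show "(case p of (n, j) \<Rightarrow> \<lambda>\<xi>. indicator (S n) \<xi> * v j \<xi>) \<xi> =
      (case p of (n, j) \<Rightarrow> \<lambda>\<xi>. avg_mult a (?M n) \<xi> * (v j \<xi> * indicator (S N) \<xi>)) \<xi> + v (snd p) \<xi> * w (fst p) \<xi>"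
      if "p \<in> {N..} \<times> J" for p \<xi>
      using that sub[of "fst p"] by (cases p) (auto simp: w_def indicator_def algebra_simps)
  qed auto
  then show ?thesis by simp
qed

lemma max_bound_all_scales:
  fixes Q :: real and a :: "real \<times> real" and S :: "nat \<Rightarrow> (real \<times> real) set"
  assumes v: "max_bound J v B" and S: "\<And>n. S n \<in> sets borel" and dec: "\<And>m n. m \<le> n \<Longrightarrow> S n \<subseteq> S m"
    and Q: "0 < Q" "Q \<le> 2 ^ N" "2 ^ N \<le> 2 * Q" and K: "N \<le> 2 ^ K"
    and local: "\<And>\<xi>. \<xi> \<in> S N \<Longrightarrow> \<exists>\<eta>. \<bar>\<eta>\<bar> < 1 / 2 ^ (N + 1) \<and>
      char2 \<xi> a = iexp (- (2 * pi * (Q * \<eta>))) \<and>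
      (\<forall>n\<ge>N. \<xi> \<in> S n \<longleftrightarrow> \<bar>\<eta>\<bar> < 1 / 2 ^ (n + 1))"
  shows "max_bound (UNIV \<times> J) (\<lambda>(n, j) \<xi>. indicator (S n) \<xi> * v j \<xi>) (B * (30 * (real K + 2)\<^sup>2))"
proof -
  have "max_bound ({..<2 ^ K} \<times> J \<union> {N..} \<times> J) (\<lambda>(n, j) \<xi>. indicator (S n) \<xi> * v j \<xi>) (B * (real K + 2)\<^sup>2 + 116 * B)"
    by (intro max_bound_Un max_bound_decreasing[OF v S dec] max_bound_large_scales[OF v S dec Q local])
  moreover have "{..<2 ^ K} \<times> J \<union> {N..} \<times> J = UNIV \<times> J"
    using K by (auto simp: not_less)
  \<comment> \<open>Since (K + 2)^2 >= 4, the term 116 is at most 29 (K + 2)^2.\<close>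
  moreover have "B * (real K + 2)\<^sup>2 + 116 * B \<le> B * (30 * (real K + 2)\<^sup>2)"
  proof -
    have "2\<^sup>2 \<le> (real K + 2)\<^sup>2" by (intro power_mono) auto
    then have "B * ((real K + 2)\<^sup>2 + 116) \<le> B * (30 * (real K + 2)\<^sup>2)"
      using max_boundD(1)[OF v] by (intro mult_left_mono) auto
    then show ?thesis by (simp add: algebra_simps)
  qed
  ultimately show ?thesis by (auto intro: max_bound_mono)
qed

section \<open>Separated frequencies\<close>

lemma mem_R_iff: "\<xi> \<in> R l n1 n2 \<longleftrightarrow> \<bar>fst \<xi> - fst l\<bar> < 1 / 2 ^ (n1 + 1) \<and> \<bar>snd \<xi> - snd l\<bar> < 1 / 2 ^ (n2 + 1)"
proof -
  have "\<xi> \<in> R l n1 n2 \<longleftrightarrow> \<xi> - l \<in> A n1 \<times> A n2"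
    unfolding R_def by (auto simp: image_iff) (metis add_diff_cancel_left' diff_add_cancel add.commute)+
  also have "\<dots> \<longleftrightarrow> \<bar>fst \<xi> - fst l\<bar> < 1 / 2 ^ (n1 + 1) \<and> \<bar>snd \<xi> - snd l\<bar> < 1 / 2 ^ (n2 + 1)"
    by (simp only: mem_Times_iff A_def greaterThanLessThan_iff fst_diff snd_diff abs_less_iff) auto
  finally show ?thesis .
qed

lemma R_borel: "R l n1 n2 \<in> sets borel"
proof -
  have "R l n1 n2 = {\<xi>. \<bar>fst \<xi> - fst l\<bar> < 1 / 2 ^ (n1 + 1) \<and> \<bar>snd \<xi> - snd l\<bar> < 1 / 2 ^ (n2 + 1)}"
    by (auto simp only: mem_R_iff mem_Collect_eq)
  also have "\<dots> = {\<xi>. \<bar>fst \<xi> - fst l\<bar> < 1 / 2 ^ (n1 + 1)} \<inter> {\<xi>. \<bar>snd \<xi> - snd l\<bar> < 1 / 2 ^ (n2 + 1)}"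
    by auto
  also have "open \<dots>"
    by (intro open_Int open_Collect_less continuous_intros)
  finally show ?thesis by simp
qed

lemma R_mono:
  assumes "m1 \<le> n1" "m2 \<le> n2" shows "R l n1 n2 \<subseteq> R l m1 m2"
proof
  have le: "1 / 2 ^ (n + 1) \<le> (1 / 2 ^ (m + 1) :: real)" if "m \<le> n" for m n :: nat
    using that by (intro divide_left_mono power_increasing) auto
  fix \<xi> assume "\<xi> \<in> R l n1 n2"
  then show "\<xi> \<in> R l m1 m2"
    unfolding mem_R_iff using le[OF assms(1)] le[OF assms(2)] by linarith
qed

lemma exp_2pi_int: "exp (- 2 * pi * \<i> * of_real (of_int k)) = 1"
  unfolding exp_eq_1 by (auto intro!: exI[of _ "- k"])

text \<open>This is where the lattice enters: for integral Q t the character of a shift by Q sees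
  only the distance from t, so all frequencies look alike.\<close>

lemma exp_periodic_cong:
  assumes "Q * t = of_int k"
  shows "exp (- 2 * pi * \<i> * of_real (s * Q)) = iexp (- (2 * pi * (Q * (s - t))))"
proof -
  have "s * Q = Q * (s - t) + of_int k" using assms by (simp add: algebra_simps)
  then have "exp (- 2 * pi * \<i> * of_real (s * Q)) =
      exp (- 2 * pi * \<i> * of_real (Q * (s - t))) * exp (- 2 * pi * \<i> * of_real (of_int k))"
    by (simp add: mult_exp_exp algebra_simps)
  also have "\<dots> = iexp (- (2 * pi * (Q * (s - t))))"
    unfolding exp_2pi_int by (simp add: mult_ac)
  finally show ?thesis .
qed

section \<open>Dyadic exponents and the double logarithm\<close>

lemma dyadic_exponent_exists:
  assumes "Q \<ge> (1 :: nat)"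
  obtains N where "Q \<le> 2 ^ N" "N = 0 \<or> 2 ^ (N - 1) < Q"
proof -
  define N where "N = (LEAST N. Q \<le> 2 ^ N)"
  have ex: "Q \<le> 2 ^ Q" using less_exp[of Q] by simp
  show ?thesis
  proof (rule that)
    show "Q \<le> 2 ^ N" unfolding N_def by (rule LeastI[of "\<lambda>N. Q \<le> 2 ^ N", OF ex])
    show "N = 0 \<or> 2 ^ (N - 1) < Q"
    proof (cases "N = 0")
      case False
      then have "N - 1 < (LEAST N. Q \<le> 2 ^ N)" unfolding N_def[symmetric] by simp
      then have "\<not> Q \<le> 2 ^ (N - 1)" by (rule not_less_Least)
      then show ?thesis by (simp add: not_le)
    qed simp
  qed
qed

text \<open>\<open>loglog\<close> drops from 1 to values near 0 just above \<open>exp 1\<close>, so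
  positivity alone gives no uniform bound. But Q sqrt c is the square root of the natural number Q^2
  c, and e^2 lies between 7 and 8; arguments beyond \<open>exp 1\<close> are therefore at least
  \<open>sqrt 8\<close>.\<close>

lemma loglog_lower_bounds:
  obtains \<delta> where "0 < \<delta>" "\<delta> \<le> 1" "\<And>Q c :: nat. Q \<ge> 1 \<Longrightarrow> c \<ge> 1 \<Longrightarrow> \<delta> \<le> loglog (real Q * sqrt (real c))"
proof
  let ?\<delta> = "min 1 (ln (ln (sqrt 8)))"
  have e7: "exp 1 > (265 / 100 :: real)" using e_approx_32 by (simp add: abs_if split: if_splits)
  have "(272 / 100)\<^sup>2 < (8 :: real)" by (simp add: power2_eq_square)
  then have "272 / 100 < sqrt (8 :: real)" by (rule real_less_rsqrt)
  with e_less_272 have e8: "exp 1 < sqrt 8" by (rule order.strict_trans)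
  have "ln (exp 1) < ln (sqrt 8)" using e8 by (intro ln_less_cancel_iff[THEN iffD2]) auto
  then have "1 < ln (sqrt 8)" by simp
  then show "0 < ?\<delta>" by simp
  show "?\<delta> \<le> 1" by simp
  fix Q c :: nat assume "Q \<ge> 1" "c \<ge> 1"
  show "?\<delta> \<le> loglog (real Q * sqrt (real c))"
  proof (cases "real Q * sqrt (real c) > exp 1")
    case True
    have "(265 / 100)\<^sup>2 < (real Q * sqrt (real c))\<^sup>2"
      using True e7 by (intro power_strict_mono) auto
    also have "\<dots> = real (Q\<^sup>2 * c)" by (simp add: power_mult_distrib)
    finally have "real (Q\<^sup>2 * c) > real 7" by (simp add: power2_eq_square)
    then have "Q\<^sup>2 * c > 7" by (simp only: of_nat_less_iff)
    then have "8 \<le> real (Q\<^sup>2 * c)" by linarith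
    then have "sqrt 8 \<le> sqrt (real (Q\<^sup>2 * c))" by (rule real_sqrt_le_mono)
    also have "\<dots> = real Q * sqrt (real c)" by (simp add: real_sqrt_mult)
    finally have "ln (ln (sqrt 8)) \<le> ln (ln (real Q * sqrt (real c)))"
      using \<open>1 < ln (sqrt 8)\<close> by (intro ln_mono) (auto intro: ln_mono order.strict_trans2)
    then show ?thesis using True by (simp add: loglog_def)
  qed (simp add: loglog_def)
qed

text \<open>\<open>K\<close> is about the double logarithm of Q to base 2, and c >= 1 gives Q <= Q
  sqrt c. For K <= 3 the uniform lower bound \<delta> suffices. From K = 4 on, Q > 2^(N - 1), N - 1
  >= 2^(K - 2) and ln 2 >= 2/3 bound the double logarithm below by 2/3 (K - 2) - 1/2, and 8 times
  this is at least K + 2.\<close>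

lemma dyadic_exponent_le_loglog:
  obtains C where "C > 0" "\<And>(Q :: nat) (c :: nat) N K. Q \<ge> 1 \<Longrightarrow> c \<ge> 1 \<Longrightarrow> N = 0 \<or> 2 ^ (N - 1) < Q \<Longrightarrow>
    K = 0 \<or> 2 ^ (K - 1) < N \<Longrightarrow> real K + 2 \<le> C * loglog (real Q * sqrt (real c))"
proof -
  obtain \<delta> where \<delta>: "0 < \<delta>" "\<delta> \<le> 1" "\<And>Q c :: nat. Q \<ge> 1 \<Longrightarrow> c \<ge> 1 \<Longrightarrow> \<delta> \<le> loglog (real Q * sqrt (real c))"
    using loglog_lower_bounds by blast
  have "real K + 2 \<le> (8 / \<delta>) * loglog (real Q * sqrt (real c))"
    if "Q \<ge> 1" "c \<ge> 1" and N: "N = 0 \<or> 2 ^ (N - 1) < Q" and K: "K = 0 \<or> 2 ^ (K - 1) < N" for Q c N K :: nat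
  proof (cases "K \<le> 3")
    case True
    have "real K + 2 \<le> 8 / \<delta> * \<delta>" using True \<delta> by simp
    also have "\<dots> \<le> (8 / \<delta>) * loglog (real Q * sqrt (real c))"
      using \<delta>(1) \<delta>(3)[OF that(1,2)] by (intro mult_left_mono) auto
    finally show ?thesis .
  next
    case False
    let ?X = "real Q * sqrt (real c)"
    have K4: "K \<ge> 4" "2 ^ (K - 1) < N" using False K by auto
    have "(1 :: nat) < 2 ^ (K - 1)" using K4(1) by (intro one_less_power) auto
    then have N2: "N \<ge> 2" "2 ^ (N - 1) < Q" using K4 N by auto
    have "real (2 ^ (N - 1)) * 1 \<le> ?X"
      using N2 that(2) by (intro mult_mono) (auto simp del: of_nat_power simp: less_imp_le)
    then have "ln (2 ^ (N - 1)) \<le> ln ?X" by (intro ln_mono) auto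
    then have "real (N - 1) * ln 2 \<le> ln ?X" by (simp add: ln_realpow)
    moreover have "2 ^ (K - 2) * (2 / 3) \<le> real (N - 1) * ln 2"
    proof (intro mult_mono ln2_ge_two_thirds)
      have "2 ^ (K - 1) = 2 * (2 :: nat) ^ (K - 2)" using K4(1) by (cases K; cases "K - 1") auto
      then have "2 ^ (K - 2) \<le> N - 1" using K4 by linarith
      then show "2 ^ (K - 2) \<le> real (N - 1)" by (metis of_nat_le_iff of_nat_numeral of_nat_power)
    qed auto
    ultimately have lnX: "2 ^ (K - 2) * (2 / 3) \<le> ln ?X" by linarith
    have "ln (2 ^ (K - 2) * (2 / 3)) \<le> ln (ln ?X)" using lnX by (intro ln_mono) auto
    also have "ln (2 ^ (K - 2) * (2 / 3 :: real)) = real (K - 2) * ln 2 + ln (2 / 3)"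
      by (subst ln_mult_pos) (auto simp: ln_realpow)
    finally have 1: "real (K - 2) * ln 2 + ln (2 / 3) \<le> ln (ln ?X)" .
    have 2: "- (1 / 2) \<le> ln (2 / 3 :: real)"
      using ln_le_minus_one[of "3 / 2 :: real"] ln_div[of 2 "3 :: real"] ln_div[of 3 "2 :: real"] by simp
    have 3: "real (K - 2) * (2 / 3) \<le> real (K - 2) * ln 2"
      by (intro mult_left_mono ln2_ge_two_thirds) auto
    have K2: "real (K - 2) = real K - 2" using K4 by simp
    have main: "(real K - 2) * (2 / 3) - 1 / 2 \<le> ln (ln ?X)" using 1 2 3 unfolding K2 by linarith
    \<comment> \<open>K >= 4 also yields \<open>ln ?X\<close> >= 8/3 > 1, so \<open>loglog\<close>
      is the genuine double logarithm here.\<close>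
    have "(2 :: real) ^ 2 * (2 / 3) \<le> 2 ^ (K - 2) * (2 / 3)"
      using K4 by (intro mult_right_mono power_increasing) auto
    then have "1 < ln ?X" using lnX by simp
    moreover have "?X > 0" using that by auto
    ultimately have "exp 1 < ?X" by (metis exp_less_cancel_iff exp_ln)
    then have "loglog ?X = ln (ln ?X)" by (simp add: loglog_def)
    moreover have "real K + 2 \<le> 8 * ln (ln ?X)"
    proof -
      have "4 \<le> real K" using K4(1) by simp
      with main show ?thesis by argo
    qed
    moreover have "8 * ln (ln ?X) \<le> (8 / \<delta>) * ln (ln ?X)"
      using \<delta> \<open>1 < ln ?X\<close> by (intro mult_right_mono) (auto simp: field_simps)
    ultimately show ?thesis by simp
  qed
  moreover have "8 / \<delta> > 0" using \<delta> by simp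
  ultimately show ?thesis using that by blast
qed

lemma ennreal_power2_le_cancel: "a\<^sup>2 \<le> b\<^sup>2 \<Longrightarrow> a \<le> (b :: ennreal)"
proof (rule ccontr)
  assume le: "a\<^sup>2 \<le> b\<^sup>2" and "\<not> a \<le> b"
  then have "b < a" by simp
  then obtain b' where b': "b = ennreal b'" "b' \<ge> 0" by (cases b) auto
  have "a \<noteq> top"
  proof
    assume "a = top"
    then have "a\<^sup>2 = top" by (simp only: power2_eq_square ennreal_top_mult ennreal_top_neq_zero if_False)
    moreover have "b\<^sup>2 = ennreal (b'\<^sup>2)" using b' by (simp add: ennreal_power)
    ultimately show False using le by (simp add: top_unique)
  qed
  then obtain a' where a': "a = ennreal a'" "a' \<ge> 0" by (cases a) auto
  have "a'\<^sup>2 \<le> b'\<^sup>2" using le a' b' by (simp add: ennreal_power)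
  then have "a' \<le> b'" using b'(2) by (rule power2_le_imp_le)
  then show False using \<open>b < a\<close> a' b' by (simp add: ennreal_less_iff)
qed

text \<open>The trivial family is where the addition of the two parameters starts.\<close>

lemma max_bound_unit: "max_bound {()} (\<lambda>_ _. 1) 1"
  unfolding max_bound_def
proof (intro conjI ballI)
  fix f :: "real \<times> real \<Rightarrow> complex" assume f: "f \<in> L2"
  have "(\<integral>\<^sup>+x. (max_op {()} (\<lambda>_ _. 1) f x)\<^sup>2 \<partial>lborel) = nsq f"
    unfolding nsq_def
    by (intro nn_integral_cong_AE)
       (use mult_op_one[OF f] in \<open>eventually_elim, simp add: max_op_def ennreal_power\<close>)
  then show "(\<integral>\<^sup>+x. (max_op {()} (\<lambda>_ _. 1) f x)\<^sup>2 \<partial>lborel) \<le> ennreal 1 * nsq f" by simp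
qed auto

section \<open>The rectangles around separated frequencies\<close>

locale separated_frequencies =
  fixes Q1 Q2 :: nat and \<Lambda> :: "(real \<times> real) set"
  assumes Q: "Q1 \<ge> 1" "Q2 \<ge> 1" and fin: "finite \<Lambda>"
    and lattice: "\<Lambda> \<subseteq> {(of_int a / real Q1, of_int b / real Q2) | (a::int) (b::int). True}"
    and separated: "\<And>l l'. l \<in> \<Lambda> \<Longrightarrow> l' \<in> \<Lambda> \<Longrightarrow> l \<noteq> l' \<Longrightarrow> max \<bar>fst l - fst l'\<bar> \<bar>snd l - snd l'\<bar> \<ge> 1"
begin

text \<open>All rectangles lie in open unit squares about their centres, and two such squares that
  meet have centres at distance less than 1 in both coordinates.\<close>

lemma R_unique:
  assumes "l \<in> \<Lambda>" "l' \<in> \<Lambda>" "\<xi> \<in> R l m1 m2" "\<xi> \<in> R l' n1 n2"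
  shows "l = l'"
proof (rule ccontr)
  assume ne: "l \<noteq> l'"
  have "\<xi> \<in> R l 0 0" "\<xi> \<in> R l' 0 0" using assms(3,4) R_mono[of 0 _ 0] by blast+
  then have "\<bar>fst l - fst l'\<bar> < 1" "\<bar>snd l - snd l'\<bar> < 1"
    unfolding mem_R_iff by (simp_all add: abs_if split: if_splits)
  then show False using separated[OF assms(1,2) ne] by simp
qed

definition S1 :: "nat \<Rightarrow> (real \<times> real) set" where "S1 n = (\<Union>l\<in>\<Lambda>. R l n 0)"
definition S2 :: "nat \<Rightarrow> (real \<times> real) set" where "S2 n = (\<Union>l\<in>\<Lambda>. R l 0 n)"

lemma S_borel: "S1 n \<in> sets borel" "S2 n \<in> sets borel"
  unfolding S1_def S2_def using fin by (auto intro!: sets.finite_UN R_borel)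

lemma S_decreasing: "m \<le> n \<Longrightarrow> S1 n \<subseteq> S1 m" "m \<le> n \<Longrightarrow> S2 n \<subseteq> S2 m"
  unfolding S1_def S2_def by (intro UN_mono R_mono; simp)+

text \<open>The coordinate \<open>\<pi>\<close> is a parameter so that \<open>S1\<close> and
  \<open>S2\<close> are treated at once. A point of the union belongs to the unit square of exactly
  one frequency, so this frequency alone decides membership at every smaller scale.\<close>

lemma coordinate_local:
  fixes \<pi> :: "real \<times> real \<Rightarrow> real" and T :: "real \<times> real \<Rightarrow> nat \<Rightarrow> (real \<times> real) set"
  assumes sub: "\<And>l n. T l n \<subseteq> R l 0 0"
    and mem: "\<And>l m n \<xi>. \<xi> \<in> T l m \<Longrightarrow> \<xi> \<in> T l n \<longleftrightarrow> \<bar>\<pi> \<xi> - \<pi> l\<bar> < 1 / 2 ^ (n + 1)"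
    and int: "\<And>l. l \<in> \<Lambda> \<Longrightarrow> \<exists>k :: int. Q * \<pi> l = of_int k"
    and inner: "\<And>\<xi>. \<xi> \<bullet> a = \<pi> \<xi> * Q"
    and \<xi>: "\<xi> \<in> (\<Union>l\<in>\<Lambda>. T l N)"
  shows "\<exists>\<eta>. \<bar>\<eta>\<bar> < 1 / 2 ^ (N + 1) \<and>
    char2 \<xi> a = iexp (- (2 * pi * (Q * \<eta>))) \<and>
    (\<forall>n\<ge>N. \<xi> \<in> (\<Union>l\<in>\<Lambda>. T l n) \<longleftrightarrow> \<bar>\<eta>\<bar> < 1 / 2 ^ (n + 1))"
proof -
  obtain l where l: "l \<in> \<Lambda>" "\<xi> \<in> T l N" using \<xi> by auto
  obtain k :: int where "Q * \<pi> l = of_int k" using int[OF l(1)] by blast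
  from exp_periodic_cong[OF this, of "\<pi> \<xi>"]
  have "char2 \<xi> a = iexp (- (2 * pi * (Q * (\<pi> \<xi> - \<pi> l))))"
    by (simp only: inner)
  moreover have "\<xi> \<in> (\<Union>l\<in>\<Lambda>. T l n) \<longleftrightarrow> \<bar>\<pi> \<xi> - \<pi> l\<bar> < 1 / 2 ^ (n + 1)" for n
  proof -
    have "\<xi> \<in> (\<Union>l\<in>\<Lambda>. T l n) \<longleftrightarrow> \<xi> \<in> T l n"
      using l R_unique[OF l(1) _ subsetD[OF sub l(2)] subsetD[OF sub]] by blast
    then show ?thesis using mem[OF l(2)] by blast
  qed
  moreover have "\<bar>\<pi> \<xi> - \<pi> l\<bar> < 1 / 2 ^ (N + 1)" using l(2) mem by blast
  ultimately show ?thesis by blast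
qed

lemma S_local:
  "\<xi> \<in> S1 N \<Longrightarrow> \<exists>\<eta>. \<bar>\<eta>\<bar> < 1 / 2 ^ (N + 1) \<and>
    exp (- 2 * pi * \<i> * of_real (\<xi> \<bullet> (real Q1, 0))) = iexp (- (2 * pi * (real Q1 * \<eta>))) \<and>
    (\<forall>n\<ge>N. \<xi> \<in> S1 n \<longleftrightarrow> \<bar>\<eta>\<bar> < 1 / 2 ^ (n + 1))"
  "\<xi> \<in> S2 N \<Longrightarrow> \<exists>\<eta>. \<bar>\<eta>\<bar> < 1 / 2 ^ (N + 1) \<and>
    exp (- 2 * pi * \<i> * of_real (\<xi> \<bullet> (0, real Q2))) = iexp (- (2 * pi * (real Q2 * \<eta>))) \<and>
    (\<forall>n\<ge>N. \<xi> \<in> S2 n \<longleftrightarrow> \<bar>\<eta>\<bar> < 1 / 2 ^ (n + 1))"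
proof -
  have int: "\<exists>k :: int. real Q1 * fst l = of_int k" "\<exists>k :: int. real Q2 * snd l = of_int k" if l: "l \<in> \<Lambda>" for l
  proof -
    obtain a b :: int where "l = (of_int a / real Q1, of_int b / real Q2)" using lattice l by blast
    then have "real Q1 * fst l = of_int a" "real Q2 * snd l = of_int b" using Q by auto
    then show "\<exists>k :: int. real Q1 * fst l = of_int k" "\<exists>k :: int. real Q2 * snd l = of_int k" by blast+
  qed
  show "\<exists>\<eta>. \<bar>\<eta>\<bar> < 1 / 2 ^ (N + 1) \<and>
    exp (- 2 * pi * \<i> * of_real (\<xi> \<bullet> (real Q1, 0))) = iexp (- (2 * pi * (real Q1 * \<eta>))) \<and>
    (\<forall>n\<ge>N. \<xi> \<in> S1 n \<longleftrightarrow> \<bar>\<eta>\<bar> < 1 / 2 ^ (n + 1))" if "\<xi> \<in> S1 N"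
    using that unfolding S1_def
    by (intro coordinate_local[where \<pi>=fst] int R_mono) (simp_all add: mem_R_iff inner_prod_def)
  show "\<exists>\<eta>. \<bar>\<eta>\<bar> < 1 / 2 ^ (N + 1) \<and>
    exp (- 2 * pi * \<i> * of_real (\<xi> \<bullet> (0, real Q2))) = iexp (- (2 * pi * (real Q2 * \<eta>))) \<and>
    (\<forall>n\<ge>N. \<xi> \<in> S2 n \<longleftrightarrow> \<bar>\<eta>\<bar> < 1 / 2 ^ (n + 1))" if "\<xi> \<in> S2 N"
    using that unfolding S2_def
    by (intro coordinate_local[where \<pi>=snd] int R_mono) (simp_all add: mem_R_iff inner_prod_def)
qed

text \<open>A point in both unions could a priori come from two different frequencies; separation
  makes them equal, which gives the product form. The factors 1 match \<open>mult_op_sum\<close> on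
  the left and the family of \<open>max_bound_unit\<close> on the right.\<close>

lemma sum_indicator_R:
  "(\<Sum>l\<in>\<Lambda>. 1 * indicator (R l n1 n2) \<xi>) = (indicator (S1 n1) \<xi> * (indicator (S2 n2) \<xi> * 1) :: complex)"
proof (cases "\<xi> \<in> S1 n1 \<and> \<xi> \<in> S2 n2")
  case True
  then obtain l l' where l: "l \<in> \<Lambda>" "\<xi> \<in> R l n1 0" "l' \<in> \<Lambda>" "\<xi> \<in> R l' 0 n2"
    by (auto simp: S1_def S2_def)
  have "l' = l" using R_unique l by blast
  with l have lR: "\<xi> \<in> R l n1 n2" unfolding mem_R_iff by blast
  have "(\<Sum>l\<in>\<Lambda>. 1 * indicator (R l n1 n2) \<xi>) = (\<Sum>l'\<in>\<Lambda>. if l' = l then 1 else (0::complex))"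
  proof (intro sum.cong refl)
    show "1 * indicator (R l' n1 n2) \<xi> = (if l' = l then 1 else (0::complex))" if "l' \<in> \<Lambda>" for l'
      using lR R_unique[OF that l(1) _ lR] by (cases "\<xi> \<in> R l' n1 n2") auto
  qed
  then show ?thesis using True l(1) fin by simp
next
  case False
  have "\<xi> \<notin> R l n1 n2" if "l \<in> \<Lambda>" for l
    using False that R_mono[of n1 n1 0 n2 l] R_mono[of 0 n1 n2 n2 l] by (auto simp: S1_def S2_def)
  then show ?thesis using False by (auto simp: indicator_def)
qed

lemma maximal_bound:
  assumes N1: "Q1 \<le> 2 ^ N1" "N1 = 0 \<or> 2 ^ (N1 - 1) < Q1" "N1 \<le> 2 ^ K1"
    and N2: "Q2 \<le> 2 ^ N2" "N2 = 0 \<or> 2 ^ (N2 - 1) < Q2" "N2 \<le> 2 ^ K2" and f: "f \<in> L2"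
  shows "L2_norm (\<lambda>x. SUP (n1, n2) \<in> UNIV.
      ennreal (cmod (\<Sum>l\<in>\<Lambda>. inv_fourier (\<lambda>\<xi>. indicator (R l n1 n2) \<xi> * fourier f \<xi>) x)))
    \<le> ennreal (30 * (real K1 + 2) * (real K2 + 2)) * L2_norm (\<lambda>x. ennreal (cmod (f x)))"
proof -
  have Qle: "0 < real q" "real q \<le> 2 ^ n" "2 ^ n \<le> 2 * real q"
    if "1 \<le> q" "q \<le> 2 ^ n" "n = 0 \<or> 2 ^ (n - 1) < q" for q n :: nat
  proof -
    show "0 < real q" using that by simp
    show "real q \<le> 2 ^ n" using that(2) by (metis of_nat_le_iff of_nat_numeral of_nat_power)
    have "2 ^ n \<le> 2 * q" using that by (cases n) auto
    then have "real (2 ^ n) \<le> real (2 * q)" by (simp only: of_nat_le_iff)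
    then show "2 ^ n \<le> 2 * real q" by simp
  qed
  let ?g = "\<lambda>n1 n2 x. \<Sum>l\<in>\<Lambda>. inv_fourier (\<lambda>\<xi>. indicator (R l n1 n2) \<xi> * fourier f \<xi>) x"
  \<comment> \<open>C^2 is the product of the two one-parameter constants 30 (K + 2)^2 for squared
    norms.\<close>
  define C where "C = 30 * (real K1 + 2) * (real K2 + 2)"
  define v2 where "v2 = (\<lambda>(n, u::unit) \<xi>. indicator (S2 n) \<xi> * (1 :: complex))"
  define v1 where "v1 = (\<lambda>(n, p) \<xi>. indicator (S1 n) \<xi> * v2 p \<xi>)"
  \<comment> \<open>The second coordinate is added to the trivial family, then the first coordinate
    to the result; the nested index set records this order.\<close>
  have "max_bound (UNIV \<times> {()}) v2 (1 * (30 * (real K2 + 2)\<^sup>2))"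
    unfolding v2_def
    by (rule max_bound_all_scales[OF max_bound_unit S_borel(2) S_decreasing(2) Qle[OF Q(2) N2(1,2)] N2(3) S_local(2)])
  then have "max_bound (UNIV \<times> (UNIV \<times> {()})) v1 ((1 * (30 * (real K2 + 2)\<^sup>2)) * (30 * (real K1 + 2)\<^sup>2))"
    unfolding v1_def
    by (rule max_bound_all_scales[OF _ S_borel(1) S_decreasing(1) Qle[OF Q(1) N1(1,2)] N1(3) S_local(1)])
  also have "(1 * (30 * (real K2 + 2)\<^sup>2)) * (30 * (real K1 + 2)\<^sup>2) = C\<^sup>2"
    by (simp add: C_def power2_eq_square algebra_simps)
  finally have bound: "(\<integral>\<^sup>+x. (max_op (UNIV \<times> (UNIV \<times> {()})) v1 f x)\<^sup>2 \<partial>lborel) \<le> ennreal (C\<^sup>2) * nsq f"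
    using f by (rule max_boundD(4))
  have AE: "AE x in lborel. \<forall>(n1, n2)\<in>UNIV.
    ?g n1 n2 x = mult_op (v1 (n1, n2, ())) f x"
  proof (rule AE_ball_countable'[OF _ countableI_type], clarify)
    fix n1 n2
    have "AE x in lborel. mult_op (\<lambda>\<xi>. \<Sum>l\<in>\<Lambda>. 1 * indicator (R l n1 n2) \<xi>) f x = (\<Sum>l\<in>\<Lambda>. 1 * mult_op (indicator (R l n1 n2)) f x)"
      by (intro mult_op_sum fin f bdd_mult_indicator R_borel)
    then show "AE x in lborel. ?g n1 n2 x = mult_op (v1 (n1, n2, ())) f x"
      unfolding sum_indicator_R by eventually_elim (simp add: mult_op_def v1_def v2_def)
  qed
  have "(L2_norm (\<lambda>x. SUP (n1, n2) \<in> UNIV. ennreal (cmod (?g n1 n2 x))))\<^sup>2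
    = (\<integral>\<^sup>+x. (SUP (n1, n2) \<in> UNIV. ennreal (cmod (?g n1 n2 x)))\<^sup>2 \<partial>lborel)"
    by (rule L2_norm_squared)
  also have "\<dots> \<le> (\<integral>\<^sup>+x. (max_op (UNIV \<times> (UNIV \<times> {()})) v1 f x)\<^sup>2 \<partial>lborel)"
  proof (rule nn_integral_mono_AE)
    show "AE x in lborel. (SUP (n1, n2) \<in> UNIV. ennreal (cmod (?g n1 n2 x)))\<^sup>2
      \<le> (max_op (UNIV \<times> (UNIV \<times> {()})) v1 f x)\<^sup>2"
      using AE
    proof eventually_elim
      fix x assume eq: "\<forall>(n1, n2)\<in>UNIV.
        ?g n1 n2 x = mult_op (v1 (n1, n2, ())) f x"
      have "(SUP (n1, n2) \<in> UNIV. ennreal (cmod (?g n1 n2 x)))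
        \<le> max_op (UNIV \<times> (UNIV \<times> {()})) v1 f x"
      proof (rule SUP_least, clarify)
        fix n1 n2
        have "?g n1 n2 x = mult_op (v1 (n1, n2, ())) f x"
          using eq by blast
        then show "ennreal (cmod (?g n1 n2 x))
          \<le> max_op (UNIV \<times> (UNIV \<times> {()})) v1 f x"
          unfolding max_op_def by (simp only:) (rule SUP_upper, simp)
      qed
      then show "(SUP (n1, n2) \<in> UNIV. ennreal (cmod (?g n1 n2 x)))\<^sup>2
        \<le> (max_op (UNIV \<times> (UNIV \<times> {()})) v1 f x)\<^sup>2"
        by (rule power_mono) simp
    qed
  qed
  also have "\<dots> \<le> ennreal (C\<^sup>2) * nsq f" by (rule bound)
  also have "\<dots> = (ennreal C * L2_norm (\<lambda>x. ennreal (cmod (f x))))\<^sup>2"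
    unfolding power_mult_distrib L2_norm_cmod_squared by (simp add: ennreal_power C_def)
  finally show ?thesis unfolding C_def by (rule ennreal_power2_le_cancel)
qed

end

theorem theorem1:
  shows "\<exists>C::real. C > 0 \<and>
    (\<forall>(Q1::nat) (Q2::nat) (\<Lambda> :: (real \<times> real) set).
      Q1 \<ge> 1 \<longrightarrow> Q2 \<ge> 1 \<longrightarrow> finite \<Lambda> \<longrightarrow>
      \<Lambda> \<subseteq> {(of_int a / real Q1, of_int b / real Q2) | (a::int) (b::int). True} \<longrightarrow>
      (\<forall>l\<in>\<Lambda>. \<forall>l'\<in>\<Lambda>. l \<noteq> l' \<longrightarrow>
        max \<bar>fst l - fst l'\<bar> \<bar>snd l - snd l'\<bar> \<ge> 1) \<longrightarrow>
      (\<forall>f\<in>L2.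
        L2_norm (\<lambda>x. SUP (n1, n2) \<in> UNIV.
          ennreal (cmod (\<Sum>l\<in>\<Lambda>. inv_fourier (\<lambda>\<xi>. indicator (R l n1 n2) \<xi> * fourier f \<xi>) x)))
        \<le> ennreal (C * loglog (real Q1 * sqrt (real (card \<Lambda>))) * loglog (real Q2 * sqrt (real (card \<Lambda>))))
          * L2_norm (\<lambda>x. ennreal (cmod (f x)))))"
proof -
  obtain C where C: "C > 0" "\<And>(Q :: nat) (c :: nat) N K. Q \<ge> 1 \<Longrightarrow> c \<ge> 1 \<Longrightarrow> N = 0 \<or> 2 ^ (N - 1) < Q \<Longrightarrow>
    K = 0 \<or> 2 ^ (K - 1) < N \<Longrightarrow> real K + 2 \<le> C * loglog (real Q * sqrt (real c))"
    using dyadic_exponent_le_loglog by metis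
  show ?thesis
  proof (intro exI[of _ "30 * C * C"] conjI allI impI ballI)
    show "30 * C * C > 0" using C(1) by simp
    fix Q1 Q2 :: nat and \<Lambda> :: "(real \<times> real) set" and f
    assume Q: "Q1 \<ge> 1" "Q2 \<ge> 1" and fin: "finite \<Lambda>"
      and lat: "\<Lambda> \<subseteq> {(of_int a / real Q1, of_int b / real Q2) | (a::int) (b::int). True}"
      and sep: "\<forall>l\<in>\<Lambda>. \<forall>l'\<in>\<Lambda>. l \<noteq> l' \<longrightarrow> max \<bar>fst l - fst l'\<bar> \<bar>snd l - snd l'\<bar> \<ge> 1" and f: "f \<in> L2"
    let ?L = "\<lambda>Q. loglog (real Q * sqrt (real (card \<Lambda>)))"
    show "L2_norm (\<lambda>x. SUP (n1, n2) \<in> UNIV.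
          ennreal (cmod (\<Sum>l\<in>\<Lambda>. inv_fourier (\<lambda>\<xi>. indicator (R l n1 n2) \<xi> * fourier f \<xi>) x)))
        \<le> ennreal (30 * C * C * ?L Q1 * ?L Q2) * L2_norm (\<lambda>x. ennreal (cmod (f x)))"
    proof (cases "\<Lambda> = {}")
      \<comment> \<open>\<open>C(2)\<close> assumes positive cardinality; with no frequencies the
        sum is 0 and so is its norm.\<close>
      case True
      then show ?thesis by (simp add: L2_norm_def case_prod_unfold)
    next
      case False
      interpret separated_frequencies Q1 Q2 \<Lambda>
        using Q fin lat sep by unfold_locales auto
      have c: "card \<Lambda> \<ge> 1" using False fin by (simp add: Suc_le_eq card_gt_0_iff)
      have scale: "\<exists>N K. q \<le> 2 ^ N \<and> (N = 0 \<or> 2 ^ (N - 1) < q) \<and> N \<le> 2 ^ K \<and> real K + 2 \<le> C * ?L q"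
        if q: "q \<ge> 1" for q :: nat
      proof -
        obtain N where N: "q \<le> 2 ^ N" "N = 0 \<or> 2 ^ (N - 1) < q" using dyadic_exponent_exists[OF q] by blast
        obtain K where K: "N \<le> 2 ^ K" "K = 0 \<or> 2 ^ (K - 1) < N"
        \<comment> \<open>\<open>dyadic_exponent_exists\<close> requires a positive number, but q =
          1 leads to N = 0, where K = 0 serves.\<close>
        proof (cases "N = 0")
          case True
          then show ?thesis using that[of 0] by simp
        next
          case False
          then show ?thesis using dyadic_exponent_exists[of N] that by auto
        qed
        from C(2)[OF q c N(2) K(2)] N K show ?thesis by blast
      qed
      obtain N1 K1 where 1: "Q1 \<le> 2 ^ N1" "N1 = 0 \<or> 2 ^ (N1 - 1) < Q1" "N1 \<le> 2 ^ K1" "real K1 + 2 \<le> C * ?L Q1"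
        using scale[OF Q(1)] by blast
      obtain N2 K2 where 2: "Q2 \<le> 2 ^ N2" "N2 = 0 \<or> 2 ^ (N2 - 1) < Q2" "N2 \<le> 2 ^ K2" "real K2 + 2 \<le> C * ?L Q2"
        using scale[OF Q(2)] by blast
      have "30 * ((real K1 + 2) * (real K2 + 2)) \<le> 30 * ((C * ?L Q1) * (C * ?L Q2))"
        using 1(4) 2(4) by (intro mult_left_mono mult_mono) auto
      then have "30 * (real K1 + 2) * (real K2 + 2) \<le> 30 * C * C * ?L Q1 * ?L Q2"
        by (simp only: mult_ac)
      then show ?thesis
        using maximal_bound[OF 1(1-3) 2(1-3) f]
        by (elim order_trans) (intro mult_right_mono ennreal_leI, auto)
    qed
  qed
qed

end
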